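(* Let $n\ge2$ and let $\rho$ be an irreducible unitary representation of $\mathbb G^{[n]}$. Then the center of the semigroup $\mathrm{End}(\infty)$ acts in $\rho$ (via the extension $\overline\rho$ of $\rho$ to $\mathrm{End}(\infty)$) by scalar operators; consequently, one gets a homomorphism $\chi_\rho$ of the semigroup $\Delta=K\backslash\mathbb G^{[n]}/K$ to the multiplicative semigroup of $\mathbb C$, where $\chi_\rho(\mathfrak c)$ is the scalar by which the central element $z_{\mathfrak c}\in\mathrm{End}(\infty)$ corresponding to $\mathfrak c\in\Delta$ acts.
   Context: Group. $S_\infty$ is the group of all permutations of $\mathbb N$; $S_\infty(\alpha)$ is the pointwise stabilizer of $1,\dots,\alpha$; $S_\infty^{fin}$ is the group of finitely supported permutations. $\mathbb G^{[n]}$ is the group of $n$-tuples $(g_1,\dots,g_n)\in S_\infty^n$ with $g_ig_j^{-1}\in S_\infty^{fin}$ for all $i,j$; $K$ and $K(\alpha)$ are the diagonal copies of $S_\infty$ and $S_\infty(\alpha)$. $\mathbb G^{[n]}$ carries the group topology in which the $K(\alpha)$ are open and form a base of neighborhoods of the identity; unitary representations are continuous. Boards. A morphism $\beta\to\alpha$ ($\alpha,\beta\in\{0,1,2,\dots,\infty\}$) is (an isomorphism class of) a finite or countable disjoint union of compact closed oriented surfaces tiled by $n$-gons colored black and white (neighbors have opposite colors), with edges colored $1,\dots,n$ so that each black (white) $n$-gon has sides $1,\dots,n$ in anticlockwise (clockwise) order, together with an injective map from $\{1,\dots,\beta\}$ to black faces and an injective map from $\{1,\dots,\alpha\}$ to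 white faces (labels; for $\infty$ the label set is $\mathbb N$), such that almost all (all but finitely many) components are chebureks and there are no empty chebureks. A cheburek is a component made of one black and one white $n$-gon glued along their whole perimeters by colors; it is written $(p/q)$ according to the labels of its black/white face, and is empty if neither face is labeled. The set of morphisms is $\mathrm{Mor}(\beta,\alpha)$, and $\mathrm{End}(\alpha)=\mathrm{Mor}(\alpha,\alpha)$. The product $\mathfrak a\circ\mathfrak b$ of $\mathfrak a\in\mathrm{Mor}(\beta,\alpha)$ and $\mathfrak b\in\mathrm{Mor}(\gamma,\beta)$: for each $j\le\beta$ cut out the black face of $\mathfrak a$ with label $j$ and the white face of $\mathfrak b$ with label $j$, glue the perimeters of the two holes by colors, and discard empty chebureks. For finite $\alpha,\beta$, $\mathrm{Mor}(\beta,\alpha)$ is identified with $K(\alpha)\backslash\mathbb G^{[n]}/K(\beta)$: for $\mathbf g$ take black $n$-gons $A_m$ and white $n$-gons $B_m$, $m\in\mathbb N$, glue side $i$ of $A_m$ to side $i$ of $B_{g_i(m)}$, forget black numbers $>\beta$ and white numbers $>\alpha$, delete empty chebureks. Similarly $\mathbb G^{[n]}$ is identified with the group of invertible elements of $\mathrm{End}(\infty)$ (all faces labeled). The semigroup $\Delta=\mathrm{End}(0)=K\backslash\mathbb G^{[n]}/K$ consists of non-labeled boards, with disjoint union as product. For $\mathfrak c\in\Delta$, $z_{\mathfrak c}\in\mathrm{End}(\infty)$ is the disjoint union of $\mathfrak c$ and the chebureks $(j/j)$, $j\in\mathbb N$; the map $\mathfrak c\mapsto z_{\mathfrak c}$ is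 an isomorphism of $\Delta$ onto the center of $\mathrm{End}(\infty)$. Extension $\overline\rho$. Let $H(\beta)$ be the space of $K(\beta)$-fixed vectors of $\rho$ and $P(\beta)$ the orthogonal projection to it. For $\mathfrak b\in\mathrm{End}(\beta)$, $\beta<\infty$, $\overline\rho(\mathfrak b):=P(\beta)\rho(\mathbf g)P(\beta)$ for any $\mathbf g$ in the double coset $\mathfrak b$. For $\mathfrak c\in\mathrm{End}(\infty)$, $\overline\rho(\mathfrak c)$ is the weak operator limit as $\beta\to\infty$ of $\overline\rho(\mathfrak c_\beta)P(\beta)$, where $\mathfrak c_\beta\in\mathrm{End}(\beta)$ is obtained from $\mathfrak c$ by removing all labels $>\beta$ and deleting empty chebureks. This is a representation of $\mathrm{End}(\infty)$ extending $\rho$. *)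

theory Defs
  imports "HOL-Analysis.Analysis" "HOL-Algebra.Product_Groups" "HOL-Algebra.Bij" "HOL-Library.Extended_Nat"
begin

section \<open>Complex Hilbert spaces\<close>

text \<open>
  A complex Hilbert space is a real Hilbert space whose scalar multiplication is extended to
  the complex numbers and whose real inner product is the real part of a Hermitian form.
  The norm is the one of \<^class>\<open>real_inner\<close>.
\<close>

class chilbert_space = real_inner + complete_space +
  fixes scaleC :: "complex \<Rightarrow> 'a \<Rightarrow> 'a" (infixr "*\<^sub>C" 75)
    and cinner :: "'a \<Rightarrow> 'a \<Rightarrow> complex"
  assumes scaleC_add_right: "a *\<^sub>C (x + y) = a *\<^sub>C x + a *\<^sub>C y"
    and scaleC_add_left: "(a + b) *\<^sub>C x = a *\<^sub>C x + b *\<^sub>C x"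
    and scaleC_scaleC: "a *\<^sub>C b *\<^sub>C x = (a * b) *\<^sub>C x"
    and scaleR_scaleC: "r *\<^sub>R x = complex_of_real r *\<^sub>C x"
    and cinner_commute: "cinner x y = cnj (cinner y x)"
    and cinner_add_left: "cinner (x + y) z = cinner x z + cinner y z"
    and cinner_scaleC_left: "cinner (a *\<^sub>C x) y = a * cinner x y"
    and inner_cinner: "inner x y = Re (cinner x y)"

instantiation complex :: chilbert_space
begin
definition scaleC_complex :: "complex \<Rightarrow> complex \<Rightarrow> complex" where "scaleC_complex a x = a * x"
definition cinner_complex :: "complex \<Rightarrow> complex \<Rightarrow> complex" where "cinner_complex x y = x * cnj y"
instance
  by standard
    (auto simp: scaleC_complex_def cinner_complex_def algebra_simps inner_complex_def
      scaleR_conv_of_real)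
end

definition csubspace :: "'h::chilbert_space set \<Rightarrow> bool" where
  "csubspace V \<longleftrightarrow> subspace V \<and> (\<forall>a. \<forall>x\<in>V. a *\<^sub>C x \<in> V)"

definition unitary :: "('h::chilbert_space \<Rightarrow> 'h) \<Rightarrow> bool" where
  "unitary U \<longleftrightarrow> (\<forall>x y. U (x + y) = U x + U y) \<and> (\<forall>a x. U (a *\<^sub>C x) = a *\<^sub>C U x)
     \<and> (\<forall>x y. cinner (U x) (U y) = cinner x y) \<and> surj U"

definition unitary_group :: "('h::chilbert_space \<Rightarrow> 'h) monoid" where
  "unitary_group = \<lparr>carrier = {U. unitary U}, mult = (\<circ>), one = id\<rparr>"

definition ortho_proj :: "'h::chilbert_space set \<Rightarrow> 'h \<Rightarrow> 'h" where
  "ortho_proj V v = (THE w. w \<in> V \<and> (\<forall>u\<in>V. cinner (v - w) u = 0))"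

section \<open>The group of n-tuples of permutations\<close>

text \<open>
  Positive integers are numbered from 0, so that the set \<open>{1,\<dots>,\<alpha>}\<close> is rendered by
  \<open>labels \<alpha> = {0,\<dots>,\<alpha>-1}\<close>, with \<open>labels \<infinity> = UNIV\<close>.  Colours run through \<open>{1..n}\<close>.
\<close>

definition labels :: "enat \<Rightarrow> nat set" where
  "labels \<alpha> = {j. enat j < \<alpha>}"

abbreviation Sinf :: "(nat \<Rightarrow> nat) monoid" where
  "Sinf \<equiv> BijGroup UNIV"

definition Sinf_stab :: "enat \<Rightarrow> (nat \<Rightarrow> nat) set" where
  "Sinf_stab \<alpha> = {s \<in> carrier Sinf. \<forall>j\<in>labels \<alpha>. s j = j}"

definition Sinf_fin :: "(nat \<Rightarrow> nat) set" where
  "Sinf_fin = {s \<in> carrier Sinf. finite {m. s m \<noteq> m}}"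

definition GG :: "nat \<Rightarrow> (nat \<Rightarrow> nat \<Rightarrow> nat) monoid" where
  "GG n = (product_group {1..n} (\<lambda>_. Sinf))
     \<lparr>carrier := {g \<in> carrier (product_group {1..n} (\<lambda>_. Sinf)).
        \<forall>i\<in>{1..n}. \<forall>j\<in>{1..n}. g i \<otimes>\<^bsub>Sinf\<^esub> inv\<^bsub>Sinf\<^esub> g j \<in> Sinf_fin}\<rparr>"

definition KK :: "nat \<Rightarrow> enat \<Rightarrow> (nat \<Rightarrow> nat \<Rightarrow> nat) set" where
  "KK n \<alpha> = (\<lambda>s. \<lambda>i\<in>{1..n}. s) ` Sinf_stab \<alpha>"

text \<open>The group topology for which the \<open>KK n \<alpha>\<close>, \<open>\<alpha>\<close> finite, are a base at the identity.\<close>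

definition GG_top :: "nat \<Rightarrow> (nat \<Rightarrow> nat \<Rightarrow> nat) topology" where
  "GG_top n = topology (\<lambda>U. U \<subseteq> carrier (GG n) \<and>
     (\<forall>g\<in>U. \<exists>\<alpha>::nat. (\<lambda>k. g \<otimes>\<^bsub>GG n\<^esub> k) ` KK n (enat \<alpha>) \<subseteq> U))"

lemma Sinf_stab_antimono: "\<alpha> \<le> \<beta> \<Longrightarrow> Sinf_stab \<beta> \<subseteq> Sinf_stab \<alpha>"
  by (auto simp: Sinf_stab_def labels_def)

lemma KK_antimono: "\<alpha> \<le> \<beta> \<Longrightarrow> KK n \<beta> \<subseteq> KK n \<alpha>"
  unfolding KK_def using Sinf_stab_antimono by blast

lemma openin_GG_top:
  "openin (GG_top n) U \<longleftrightarrow> U \<subseteq> carrier (GG n) \<and>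
     (\<forall>g\<in>U. \<exists>\<alpha>::nat. (\<lambda>k. g \<otimes>\<^bsub>GG n\<^esub> k) ` KK n (enat \<alpha>) \<subseteq> U)"
proof -
  let ?P = "\<lambda>U. U \<subseteq> carrier (GG n) \<and>
     (\<forall>g\<in>U. \<exists>\<alpha>::nat. (\<lambda>k. g \<otimes>\<^bsub>GG n\<^esub> k) ` KK n (enat \<alpha>) \<subseteq> U)"
  have Int: "?P (S \<inter> T)" if S: "?P S" and T: "?P T" for S T
  proof (intro conjI ballI)
    show "S \<inter> T \<subseteq> carrier (GG n)" using S by blast
    fix g assume g: "g \<in> S \<inter> T"
    obtain a b :: nat where a: "(\<lambda>k. g \<otimes>\<^bsub>GG n\<^esub> k) ` KK n (enat a) \<subseteq> S"
      and b: "(\<lambda>k. g \<otimes>\<^bsub>GG n\<^esub> k) ` KK n (enat b) \<subseteq> T"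
      using S T g by blast
    have "KK n (enat (max a b)) \<subseteq> KK n (enat a)" "KK n (enat (max a b)) \<subseteq> KK n (enat b)"
      by (auto intro!: KK_antimono)
    then show "\<exists>\<alpha>::nat. (\<lambda>k. g \<otimes>\<^bsub>GG n\<^esub> k) ` KK n (enat \<alpha>) \<subseteq> S \<inter> T"
      using a b by (intro exI[of _ "max a b"]) blast
  qed
  have Un: "?P (\<Union>\<K>)" if A: "\<forall>S\<in>\<K>. ?P S" for \<K>
  proof (intro conjI ballI)
    show "\<Union>\<K> \<subseteq> carrier (GG n)" using A by blast
    fix g assume "g \<in> \<Union>\<K>"
    then obtain S where S: "S \<in> \<K>" "g \<in> S" by blast
    then obtain \<alpha> :: nat where "(\<lambda>k. g \<otimes>\<^bsub>GG n\<^esub> k) ` KK n (enat \<alpha>) \<subseteq> S"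
      using A by blast
    then show "\<exists>\<alpha>::nat. (\<lambda>k. g \<otimes>\<^bsub>GG n\<^esub> k) ` KK n (enat \<alpha>) \<subseteq> \<Union>\<K>"
      using S by blast
  qed
  have "istopology ?P"
    unfolding istopology_def
  proof (rule conjI)
    show "\<forall>S T. ?P S \<longrightarrow> ?P T \<longrightarrow> ?P (S \<inter> T)"
      using Int by (intro allI impI)
    show "\<forall>\<K>. (\<forall>S\<in>\<K>. ?P S) \<longrightarrow> ?P (\<Union>\<K>)"
      using Un by (intro allI impI)
  qed
  then show ?thesis
    unfolding GG_top_def by (simp only: topology_inverse')
qed

lemma mult_Sinf:
  "s \<in> carrier Sinf \<Longrightarrow> t \<in> carrier Sinf \<Longrightarrow> s \<otimes>\<^bsub>Sinf\<^esub> t = s \<circ> t"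
  by (auto simp: BijGroup_def compose_def fun_eq_iff)

lemma Sinf_fin_normal: "Sinf_fin \<lhd> Sinf"
proof -
  interpret group Sinf by (rule group_BijGroup)
  have fin_iff: "s \<in> Sinf_fin \<longleftrightarrow> s \<in> carrier Sinf \<and> finite {m. s m \<noteq> m}" for s
    by (simp add: Sinf_fin_def)
  have inv_fix: "(inv\<^bsub>Sinf\<^esub> s) m = m \<longleftrightarrow> s m = m" if "s \<in> carrier Sinf" for s m
  proof -
    have one: "\<one>\<^bsub>Sinf\<^esub> = id" by (auto simp: BijGroup_def)
    have "s \<circ> inv\<^bsub>Sinf\<^esub> s = id" "inv\<^bsub>Sinf\<^esub> s \<circ> s = id"
      using that by (metis mult_Sinf inv_closed r_inv one, metis mult_Sinf inv_closed l_inv one)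
    then have "s ((inv\<^bsub>Sinf\<^esub> s) k) = k" "(inv\<^bsub>Sinf\<^esub> s) (s k) = k" for k
      by (simp_all add: fun_eq_iff)
    then show ?thesis by metis
  qed
  have sub: "subgroup Sinf_fin Sinf"
  proof
    show "Sinf_fin \<subseteq> carrier Sinf" by (auto simp: fin_iff)
    show "\<one>\<^bsub>Sinf\<^esub> \<in> Sinf_fin" using one_closed by (auto simp: fin_iff BijGroup_def)
    fix s assume s: "s \<in> Sinf_fin"
    then show "inv\<^bsub>Sinf\<^esub> s \<in> Sinf_fin" by (auto simp: fin_iff inv_fix)
    fix t assume t: "t \<in> Sinf_fin"
    have "{m. (s \<circ> t) m \<noteq> m} \<subseteq> {m. s m \<noteq> m} \<union> {m. t m \<noteq> m}" by auto
    then show "s \<otimes>\<^bsub>Sinf\<^esub> t \<in> Sinf_fin"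
      using s t m_closed[of s t] finite_subset by (fastforce simp: fin_iff mult_Sinf)
  qed
  have "x \<otimes>\<^bsub>Sinf\<^esub> h \<otimes>\<^bsub>Sinf\<^esub> inv\<^bsub>Sinf\<^esub> x \<in> Sinf_fin"
    if x: "x \<in> carrier Sinf" and h: "h \<in> Sinf_fin" for x h
  proof -
    let ?y = "inv\<^bsub>Sinf\<^esub> x"
    have hc: "h \<in> carrier Sinf" using h by (simp add: fin_iff)
    have eq: "x \<otimes>\<^bsub>Sinf\<^esub> h \<otimes>\<^bsub>Sinf\<^esub> ?y = x \<circ> h \<circ> ?y"
      using x hc by (metis mult_Sinf m_closed inv_closed)
    have one: "\<one>\<^bsub>Sinf\<^esub> = id" by (auto simp: BijGroup_def)
    have "x \<circ> ?y = id" using x by (metis mult_Sinf inv_closed r_inv one)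
    then have xy: "x (?y m) = m" for m by (simp add: fun_eq_iff)
    have "{m. (x \<circ> h \<circ> ?y) m \<noteq> m} \<subseteq> x ` {m. h m \<noteq> m}"
    proof
      fix m assume "m \<in> {m. (x \<circ> h \<circ> ?y) m \<noteq> m}"
      then have "h (?y m) \<noteq> ?y m" using xy[of m] by auto
      then show "m \<in> x ` {m. h m \<noteq> m}" using xy[of m] by (metis (mono_tags) image_iff mem_Collect_eq)
    qed
    moreover have "finite (x ` {m. h m \<noteq> m})" using h by (simp add: fin_iff)
    ultimately have "finite {m. (x \<circ> h \<circ> ?y) m \<noteq> m}" by (rule finite_subset)
    then show ?thesis using x hc eq by (metis fin_iff m_closed inv_closed)
  qed
  then show ?thesis using sub by (simp add: normal_inv_iff)
qed

lemma group_GG: "group (GG n)"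
proof -
  interpret S: group Sinf by (rule group_BijGroup)
  interpret N: normal Sinf_fin Sinf by (rule Sinf_fin_normal)
  let ?P = "product_group {1..n} (\<lambda>_. Sinf)"
  interpret P: group ?P by (rule product_group) (rule S.group_axioms)
  let ?H = "{g \<in> carrier ?P. \<forall>i\<in>{1..n}. \<forall>j\<in>{1..n}.
      g i \<otimes>\<^bsub>Sinf\<^esub> inv\<^bsub>Sinf\<^esub> g j \<in> Sinf_fin}"
  have comp: "g i \<in> carrier Sinf" if "g \<in> carrier ?P" "i \<in> {1..n}" for g i
    using that by (auto simp: PiE_iff)
  have "subgroup ?H ?P"
  proof
    show "?H \<subseteq> carrier ?P" by blast
    show "\<one>\<^bsub>?P\<^esub> \<in> ?H" using P.one_closed by auto
  next
    fix g h assume g: "g \<in> ?H" and h: "h \<in> ?H"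
    have "(g i \<otimes>\<^bsub>Sinf\<^esub> h i) \<otimes>\<^bsub>Sinf\<^esub> inv\<^bsub>Sinf\<^esub> (g j \<otimes>\<^bsub>Sinf\<^esub> h j) \<in> Sinf_fin"
      if i: "i \<in> {1..n}" and j: "j \<in> {1..n}" for i j
    proof -
      have c: "g i \<in> carrier Sinf" "g j \<in> carrier Sinf" "h i \<in> carrier Sinf" "h j \<in> carrier Sinf"
        using comp g h i j by blast+
      have "(g i \<otimes>\<^bsub>Sinf\<^esub> h i) \<otimes>\<^bsub>Sinf\<^esub> inv\<^bsub>Sinf\<^esub> (g j \<otimes>\<^bsub>Sinf\<^esub> h j)
        = (g i \<otimes>\<^bsub>Sinf\<^esub> (h i \<otimes>\<^bsub>Sinf\<^esub> inv\<^bsub>Sinf\<^esub> h j) \<otimes>\<^bsub>Sinf\<^esub> inv\<^bsub>Sinf\<^esub> g i)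
            \<otimes>\<^bsub>Sinf\<^esub> (g i \<otimes>\<^bsub>Sinf\<^esub> inv\<^bsub>Sinf\<^esub> g j)"
        using c S.m_assoc[of "inv\<^bsub>Sinf\<^esub> g i" "g i" "inv\<^bsub>Sinf\<^esub> g j", symmetric]
        by (simp add: S.m_assoc S.inv_mult_group)
      moreover have "g i \<otimes>\<^bsub>Sinf\<^esub> (h i \<otimes>\<^bsub>Sinf\<^esub> inv\<^bsub>Sinf\<^esub> h j) \<otimes>\<^bsub>Sinf\<^esub> inv\<^bsub>Sinf\<^esub> g i \<in> Sinf_fin"
        using N.inv_op_closed2 c h i j by blast
      moreover have "g i \<otimes>\<^bsub>Sinf\<^esub> inv\<^bsub>Sinf\<^esub> g j \<in> Sinf_fin" using g i j by blast
      ultimately show ?thesis by (metis N.m_closed)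
    qed
    then show "g \<otimes>\<^bsub>?P\<^esub> h \<in> ?H" using P.m_closed g h by auto
  next
    fix g assume g: "g \<in> ?H"
    have gc: "g \<in> carrier ?P" using g by blast
    have inv_eq: "inv\<^bsub>?P\<^esub> g = (\<lambda>i\<in>{1..n}. inv\<^bsub>Sinf\<^esub> g i)"
      using gc by (intro inv_product_group) (auto intro: S.group_axioms)
    have "inv\<^bsub>Sinf\<^esub> g i \<otimes>\<^bsub>Sinf\<^esub> inv\<^bsub>Sinf\<^esub> (inv\<^bsub>Sinf\<^esub> g j) \<in> Sinf_fin"
      if i: "i \<in> {1..n}" and j: "j \<in> {1..n}" for i j
    proof -
      have c: "g i \<in> carrier Sinf" "g j \<in> carrier Sinf" using comp gc i j by blast+
      have "inv\<^bsub>Sinf\<^esub> g i \<otimes>\<^bsub>Sinf\<^esub> inv\<^bsub>Sinf\<^esub> (inv\<^bsub>Sinf\<^esub> g j)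
        = inv\<^bsub>Sinf\<^esub> g i \<otimes>\<^bsub>Sinf\<^esub> (g j \<otimes>\<^bsub>Sinf\<^esub> inv\<^bsub>Sinf\<^esub> g i) \<otimes>\<^bsub>Sinf\<^esub> g i"
        using c by (simp add: S.m_assoc)
      then show ?thesis using N.inv_op_closed1 c g i j by auto
    qed
    then show "inv\<^bsub>?P\<^esub> g \<in> ?H"
      using P.inv_closed[OF gc] by (simp add: inv_eq del: atLeastAtMost_iff One_nat_def carrier_product_group)
  qed
  then show ?thesis unfolding GG_def by (rule P.subgroup_imp_group)
qed

section \<open>Unitary representations\<close>

definition unitary_rep :: "nat \<Rightarrow> ((nat \<Rightarrow> nat \<Rightarrow> nat) \<Rightarrow> 'h::chilbert_space \<Rightarrow> 'h) \<Rightarrow> bool" where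
  "unitary_rep n \<rho> \<longleftrightarrow> \<rho> \<in> hom (GG n) unitary_group \<and>
     (\<forall>v. continuous_map (GG_top n) euclidean (\<lambda>g. \<rho> g v))"

definition irreducible_rep :: "nat \<Rightarrow> ((nat \<Rightarrow> nat \<Rightarrow> nat) \<Rightarrow> 'h::chilbert_space \<Rightarrow> 'h) \<Rightarrow> bool" where
  "irreducible_rep n \<rho> \<longleftrightarrow> (\<exists>v::'h. v \<noteq> 0) \<and>
     (\<forall>V. csubspace V \<and> closed V \<and> (\<forall>g\<in>carrier (GG n). \<rho> g ` V \<subseteq> V) \<longrightarrow> V = {0} \<or> V = UNIV)"

definition fixed_space ::
    "nat \<Rightarrow> ((nat \<Rightarrow> nat \<Rightarrow> nat) \<Rightarrow> 'h::chilbert_space \<Rightarrow> 'h) \<Rightarrow> enat \<Rightarrow> 'h set" where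
  "fixed_space n \<rho> \<beta> = {v. \<forall>k\<in>KK n \<beta>. \<rho> k v = v}"

definition fixed_proj ::
    "nat \<Rightarrow> ((nat \<Rightarrow> nat \<Rightarrow> nat) \<Rightarrow> 'h::chilbert_space \<Rightarrow> 'h) \<Rightarrow> enat \<Rightarrow> 'h \<Rightarrow> 'h" where
  "fixed_proj n \<rho> \<beta> = ortho_proj (fixed_space n \<rho> \<beta>)"

section \<open>Boards\<close>

text \<open>
  A tiled surface is recorded by its gluing pattern: \<open>glue X i b\<close> is the white face glued to the
  black face \<open>b\<close> along the side of colour \<open>i\<close>.  Every black face has exactly one side of each
  colour, and so has every white face, so each \<open>glue X i\<close> is a bijection.  Sides of equal colour
  are glued with reversed orientations (anticlockwise order on black faces, clockwise on white
  ones), so the pattern determines the oriented surface, including its vertices, up to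
  isomorphism, and every pattern with finite components arises.  The label \<open>j\<close> sits on the black
  face \<open>blab X j\<close> and/or the white face \<open>wlab X j\<close>; values outside the label sets are irrelevant.
\<close>

record 'f board =
  black :: "'f set"
  white :: "'f set"
  glue :: "nat \<Rightarrow> 'f \<Rightarrow> 'f"
  blab :: "nat \<Rightarrow> 'f"
  wlab :: "nat \<Rightarrow> 'f"

definition adjacent :: "nat \<Rightarrow> 'f board \<Rightarrow> (('f + 'f) \<times> ('f + 'f)) set" where
  "adjacent n X = {(Inl b, Inr (glue X i b)) | i b. i \<in> {1..n} \<and> b \<in> black X}"

definition components_of_board :: "nat \<Rightarrow> 'f board \<Rightarrow> ('f + 'f) set set" where
  "components_of_board n X = Sum_Type.Plus (black X) (white X) // (adjacent n X \<union> (adjacent n X)\<inverse>)\<^sup>*"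

definition cheburek :: "nat \<Rightarrow> 'f board \<Rightarrow> 'f \<Rightarrow> 'f \<Rightarrow> bool" where
  "cheburek n X b w \<longleftrightarrow> b \<in> black X \<and> w \<in> white X \<and> (\<forall>i\<in>{1..n}. glue X i b = w)"

text \<open>Arguments \<open>n \<beta> \<alpha>\<close> below: number of colours, black label set, white label set.\<close>

definition empty_cheburek :: "nat \<Rightarrow> enat \<Rightarrow> enat \<Rightarrow> 'f board \<Rightarrow> 'f \<Rightarrow> 'f \<Rightarrow> bool" where
  "empty_cheburek n \<beta> \<alpha> X b w \<longleftrightarrow>
     cheburek n X b w \<and> b \<notin> blab X ` labels \<beta> \<and> w \<notin> wlab X ` labels \<alpha>"

definition is_board :: "nat \<Rightarrow> enat \<Rightarrow> enat \<Rightarrow> 'f board \<Rightarrow> bool" where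
  "is_board n \<beta> \<alpha> X \<longleftrightarrow>
     (\<forall>i\<in>{1..n}. bij_betw (glue X i) (black X) (white X)) \<and>
     (\<forall>C\<in>components_of_board n X. finite C) \<and>
     inj_on (blab X) (labels \<beta>) \<and> blab X ` labels \<beta> \<subseteq> black X \<and>
     inj_on (wlab X) (labels \<alpha>) \<and> wlab X ` labels \<alpha> \<subseteq> white X \<and>
     finite {C \<in> components_of_board n X. \<not> (\<exists>b w. cheburek n X b w \<and> C = {Inl b, Inr w})} \<and>
     (\<nexists>b w. empty_cheburek n \<beta> \<alpha> X b w)"

definition board_iso :: "nat \<Rightarrow> enat \<Rightarrow> enat \<Rightarrow> 'f board \<Rightarrow> 'g board \<Rightarrow> bool" where
  "board_iso n \<beta> \<alpha> X Y \<longleftrightarrow> (\<exists>\<phi> \<psi>.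
     bij_betw \<phi> (black X) (black Y) \<and> bij_betw \<psi> (white X) (white Y) \<and>
     (\<forall>i\<in>{1..n}. \<forall>b\<in>black X. \<psi> (glue X i b) = glue Y i (\<phi> b)) \<and>
     (\<forall>j\<in>labels \<beta>. \<phi> (blab X j) = blab Y j) \<and> (\<forall>j\<in>labels \<alpha>. \<psi> (wlab X j) = wlab Y j))"

text \<open>
  Since boards have countably many faces, every isomorphism class has representatives whose faces
  are natural numbers; the set of these represents the class.
\<close>

definition board_class :: "nat \<Rightarrow> enat \<Rightarrow> enat \<Rightarrow> 'f board \<Rightarrow> nat board set" where
  "board_class n \<beta> \<alpha> X = {Y. is_board n \<beta> \<alpha> Y \<and> board_iso n \<beta> \<alpha> X Y}"

definition Mor :: "nat \<Rightarrow> enat \<Rightarrow> enat \<Rightarrow> nat board set set" where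
  "Mor n \<beta> \<alpha> = board_class n \<beta> \<alpha> ` {X :: nat board. is_board n \<beta> \<alpha> X}"

definition discard_empty :: "nat \<Rightarrow> enat \<Rightarrow> enat \<Rightarrow> 'f board \<Rightarrow> 'f board" where
  "discard_empty n \<beta> \<alpha> X = X\<lparr>
     black := {b \<in> black X. \<nexists>w. empty_cheburek n \<beta> \<alpha> X b w},
     white := {w \<in> white X. \<nexists>b. empty_cheburek n \<beta> \<alpha> X b w}\<rparr>"

text \<open>
  Black faces of \<open>X\<close> and white faces of \<open>Y\<close> with labels in \<open>labels \<beta>\<close> are cut out.  If the side
  \<open>i\<close> of a black face of \<open>Y\<close> bordered the removed white face with label \<open>j\<close>, it is now glued to
  the white face of \<open>X\<close> that bordered the side \<open>i\<close> of the removed black face with label \<open>j\<close>.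
\<close>

definition cut_and_glue :: "enat \<Rightarrow> 'f board \<Rightarrow> 'g board \<Rightarrow> ('f + 'g) board" where
  "cut_and_glue \<beta> X Y = \<lparr>
     black = Sum_Type.Plus (black X - blab X ` labels \<beta>) (black Y),
     white = Sum_Type.Plus (white X) (white Y - wlab Y ` labels \<beta>),
     glue = (\<lambda>i. case_sum
        (\<lambda>b. Inl (glue X i b))
        (\<lambda>b. if glue Y i b \<in> wlab Y ` labels \<beta>
             then Inl (glue X i (blab X (the_inv_into (labels \<beta>) (wlab Y) (glue Y i b))))
             else Inr (glue Y i b))),
     blab = Inr \<circ> blab Y,
     wlab = Inl \<circ> wlab X\<rparr>"

text \<open>The product of \<open>A \<in> Mor n \<beta> \<alpha>\<close> and \<open>B \<in> Mor n \<gamma> \<beta>\<close>.\<close>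

definition board_comp ::
    "nat \<Rightarrow> enat \<Rightarrow> enat \<Rightarrow> enat \<Rightarrow> nat board set \<Rightarrow> nat board set \<Rightarrow> nat board set" where
  "board_comp n \<gamma> \<beta> \<alpha> A B =
     (\<Union>X\<in>A. \<Union>Y\<in>B. board_class n \<gamma> \<alpha> (discard_empty n \<gamma> \<alpha> (cut_and_glue \<beta> X Y)))"

definition id_board :: "enat \<Rightarrow> nat board" where
  "id_board \<alpha> = \<lparr>black = labels \<alpha>, white = labels \<alpha>, glue = (\<lambda>_ b. b),
     blab = (\<lambda>j. j), wlab = (\<lambda>j. j)\<rparr>"

definition EndB :: "nat \<Rightarrow> enat \<Rightarrow> nat board set monoid" where
  "EndB n \<alpha> = \<lparr>carrier = Mor n \<alpha> \<alpha>, mult = board_comp n \<alpha> \<alpha> \<alpha>,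
     one = board_class n \<alpha> \<alpha> (id_board \<alpha>)\<rparr>"

abbreviation Delta :: "nat \<Rightarrow> nat board set monoid" where
  "Delta n \<equiv> EndB n 0"

definition center :: "('a, 'b) monoid_scheme \<Rightarrow> 'a set" where
  "center G = {z \<in> carrier G. \<forall>x\<in>carrier G. z \<otimes>\<^bsub>G\<^esub> x = x \<otimes>\<^bsub>G\<^esub> z}"

text \<open>The identification of double cosets \<open>KK n \<alpha> \ GG n / KK n \<beta>\<close> with \<open>Mor n \<beta> \<alpha>\<close>.\<close>

definition board_of :: "nat \<Rightarrow> enat \<Rightarrow> enat \<Rightarrow> (nat \<Rightarrow> nat \<Rightarrow> nat) \<Rightarrow> nat board set" where
  "board_of n \<beta> \<alpha> g = board_class n \<beta> \<alpha> (discard_empty n \<beta> \<alpha>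
     \<lparr>black = UNIV, white = UNIV, glue = g, blab = (\<lambda>j. j), wlab = (\<lambda>j. j)\<rparr>)"

definition remove_labels :: "nat \<Rightarrow> enat \<Rightarrow> nat board set \<Rightarrow> nat board set" where
  "remove_labels n \<beta> C = (\<Union>X\<in>C. board_class n \<beta> \<beta> (discard_empty n \<beta> \<beta> X))"

definition add_chebureks :: "'f board \<Rightarrow> ('f + nat) board" where
  "add_chebureks X = \<lparr>
     black = Sum_Type.Plus (black X) UNIV,
     white = Sum_Type.Plus (white X) UNIV,
     glue = (\<lambda>i. case_sum (\<lambda>b. Inl (glue X i b)) (\<lambda>j. Inr j)),
     blab = Inr,
     wlab = Inr\<rparr>"

definition z_elem :: "nat \<Rightarrow> nat board set \<Rightarrow> nat board set" where
  "z_elem n C = (\<Union>X\<in>C. board_class n \<infinity> \<infinity> (add_chebureks X))"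

lemma board_iso_refl: "board_iso n \<beta> \<alpha> X X"
  unfolding board_iso_def by (intro exI[of _ "\<lambda>x. x"]) (auto simp: bij_betw_def)

lemma board_iso_trans:
  assumes "is_board n \<beta> \<alpha> X" "board_iso n \<beta> \<alpha> X Y" "board_iso n \<beta> \<alpha> Y Z"
  shows "board_iso n \<beta> \<alpha> X Z"
proof -
  obtain \<phi> \<psi> where 1: "bij_betw \<phi> (black X) (black Y)" "bij_betw \<psi> (white X) (white Y)"
     "\<forall>i\<in>{1..n}. \<forall>b\<in>black X. \<psi> (glue X i b) = glue Y i (\<phi> b)"
     "\<forall>j\<in>labels \<beta>. \<phi> (blab X j) = blab Y j" "\<forall>j\<in>labels \<alpha>. \<psi> (wlab X j) = wlab Y j"
    using assms(2) unfolding board_iso_def by blast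
  obtain \<phi>' \<psi>' where 2: "bij_betw \<phi>' (black Y) (black Z)" "bij_betw \<psi>' (white Y) (white Z)"
     "\<forall>i\<in>{1..n}. \<forall>b\<in>black Y. \<psi>' (glue Y i b) = glue Z i (\<phi>' b)"
     "\<forall>j\<in>labels \<beta>. \<phi>' (blab Y j) = blab Z j" "\<forall>j\<in>labels \<alpha>. \<psi>' (wlab Y j) = wlab Z j"
    using assms(3) unfolding board_iso_def by blast
  show ?thesis unfolding board_iso_def
  proof (intro exI conjI)
    show "bij_betw (\<phi>' \<circ> \<phi>) (black X) (black Z)" "bij_betw (\<psi>' \<circ> \<psi>) (white X) (white Z)"
      using 1 2 bij_betw_trans by blast+
    show "\<forall>i\<in>{1..n}. \<forall>b\<in>black X. (\<psi>' \<circ> \<psi>) (glue X i b) = glue Z i ((\<phi>' \<circ> \<phi>) b)"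
      using 1 2 by (auto dest: bij_betwE)
  qed (use 1 2 in auto)
qed

lemma board_iso_sym:
  assumes "is_board n \<beta> \<alpha> X" "board_iso n \<beta> \<alpha> X Y"
  shows "board_iso n \<beta> \<alpha> Y X"
proof -
  obtain \<phi> \<psi> where 1: "bij_betw \<phi> (black X) (black Y)" "bij_betw \<psi> (white X) (white Y)"
     "\<forall>i\<in>{1..n}. \<forall>b\<in>black X. \<psi> (glue X i b) = glue Y i (\<phi> b)"
     "\<forall>j\<in>labels \<beta>. \<phi> (blab X j) = blab Y j" "\<forall>j\<in>labels \<alpha>. \<psi> (wlab X j) = wlab Y j"
    using assms(2) unfolding board_iso_def by blast
  have X: "\<And>i b. i \<in> {1..n} \<Longrightarrow> b \<in> black X \<Longrightarrow> glue X i b \<in> white X"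
    "\<And>j. j \<in> labels \<beta> \<Longrightarrow> blab X j \<in> black X" "\<And>j. j \<in> labels \<alpha> \<Longrightarrow> wlab X j \<in> white X"
    using assms(1) unfolding is_board_def by (blast dest: bij_betwE)+
  let ?\<phi> = "the_inv_into (black X) \<phi>" and ?\<psi> = "the_inv_into (white X) \<psi>"
  have inj: "inj_on \<phi> (black X)" "inj_on \<psi> (white X)"
    using 1 by (auto simp: bij_betw_def)
  show ?thesis unfolding board_iso_def
  proof (intro exI conjI ballI)
    show "bij_betw ?\<phi> (black Y) (black X)" "bij_betw ?\<psi> (white Y) (white X)"
      using 1 by (auto intro: bij_betw_the_inv_into)
    show "?\<phi> (blab Y j) = blab X j" if "j \<in> labels \<beta>" for j
      using 1 X inj that by (metis the_inv_into_f_f)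
    show "?\<psi> (wlab Y j) = wlab X j" if "j \<in> labels \<alpha>" for j
      using 1 X inj that by (metis the_inv_into_f_f)
    fix i b assume i: "i \<in> {1..n}" and "b \<in> black Y"
    then obtain a where a: "a \<in> black X" "b = \<phi> a" using 1(1) by (auto simp: bij_betw_def)
    then show "?\<psi> (glue Y i b) = glue X i (?\<phi> b)"
      using 1 X inj i by (metis the_inv_into_f_f)
  qed
qed

lemma Mor_eq_quotient:
  "Mor n \<beta> \<alpha> = {X. is_board n \<beta> \<alpha> X} //
     {(X, Y). is_board n \<beta> \<alpha> X \<and> is_board n \<beta> \<alpha> Y \<and> board_iso n \<beta> \<alpha> X Y}"
  and equiv_board_iso: "equiv {X :: nat board. is_board n \<beta> \<alpha> X}
     {(X, Y). is_board n \<beta> \<alpha> X \<and> is_board n \<beta> \<alpha> Y \<and> board_iso n \<beta> \<alpha> X Y}"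
proof -
  show "Mor n \<beta> \<alpha> = {X. is_board n \<beta> \<alpha> X} //
     {(X, Y). is_board n \<beta> \<alpha> X \<and> is_board n \<beta> \<alpha> Y \<and> board_iso n \<beta> \<alpha> X Y}"
    by (auto simp: Mor_def quotient_def board_class_def)
  show "equiv {X :: nat board. is_board n \<beta> \<alpha> X}
     {(X, Y). is_board n \<beta> \<alpha> X \<and> is_board n \<beta> \<alpha> Y \<and> board_iso n \<beta> \<alpha> X Y}"
    by (rule equivI)
      (auto simp: refl_on_def sym_def trans_def intro: board_iso_refl board_iso_sym board_iso_trans)
qed

section \<open>The extension of a representation to the semigroup of boards\<close>

definition rhobar_fin ::
    "nat \<Rightarrow> ((nat \<Rightarrow> nat \<Rightarrow> nat) \<Rightarrow> 'h::chilbert_space \<Rightarrow> 'h) \<Rightarrow> nat \<Rightarrow> nat board set \<Rightarrow> 'h \<Rightarrow> 'h" where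
  "rhobar_fin n \<rho> \<beta> b =
     fixed_proj n \<rho> \<beta> \<circ> \<rho> (SOME g. g \<in> carrier (GG n) \<and> board_of n \<beta> \<beta> g = b) \<circ> fixed_proj n \<rho> \<beta>"

definition rhobar ::
    "nat \<Rightarrow> ((nat \<Rightarrow> nat \<Rightarrow> nat) \<Rightarrow> 'h::chilbert_space \<Rightarrow> 'h) \<Rightarrow> nat board set \<Rightarrow> 'h \<Rightarrow> 'h" where
  "rhobar n \<rho> c = (THE T. \<forall>v w.
     (\<lambda>\<beta>::nat. cinner (rhobar_fin n \<rho> \<beta> (remove_labels n \<beta> c) (fixed_proj n \<rho> \<beta> v)) w)
       \<longlonglongrightarrow> cinner (T v) w)"

definition Cmult :: "complex monoid" where
  "Cmult = \<lparr>carrier = UNIV, mult = (*), one = 1\<rparr>"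

definition chi ::
    "nat \<Rightarrow> ((nat \<Rightarrow> nat \<Rightarrow> nat) \<Rightarrow> 'h::chilbert_space \<Rightarrow> 'h) \<Rightarrow> nat board set \<Rightarrow> complex" where
  "chi n \<rho> c = (THE s. \<forall>v. rhobar n \<rho> (z_elem n c) v = s *\<^sub>C v)"

end

(*
  Let c be a board without labels.  Permutation tuples g realizing c on a finite set of numbers
  beyond k all lie in one double coset of K(k), so <rho(g) v, w> depends only on c for v, w fixed
  by K(k).  Vectors fixed by some K(k) are dense, hence rho(g) converges weakly as the support of g
  escapes to infinity.  Conjugation by a fixed element of the group permutes the escaping
  realizations, so the limit commutes with rho and is a scalar by Schur's lemma; it is the operator
  assigned to z_c.  A product of two realizations with disjoint supports realizes the disjoint
  union, which gives multiplicativity.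

  A central board commutes with the boards that cut off one label and with a transposition in a
  single colour; this forces every labelled face to lie in a cheburek (j/j).
*)

theory Submission
  imports Defs
begin

text \<open>No spectral theorem stands behind Schur's lemma here. For a Hermitian A of norm at most
  1 in the commutant, |A| = sqrt (1 - (1 - A^2)) is a power series in 1 - A^2, so it lies in the
  commutant too, and irreducibility forces A = |A| or A = -|A|. Applied to multiples of A - l for
  all real l, this makes A the scalar at which the sign changes.

  Weak limits do not respect products. Multiplicativity is therefore read off an iterated limit: the
  second factor escapes while the first stays fixed, and the scalar that it leaves behind is pulled
  out before the first one escapes.

  The extension is defined through arbitrary representatives of double cosets, so comparisons pass
  through matrix coefficients between vectors fixed by K(k), with an error that is uniform in the
  group element.

  The bound n >= 2 enters where the center is determined: for n = 1 the board made of the chebureks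
  (j/-) and (-/j) for all j is central as well, but it is not of the form z_c.\<close>

section \<open>Hilbert space preliminaries\<close>

lemma cinner_add_right: "cinner x (y + z) = cinner x y + cinner x z"
  by (metis cinner_add_left cinner_commute complex_cnj_add)

lemma cinner_scaleC_right: "cinner x (a *\<^sub>C y) = cnj a * cinner x y"
  by (metis cinner_scaleC_left cinner_commute complex_cnj_mult)

lemma scaleC_one [simp]: "1 *\<^sub>C x = (x::'h::chilbert_space)"
  by (metis of_real_1 scaleR_one scaleR_scaleC)

lemma scaleC_zero_left [simp]: "0 *\<^sub>C x = (0::'h::chilbert_space)"
  by (metis of_real_0 scaleR_zero_left scaleR_scaleC)

lemma cinner_scaleR_left: "cinner (r *\<^sub>R x) y = r *\<^sub>R cinner x y"
  by (simp add: scaleR_scaleC[of r x] cinner_scaleC_left scaleR_conv_of_real)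

lemma cinner_scaleR_right: "cinner x (r *\<^sub>R y) = r *\<^sub>R cinner x y"
  by (simp add: scaleR_scaleC[of r y] cinner_scaleC_right scaleR_conv_of_real)

lemma cinner_self: "cinner x x = complex_of_real ((norm x)\<^sup>2)"
proof (rule complex_eqI)
  show "Re (cinner x x) = Re (complex_of_real ((norm x)\<^sup>2))"
    by (simp add: inner_cinner[symmetric] power2_norm_eq_inner)
  have "Im (cinner x x) = - Im (cinner x x)"
    by (metis cinner_commute cnj.sel(2))
  then show "Im (cinner x x) = Im (complex_of_real ((norm x)\<^sup>2))" by simp
qed

lemma scaleC_zero_right [simp]: "a *\<^sub>C (0::'h::chilbert_space) = 0"
proof -
  have "a *\<^sub>C (0::'h) = a *\<^sub>C 0 + a *\<^sub>C 0" by (metis add.left_neutral scaleC_add_right)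
  then show ?thesis by simp
qed

lemma norm_scaleC: "norm (a *\<^sub>C x) = cmod a * norm x"
proof -
  have "complex_of_real ((norm (a *\<^sub>C x))\<^sup>2) = a * cnj a * complex_of_real ((norm x)\<^sup>2)"
    by (simp only: cinner_self[symmetric] cinner_scaleC_left cinner_scaleC_right mult_ac)
  also have "\<dots> = complex_of_real ((cmod a * norm x)\<^sup>2)"
    by (simp add: complex_norm_square[symmetric] power_mult_distrib)
  finally have "(norm (a *\<^sub>C x))\<^sup>2 = (cmod a * norm x)\<^sup>2"
    by (simp only: of_real_eq_iff)
  then show ?thesis by (simp add: power2_eq_iff_nonneg)
qed

text \<open>Multiplying x by the conjugate of the inner product makes that product real and
  nonnegative, so the real Cauchy-Schwarz inequality applies.\<close>

lemma cmod_cinner_le: "cmod (cinner x y) \<le> norm x * norm y"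
proof (cases "cinner x y = 0")
  case False
  define c where "c = cinner x y"
  have c0: "cmod c > 0" using False by (simp add: c_def)
  have "cinner (cnj c *\<^sub>C x) y = complex_of_real ((cmod c)\<^sup>2)"
    by (simp add: cinner_scaleC_left c_def[symmetric] complex_norm_square mult.commute flip: of_real_power)
  then have "(cmod c)\<^sup>2 = inner (cnj c *\<^sub>C x) y" by (simp add: inner_cinner)
  also have "\<dots> \<le> norm (cnj c *\<^sub>C x) * norm y" by (rule norm_cauchy_schwarz)
  also have "\<dots> = cmod c * (norm x * norm y)" by (simp add: norm_scaleC)
  finally show ?thesis using c0 by (simp add: power2_eq_square c_def)
qed simp

lemma bounded_bilinear_cinner: "bounded_bilinear (cinner :: 'h::chilbert_space \<Rightarrow> 'h \<Rightarrow> complex)"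
  by standard
    (auto simp: cinner_add_left cinner_add_right cinner_scaleR_left cinner_scaleR_right
      intro!: exI[of _ 1] cmod_cinner_le)

interpretation cinner: bounded_bilinear "cinner :: 'h::chilbert_space \<Rightarrow> 'h \<Rightarrow> complex"
  by (rule bounded_bilinear_cinner)

lemma bounded_linear_scaleC: "bounded_linear (\<lambda>x::'h::chilbert_space. a *\<^sub>C x)"
proof
  show "a *\<^sub>C (r *\<^sub>R x) = r *\<^sub>R (a *\<^sub>C x)" for r and x :: 'h
    by (simp add: scaleR_scaleC scaleC_scaleC mult.commute)
  show "\<exists>K. \<forall>x::'h. norm (a *\<^sub>C x) \<le> norm x * K"
    by (intro exI[of _ "cmod a"]) (simp add: norm_scaleC)
qed (rule scaleC_add_right)

lemma scaleC_diff_right: "a *\<^sub>C (x - y) = a *\<^sub>C x - a *\<^sub>C (y::'h::chilbert_space)"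
  using bounded_linear_scaleC linear_diff bounded_linear.linear by blast

lemma scaleC_minus_left: "(- a) *\<^sub>C x = - (a *\<^sub>C (x::'h::chilbert_space))"
  by (metis add.right_inverse add_eq_0_iff scaleC_add_left scaleC_zero_left)

lemma scaleC_cancel: "a *\<^sub>C x = b *\<^sub>C x \<Longrightarrow> x \<noteq> (0::'h::chilbert_space) \<Longrightarrow> a = b"
proof -
  assume *: "a *\<^sub>C x = b *\<^sub>C x" "x \<noteq> 0"
  then have "(a + (- b)) *\<^sub>C x = 0" by (simp only: scaleC_add_left scaleC_minus_left) simp
  then have "norm ((a - b) *\<^sub>C x) = 0" by simp
  then show "a = b" using * by (simp add: norm_scaleC)
qed

lemma cinner_ext: "(\<And>w. cinner x w = cinner y w) \<Longrightarrow> x = y"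
proof -
  assume "\<And>w. cinner x w = cinner y w"
  then have "cinner (x - y) (x - y) = 0" by (simp add: cinner.diff_left)
  then show "x = y" by (simp add: cinner_self)
qed

subsection \<open>Nearest points, orthogonal projections and functionals\<close>

text \<open>By the parallelogram law, two distinct points of minimal norm would have a midpoint of
  smaller norm. Later this shows that a norm preserving operator that maps a convex set into itself
  fixes its minimal point.\<close>

lemma min_norm_point_unique:
  fixes c d :: "'h::real_inner"
  assumes "convex C" "c \<in> C" "d \<in> C" "\<And>x. x \<in> C \<Longrightarrow> norm c \<le> norm x" "norm d = norm c"
  shows "d = c"
proof -
  have m: "(1/2) *\<^sub>R c + (1/2) *\<^sub>R d \<in> C" by (intro convexD assms) auto
  have "(norm c)\<^sup>2 \<le> (norm ((1/2) *\<^sub>R (c + d)))\<^sup>2"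
    using assms(4)[OF m] by (intro power_mono) (auto simp: scaleR_add_right)
  then have "4 * (norm c)\<^sup>2 \<le> (norm (c + d))\<^sup>2"
    by (simp add: power_divide)
  moreover have "(norm (c + d))\<^sup>2 + (norm (c - d))\<^sup>2 = 2 * (norm c)\<^sup>2 + 2 * (norm d)\<^sup>2"
    by (simp add: power2_norm_eq_inner algebra_simps inner_commute)
  ultimately have "(norm (c - d))\<^sup>2 \<le> 0" unfolding assms(5) by linarith
  then show ?thesis by simp
qed

text \<open>A minimizing sequence is Cauchy: midpoints stay in C, so their norms are at least the
  infimum D, and the parallelogram law bounds the distances.\<close>

lemma min_norm_point_exists:
  fixes C :: "'h::{real_inner, complete_space} set"
  assumes "convex C" "closed C" "C \<noteq> {}"
  obtains c where "c \<in> C" "\<And>x. x \<in> C \<Longrightarrow> norm c \<le> norm x"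
proof -
  define D where "D = Inf (norm ` C)"
  have bdd: "bdd_below (norm ` C)" by (rule bdd_belowI2[of _ 0]) simp
  have D: "D \<le> norm x" if "x \<in> C" for x
    unfolding D_def using bdd that by (intro cInf_lower) auto
  have D0: "D \<ge> 0" unfolding D_def using assms(3) by (intro cInf_greatest) auto
  have "\<exists>x\<in>C. norm x < D + 1 / Suc k" for k
    using cInf_lessD[of "norm ` C" "D + 1 / Suc k"] assms(3) unfolding D_def by auto
  then obtain x where x: "\<And>k. x k \<in> C" "\<And>k. norm (x k) < D + 1 / Suc k" by metis
  \<comment> \<open>The norm of each point exceeds D by at most 1/(i+1), so its square exceeds D^2
    by at most (2 D + 1)/(i+1). In the parallelogram law the terms 4 D^2 cancel and four such
    excesses remain.\<close>
  have key: "(norm (x j - x k))\<^sup>2 \<le> (8 * D + 4) / Suc i" if "i \<le> j" "i \<le> k" for i j k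
  proof -
    have m: "(1/2) *\<^sub>R x j + (1/2) *\<^sub>R x k \<in> C" using x assms(1) by (intro convexD) auto
    have "D\<^sup>2 \<le> (norm ((1/2) *\<^sub>R (x j + x k)))\<^sup>2"
      using D[OF m] D0 by (intro power_mono) (auto simp: scaleR_add_right)
    then have 1: "4 * D\<^sup>2 \<le> (norm (x j + x k))\<^sup>2" by (simp add: power_divide)
    have 2: "(norm (x j + x k))\<^sup>2 + (norm (x j - x k))\<^sup>2 = 2 * (norm (x j))\<^sup>2 + 2 * (norm (x k))\<^sup>2"
      by (simp add: power2_norm_eq_inner algebra_simps inner_commute)
    have sq: "(norm (x l))\<^sup>2 \<le> D\<^sup>2 + (2 * D + 1) / Suc i" if "i \<le> l" for l
    proof -
      have "1 / real (Suc l) \<le> 1 / real (Suc i)" using that by (intro divide_left_mono) auto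
      then have "norm (x l) \<le> D + 1 / Suc i" using x(2)[of l] by simp
      then have "(norm (x l))\<^sup>2 \<le> (D + 1 / Suc i)\<^sup>2" by (intro power_mono) auto
      also have "\<dots> = D\<^sup>2 + 2 * D * (1 / Suc i) + (1 / Suc i) * (1 / Suc i)"
        unfolding power2_sum by (simp add: power2_eq_square)
      also have "(1 / real (Suc i)) * (1 / Suc i) \<le> 1 / Suc i"
        by (intro mult_left_le) auto
      finally show ?thesis by (simp add: add_divide_distrib)
    qed
    have "(norm (x j - x k))\<^sup>2 \<le> 4 * ((2 * D + 1) / Suc i)"
      using 1 2 sq[OF that(1)] sq[OF that(2)] by linarith
    then show ?thesis by (simp add: field_simps)
  qed
  have "Cauchy x"
  proof (rule metric_CauchyI)
    fix e :: real assume e: "e > 0"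
    have "(\<lambda>i. (8 * D + 4) / real (Suc i)) \<longlonglongrightarrow> 0"
      using LIMSEQ_Suc[OF lim_const_over_n[of "8 * D + 4"]] by simp
    then have "\<forall>\<^sub>F i in sequentially. (8 * D + 4) / real (Suc i) < e\<^sup>2"
      using e by (intro order_tendstoD(2)) auto
    then obtain i where i: "(8 * D + 4) / real (Suc i) < e\<^sup>2" by (auto simp: eventually_sequentially)
    show "\<exists>M. \<forall>m\<ge>M. \<forall>n\<ge>M. dist (x m) (x n) < e"
    proof (intro exI[of _ i] allI impI)
      fix m n assume "m \<ge> i" "n \<ge> i"
      then have "(norm (x m - x n))\<^sup>2 < e\<^sup>2" using key[of i m n] i by linarith
      then show "dist (x m) (x n) < e" using e by (simp add: dist_norm power2_less_imp_less)
    qed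
  qed
  then obtain c where c: "x \<longlonglongrightarrow> c" by (auto simp: Cauchy_convergent_iff convergent_def)
  have "c \<in> C" using assms(2) c x(1) closed_sequentially by blast
  moreover have "norm c \<le> D"
  proof (rule LIMSEQ_le)
    show "(\<lambda>k. norm (x k)) \<longlonglongrightarrow> norm c" using c by (rule tendsto_norm)
    show "(\<lambda>k. D + 1 / real (Suc k)) \<longlonglongrightarrow> D"
      using tendsto_add[OF tendsto_const[of D] LIMSEQ_Suc[OF lim_const_over_n[of 1]]] by simp
    show "\<exists>N. \<forall>n\<ge>N. norm (x n) \<le> D + 1 / real (Suc n)" using x(2) less_imp_le by blast
  qed
  ultimately show ?thesis using D that by (meson order_trans)
qed

lemma min_norm_orthogonal:
  fixes p y :: "'h::real_inner"
  assumes "\<And>t. norm p \<le> norm (p + t *\<^sub>R y)"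
  shows "inner p y = 0"
proof (rule ccontr)
  assume *: "inner p y \<noteq> 0"
  then have y: "inner y y > 0" by auto
  \<comment> \<open>The minimizer of the quadratic polynomial that sends t to the squared norm of p
    + t y.\<close>
  define t where "t = - inner p y / inner y y"
  have "(norm (p + t *\<^sub>R y))\<^sup>2 = (norm p)\<^sup>2 + 2 * t * inner p y + t * t * inner y y"
    by (simp add: power2_norm_eq_inner algebra_simps inner_commute)
  also have "\<dots> = (norm p)\<^sup>2 - (inner p y)\<^sup>2 / inner y y"
    using y by (simp add: t_def field_simps power2_eq_square)
  also have "\<dots> < (norm p)\<^sup>2" using * y by simp
  finally have "norm (p + t *\<^sub>R y) < norm p" by (rule power2_less_imp_less) simp
  with assms[of t] show False by simp
qed

text \<open>The point p of the affine hyperplane f = 1 that is nearest to 0 is orthogonal to the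
  kernel of f. Since w - f(w) p lies in the kernel, p divided by its squared norm represents
  f.\<close>

lemma riesz_real:
  fixes f :: "'h::{real_inner, complete_space} \<Rightarrow> real"
  assumes "bounded_linear f"
  obtains t where "\<And>w. f w = inner t w"
proof (cases "\<forall>w. f w = 0")
  case True
  then show ?thesis using that[of 0] by simp
next
  case False
  interpret f: bounded_linear f by fact
  obtain u where u: "f u \<noteq> 0" using False by blast
  define C where "C = {x. f x = 1}"
  have "convex C" unfolding C_def convex_alt by (simp add: f.add f.scaleR)
  moreover have "closed C" unfolding C_def
    by (intro closed_Collect_eq continuous_intros f.continuous_on)
  moreover have "u /\<^sub>R f u \<in> C" using u by (simp add: C_def f.scaleR)
  ultimately obtain p where p: "p \<in> C" "\<And>x. x \<in> C \<Longrightarrow> norm p \<le> norm x"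
    using min_norm_point_exists[of C] by blast
  have orth: "inner p y = 0" if "f y = 0" for y
    using that p by (intro min_norm_orthogonal p(2)) (simp add: C_def f.add f.scaleR)
  have p0: "inner p p \<noteq> 0" using p(1) by (auto simp: C_def f.zero)
  have "f w = inner (p /\<^sub>R inner p p) w" for w
  proof -
    have "inner p (w - f w *\<^sub>R p) = 0"
      using p(1) by (intro orth) (simp add: C_def f.diff f.scaleR)
    then show ?thesis using p0 by (simp add: inner_diff_right field_simps)
  qed
  then show ?thesis using that by blast
qed

text \<open>The real part of S is represented by some t. Conjugate linearity makes the imaginary
  part of S at w equal to the real part of S at i w, so the same t represents S.\<close>

lemma riesz_cinner:
  fixes S :: "'h::chilbert_space \<Rightarrow> complex"
  assumes "bounded_linear S" and "\<And>a w. S (a *\<^sub>C w) = cnj a * S w"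
  obtains t where "\<And>w. S w = cinner t w"
proof -
  have "bounded_linear (\<lambda>w. Re (S w))"
    using bounded_linear_compose[OF bounded_linear_Re assms(1)] by simp
  then obtain t where t: "\<And>w. Re (S w) = inner t w" using riesz_real by blast
  have "S w = cinner t w" for w
  proof (rule complex_eqI)
    show "Re (S w) = Re (cinner t w)" by (simp add: t inner_cinner)
    have "Re (S (\<i> *\<^sub>C w)) = Re (cinner t (\<i> *\<^sub>C w))" by (simp only: t inner_cinner)
    then show "Im (S w) = Im (cinner t w)" by (simp add: assms(2) cinner_scaleC_right)
  qed
  then show ?thesis using that by blast
qed

lemma csubspaceD:
  assumes "csubspace V"
  shows "subspace V" "\<And>a x. x \<in> V \<Longrightarrow> a *\<^sub>C x \<in> V"
    and "0 \<in> V" "\<And>x y. x \<in> V \<Longrightarrow> y \<in> V \<Longrightarrow> x + y \<in> V" "\<And>x y. x \<in> V \<Longrightarrow> y \<in> V \<Longrightarrow> x - y \<in> V"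
  using assms subspace_0 subspace_add subspace_diff unfolding csubspace_def by blast+

lemma ortho_proj:
  fixes V :: "'h::chilbert_space set"
  assumes V: "csubspace V" "closed V"
  shows ortho_proj_in: "ortho_proj V v \<in> V"
    and ortho_proj_orth: "\<And>u. u \<in> V \<Longrightarrow> cinner (v - ortho_proj V v) u = 0"
proof -
  let ?P = "\<lambda>w. w \<in> V \<and> (\<forall>u\<in>V. cinner (v - w) u = 0)"
  have "\<exists>w. ?P w"
  proof -
    let ?C = "(\<lambda>u. v - u) ` V"
    have "convex ?C" by (intro convex_linear_image[of "\<lambda>u. - u", THEN convex_translation, of V v, 
          unfolded image_image, simplified] subspace_imp_convex csubspaceD V) (simp add: linear_uminus module_hom_uminus)
    moreover have "closed ?C"
      using closed_translation[OF closed_negations[OF V(2)], of v] by (simp add: image_image)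
    moreover have "?C \<noteq> {}" using csubspaceD(3)[OF V(1)] by blast
    ultimately obtain c where c: "c \<in> ?C" "\<And>x. x \<in> ?C \<Longrightarrow> norm c \<le> norm x"
      using min_norm_point_exists[of ?C] by blast
    then obtain w where w: "w \<in> V" "c = v - w" by blast
    have "inner c u = 0" if "u \<in> V" for u
    proof (rule min_norm_orthogonal)
      fix t
      have "w - t *\<^sub>R u \<in> V" using V w that by (simp add: csubspaceD subspace_scale)
      then have "v - (w - t *\<^sub>R u) \<in> ?C" by blast
      then show "norm c \<le> norm (c + t *\<^sub>R u)" using c(2) w(2) by (metis diff_diff_eq2 diff_add_eq)
    qed
    \<comment> \<open>Minimality yields real orthogonality only; testing both u and i u, which lies
      in V as well, gives the complex one.\<close>
    then have "Re (cinner c u) = 0" "Re (cinner c (\<i> *\<^sub>C u)) = 0" if "u \<in> V" for u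
      using that csubspaceD(2)[OF V(1)] by (simp_all add: inner_cinner[symmetric])
    then have "cinner c u = 0" if "u \<in> V" for u
      using that by (auto simp: complex_eq_iff cinner_scaleC_right)
    then show ?thesis using w by blast
  qed
  moreover have "w = w'" if "?P w" "?P w'" for w w'
  proof -
    have "cinner (v - w') (w - w') - cinner (v - w) (w - w') = 0"
      using that csubspaceD(5)[OF V(1)] by simp
    then have "cinner (w - w') (w - w') = 0" by (simp add: cinner.diff_left[symmetric])
    then show ?thesis by (simp add: cinner_self)
  qed
  ultimately have "\<exists>!w. ?P w" by blast
  from theI'[OF this] show "ortho_proj V v \<in> V" "\<And>u. u \<in> V \<Longrightarrow> cinner (v - ortho_proj V v) u = 0"
    unfolding ortho_proj_def by blast+
qed

lemma norm_diff_ortho_proj_le: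
  assumes "csubspace V" "closed V" "u \<in> V"
  shows "norm (v - ortho_proj V v) \<le> norm (v - u)"
proof -
  let ?p = "ortho_proj V v"
  have "inner (v - ?p) (?p - u) = 0"
    using ortho_proj[OF assms(1,2)] csubspaceD(5)[OF assms(1)] assms(3) by (simp add: inner_cinner)
  then have "(norm ((v - ?p) + (?p - u)))\<^sup>2 = (norm (v - ?p))\<^sup>2 + (norm (?p - u))\<^sup>2"
    by (simp only: power2_norm_eq_inner inner_add_left inner_add_right inner_commute)
  then have "(norm (v - ?p))\<^sup>2 \<le> (norm (v - u))\<^sup>2" by simp
  then show ?thesis by (rule power2_le_imp_le) simp
qed

lemma cinner_ortho_proj:
  assumes "csubspace V" "closed V" "u \<in> V"
  shows "cinner (ortho_proj V v) u = cinner v u" "cinner u (ortho_proj V v) = cinner u v"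
proof -
  show *: "cinner (ortho_proj V v) u = cinner v u"
    using ortho_proj_orth[OF assms, of v] by (simp add: cinner.diff_left)
  then show "cinner u (ortho_proj V v) = cinner u v" by (metis cinner_commute)
qed

lemma ortho_proj_id:
  assumes "csubspace V" "closed V" "u \<in> V"
  shows "ortho_proj V u = u"
  using norm_diff_ortho_proj_le[OF assms, of u] by simp

section \<open>Schur's lemma\<close>

instance chilbert_space \<subseteq> banach
  by standard

text \<open>The recursion compares coefficients in f^2 = 2 f - x, the equation solved by f = 1 -
  sqrt (1 - x). The values are the Catalan numbers up to powers of 2. Defined this way, the
  coefficients are visibly nonnegative and the functional equation needs no analysis.\<close>

fun sqrt_coeff :: "nat \<Rightarrow> real" where
  "sqrt_coeff k = (if k = 1 then 1/2 else (\<Sum>i\<in>{1..<k}. sqrt_coeff i * sqrt_coeff (k - i)) / 2)"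

declare sqrt_coeff.simps [simp del]

lemma sqrt_coeff_0 [simp]: "sqrt_coeff 0 = 0"
  by (subst sqrt_coeff.simps) simp

lemma sqrt_coeff_nonneg: "0 \<le> sqrt_coeff k"
proof (induction k rule: less_induct)
  case (less k)
  show ?case
    by (subst sqrt_coeff.simps) (auto intro!: sum_nonneg mult_nonneg_nonneg less)
qed

lemma sqrt_coeff_convolution_inner:
  "(\<Sum>i\<in>{1..<k}. sqrt_coeff i * sqrt_coeff (k - i)) = 2 * sqrt_coeff k - (if k = 1 then 1 else 0)"
  by (subst (3) sqrt_coeff.simps) (simp split: if_split)

lemma sqrt_coeff_convolution:
  "(\<Sum>i\<le>k. sqrt_coeff i * sqrt_coeff (k - i)) = 2 * sqrt_coeff k - (if k = 1 then 1 else 0)"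
proof -
  have "(\<Sum>i\<le>k. sqrt_coeff i * sqrt_coeff (k - i)) = (\<Sum>i\<in>{1..<k}. sqrt_coeff i * sqrt_coeff (k - i))"
  proof (rule sum.mono_neutral_right)
    show "\<forall>i\<in>{..k} - {1..<k}. sqrt_coeff i * sqrt_coeff (k - i) = 0"
    proof
      fix i assume "i \<in> {..k} - {1..<k}"
      then have "i = 0 \<or> i = k" by auto
      then show "sqrt_coeff i * sqrt_coeff (k - i) = 0" by auto
    qed
  qed auto
  then show ?thesis by (simp only: sqrt_coeff_convolution_inner)
qed

text \<open>A pair of positive indices with sum at most N + 1 has both indices at most N. Hence the
  partial sums satisfy 2 s_(N+1) <= 1 + (s_N)^2, and the bound 1 reproduces itself.\<close>

lemma sum_sqrt_coeff_le_1: "(\<Sum>k\<le>N. sqrt_coeff k) \<le> 1"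
proof (induction N)
  case (Suc N)
  let ?c = sqrt_coeff
  have "2 * (\<Sum>k\<le>Suc N. ?c k)
      = (\<Sum>k\<le>Suc N. (\<Sum>i\<in>{1..<k}. ?c i * ?c (k - i)) + (if k = 1 then 1 else 0))"
    unfolding sum_distrib_left by (rule sum.cong[OF refl]) (simp only: sqrt_coeff_convolution_inner)
  also have "\<dots> = (\<Sum>k\<le>Suc N. \<Sum>i\<in>{1..<k}. ?c i * ?c (k - i)) + 1"
    by (simp only: sum.distrib) (simp add: sum.delta)
  also have "(\<Sum>k\<le>Suc N. \<Sum>i\<in>{1..<k}. ?c i * ?c (k - i))
      = (\<Sum>(k, i)\<in>Sigma {..Suc N} (\<lambda>k. {1..<k}). ?c i * ?c (k - i))"
    by (rule sum.Sigma) auto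
  also have "\<dots> = (\<Sum>(i, j)\<in>(\<lambda>(k, i). (i, k - i)) ` Sigma {..Suc N} (\<lambda>k. {1..<k}). ?c i * ?c j)"
    by (subst sum.reindex) (auto simp: inj_on_def case_prod_unfold)
  also have "\<dots> \<le> (\<Sum>(i, j)\<in>{..N} \<times> {..N}. ?c i * ?c j)"
    by (rule sum_mono2) (auto intro: mult_nonneg_nonneg sqrt_coeff_nonneg)
  also have "\<dots> = (\<Sum>i\<le>N. ?c i) * (\<Sum>j\<le>N. ?c j)"
    by (simp add: sum_product sum.cartesian_product)
  also have "\<dots> \<le> 1 * 1"
    by (intro mult_mono Suc.IH) (auto intro!: sum_nonneg sqrt_coeff_nonneg)
  finally show ?case by simp
qed simp

lemma sqrt_coeff_summable: "sqrt_coeff summable_on UNIV"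
  and infsum_sqrt_coeff_le_1: "infsum sqrt_coeff UNIV \<le> 1"
proof -
  have "summable sqrt_coeff"
  proof (rule bounded_imp_summable)
    show "(\<Sum>k\<le>n. sqrt_coeff k) \<le> 1" for n by (rule sum_sqrt_coeff_le_1)
  qed (rule sqrt_coeff_nonneg)
  then show *: "sqrt_coeff summable_on UNIV"
    by (simp add: summable_on_UNIV_nonneg_real_iff sqrt_coeff_nonneg)
  show "infsum sqrt_coeff UNIV \<le> 1"
  proof (rule infsum_le_finite_sums[OF *])
    fix F :: "nat set" assume "finite F"
    then obtain N where "F \<subseteq> {..N}" using finite_nat_iff_bounded_le by blast
    then have "sum sqrt_coeff F \<le> sum sqrt_coeff {..N}"
      by (intro sum_mono2) (auto intro: sqrt_coeff_nonneg)
    then show "sum sqrt_coeff F \<le> 1" using sum_sqrt_coeff_le_1[of N] by simp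
  qed
qed

lemma infsum_bounded_linear:
  fixes h :: "'a::real_normed_vector \<Rightarrow> 'b::real_normed_vector"
  assumes "bounded_linear h" "f summable_on A"
  shows "infsum (\<lambda>x. h (f x)) A = h (infsum f A)"
  by (rule infsumI[OF has_sum_bounded_linear[OF assms(1) has_sum_infsum[OF assms(2)]]])

text \<open>Since \<open>1 - sqrt (1 - x)\<close> has the Taylor coefficients \<open>sqrt_coeff\<close>, this is
  \<open>1 - sqrt (1 - B)\<close> for a contraction \<open>B\<close>.\<close>

definition sqrt_defect :: "('h::chilbert_space \<Rightarrow> 'h) \<Rightarrow> 'h \<Rightarrow> 'h" where
  "sqrt_defect B v = infsum (\<lambda>k. sqrt_coeff k *\<^sub>R (B ^^ k) v) UNIV"

context
  fixes B :: "'h::chilbert_space \<Rightarrow> 'h"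
  assumes B: "bounded_linear B" "\<And>v. norm (B v) \<le> norm v"
begin

lemma norm_funpow_contraction: "norm ((B ^^ k) v) \<le> norm v"
  by (induction k) (auto intro: order_trans B)

lemma bounded_linear_funpow: "bounded_linear (B ^^ k)"
proof (induction k)
  case 0
  then show ?case by (simp add: bounded_linear_ident id_def)
next
  case (Suc k)
  then show ?case using bounded_linear_compose[OF B(1) Suc] by (simp add: comp_def)
qed

lemma sqrt_defect_norm_summable: "(\<lambda>k. norm (sqrt_coeff k *\<^sub>R (B ^^ k) v)) summable_on UNIV"
proof (rule summable_on_comparison_test)
  show "(\<lambda>k. sqrt_coeff k * norm v) summable_on UNIV"
    by (intro summable_on_cmult_left sqrt_coeff_summable)
qed (auto simp: sqrt_coeff_nonneg intro: mult_left_mono norm_funpow_contraction)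

lemma sqrt_defect_summable: "(\<lambda>k. sqrt_coeff k *\<^sub>R (B ^^ k) v) summable_on UNIV"
  by (rule abs_summable_summable[OF sqrt_defect_norm_summable])

lemma norm_sqrt_defect_le: "norm (sqrt_defect B v) \<le> norm v"
proof -
  have "norm (sqrt_defect B v) \<le> infsum (\<lambda>k. norm (sqrt_coeff k *\<^sub>R (B ^^ k) v)) UNIV"
    unfolding sqrt_defect_def by (rule norm_infsum_bound[OF sqrt_defect_norm_summable])
  also have "\<dots> \<le> infsum (\<lambda>k. sqrt_coeff k * norm v) UNIV"
    by (intro infsum_mono sqrt_defect_norm_summable summable_on_cmult_left sqrt_coeff_summable)
      (auto simp: sqrt_coeff_nonneg intro: mult_left_mono norm_funpow_contraction)
  also have "\<dots> = infsum sqrt_coeff UNIV * norm v"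
    by (rule infsum_cmult_left) (rule sqrt_coeff_summable)
  also have "\<dots> \<le> 1 * norm v"
    by (rule mult_right_mono) (auto simp: infsum_sqrt_coeff_le_1)
  finally show ?thesis by simp
qed

lemma bounded_linear_sqrt_defect: "bounded_linear (sqrt_defect B)"
proof
  fix x y :: 'h and r :: real
  interpret P: bounded_linear "B ^^ k" for k by (rule bounded_linear_funpow)
  show "sqrt_defect B (x + y) = sqrt_defect B x + sqrt_defect B y"
    unfolding sqrt_defect_def
    by (simp add: P.add scaleR_add_right infsum_add sqrt_defect_summable)
  show "sqrt_defect B (r *\<^sub>R x) = r *\<^sub>R sqrt_defect B x"
    unfolding sqrt_defect_def
    by (simp add: P.scaleR infsum_scaleR_right[symmetric] mult.commute)
  show "\<exists>K. \<forall>x. norm (sqrt_defect B x) \<le> norm x * K"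
    by (intro exI[of _ 1]) (simp add: norm_sqrt_defect_le)
qed

lemma sqrt_defect_commute:
  assumes "bounded_linear A" "\<And>x. A (B x) = B (A x)"
  shows "A (sqrt_defect B v) = sqrt_defect B (A v)"
proof -
  interpret A: bounded_linear A by fact
  have pw: "A ((B ^^ k) x) = (B ^^ k) (A x)" for k x
    by (induction k) (auto simp: assms(2))
  have "A (sqrt_defect B v) = infsum (\<lambda>k. A (sqrt_coeff k *\<^sub>R (B ^^ k) v)) UNIV"
    unfolding sqrt_defect_def
    by (rule infsum_bounded_linear[OF assms(1) sqrt_defect_summable, symmetric])
  then show ?thesis by (simp add: A.scaleR pw sqrt_defect_def)
qed

text \<open>A Cauchy product. The double family \<open>f\<close> is absolutely summable, so it may
  be regrouped along the diagonals i + j = k, where \<open>sqrt_coeff_convolution\<close> collapses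
  each of them to 2 \<open>sqrt_coeff\<close> k. The exception at k = 1, collected in
  \<open>d\<close>, leaves the term - B v.\<close>

lemma sqrt_defect_square: "sqrt_defect B (sqrt_defect B v) = 2 *\<^sub>R sqrt_defect B v - B v"
proof -
  let ?c = sqrt_coeff
  define f where "f = (\<lambda>(i, j). (?c i * ?c j) *\<^sub>R (B ^^ (i + j)) v)"
  define d where "d = (\<lambda>k::nat. if k = 1 then B v else 0)"
  interpret P: bounded_linear "B ^^ k" for k by (rule bounded_linear_funpow)
  have nf: "norm (f (i, j)) \<le> ?c i * (?c j * norm v)" for i j
    by (simp add: f_def sqrt_coeff_nonneg abs_mult mult.assoc mult_left_mono norm_funpow_contraction)
  have cs: "(\<lambda>j. ?c i * (?c j * norm v)) summable_on UNIV" for i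
    by (intro summable_on_cmult_left summable_on_cmult_right sqrt_coeff_summable)
  have ci: "infsum (\<lambda>j. ?c i * (?c j * norm v)) UNIV = ?c i * (infsum ?c UNIV * norm v)" for i
    by (simp add: infsum_cmult_right infsum_cmult_left sqrt_coeff_summable summable_on_cmult_left)
  have g1: "(\<lambda>j. norm (f (i, j))) summable_on UNIV" for i
    by (rule summable_on_comparison_test[OF cs]) (use nf in auto)
  have "(\<lambda>p. norm (f p)) summable_on UNIV \<times> UNIV"
  proof -
    have "(\<lambda>i. infsum (\<lambda>j. norm (f (i, j))) UNIV) summable_on UNIV"
    proof (rule summable_on_comparison_test)
      show "(\<lambda>i. ?c i * (infsum ?c UNIV * norm v)) summable_on UNIV"
        by (intro summable_on_cmult_left sqrt_coeff_summable)
      show "infsum (\<lambda>j. norm (f (i, j))) UNIV \<le> ?c i * (infsum ?c UNIV * norm v)" for i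
        unfolding ci[symmetric] by (intro infsum_mono g1 cs nf)
    qed (auto intro: infsum_nonneg)
    then have "(\<lambda>i. norm (infsum (\<lambda>j. norm (f (i, j))) UNIV)) summable_on UNIV"
      by (simp add: infsum_nonneg)
    then show ?thesis
      using g1 Infinite_Sum.abs_summable_on_Sigma_iff[of f UNIV "\<lambda>_. UNIV"] by blast
  qed
  then have sf: "f summable_on UNIV \<times> UNIV" by (rule abs_summable_summable)
  have "sqrt_defect B (sqrt_defect B v) = infsum (\<lambda>i. infsum (\<lambda>j. f (i, j)) UNIV) UNIV"
  proof -
    have "?c i *\<^sub>R (B ^^ i) (sqrt_defect B v) = infsum (\<lambda>j. f (i, j)) UNIV" for i
    proof -
      have "bounded_linear (\<lambda>w. ?c i *\<^sub>R (B ^^ i) w)"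
        by (intro bounded_linear_const_scaleR bounded_linear_funpow)
      from infsum_bounded_linear[OF this sqrt_defect_summable[of v]]
      show ?thesis by (simp add: sqrt_defect_def f_def P.scaleR funpow_add)
    qed
    then show ?thesis by (simp add: sqrt_defect_def[of B "sqrt_defect B v"])
  qed
  also have "\<dots> = infsum f (UNIV \<times> UNIV)"
    by (rule infsum_Sigma_banach[OF sf])
  also have "\<dots> = infsum (\<lambda>(k, i). f (i, k - i)) (Sigma UNIV (\<lambda>k. {..k}))"
    by (rule infsum_reindex_bij_witness[where j = "\<lambda>(i, j). (i + j, i)" and i = "\<lambda>(k, i). (i, k - i)"])
      auto
  also have "\<dots> = infsum (\<lambda>k. infsum (\<lambda>i. f (i, k - i)) {..k}) UNIV"
  proof -
    have "(\<lambda>(k, i). f (i, k - i)) summable_on (Sigma UNIV (\<lambda>k. {..k}))"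
      using sf by (subst summable_on_reindex_bij_witness[where T = "UNIV \<times> UNIV" and h = f
          and i = "\<lambda>(i, j). (i + j, i)" and j = "\<lambda>(k, i). (i, k - i)"]) auto
    from infsum_Sigma_banach[OF this] show ?thesis by simp
  qed
  also have "\<dots> = infsum (\<lambda>k. (2 * ?c k - (if k = 1 then 1 else 0)) *\<^sub>R (B ^^ k) v) UNIV"
    by (rule infsum_cong)
      (simp add: f_def scaleR_left.sum[symmetric] sqrt_coeff_convolution)
  also have "\<dots> = infsum (\<lambda>k. 2 *\<^sub>R (?c k *\<^sub>R (B ^^ k) v) + - d k) UNIV"
    by (rule infsum_cong) (auto simp: scaleR_left_diff_distrib d_def)
  also have "\<dots> = 2 *\<^sub>R sqrt_defect B v - infsum d UNIV"
  proof -
    have "d summable_on UNIV"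
      by (rule finite_nonzero_values_imp_summable_on) (auto simp: d_def intro: finite_subset[of _ "{1}"])
    then have "infsum (\<lambda>k. 2 *\<^sub>R (?c k *\<^sub>R (B ^^ k) v) + - d k) UNIV
        = infsum (\<lambda>k. 2 *\<^sub>R (?c k *\<^sub>R (B ^^ k) v)) UNIV + infsum (\<lambda>k. - d k) UNIV"
      by (intro infsum_add[OF summable_on_scaleR_right[OF sqrt_defect_summable]] summable_on_uminus[THEN iffD2])
    then show ?thesis
      by (simp only: infsum_uminus infsum_scaleR_right sqrt_defect_def diff_conv_add_uminus)
  qed
  also have "infsum d UNIV = infsum d {1}"
    by (rule infsum_cong_neutral) (auto simp: d_def)
  finally show ?thesis by (simp add: d_def)
qed

end

section \<open>Hermitian operators that commute with an irreducible set\<close>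

definition commutant :: "('h::chilbert_space \<Rightarrow> 'h) set \<Rightarrow> ('h \<Rightarrow> 'h) set" where
  "commutant \<U> = {A. bounded_linear A \<and> (\<forall>a x. A (a *\<^sub>C x) = a *\<^sub>C A x) \<and> (\<forall>U\<in>\<U>. \<forall>x. A (U x) = U (A x))}"

text \<open>Only the real inner product is used. For complex linear operators this is equivalent to
  the Hermitian condition, as replacing y by i y shows.\<close>

definition selfadjoint :: "('h::chilbert_space \<Rightarrow> 'h) \<Rightarrow> bool" where
  "selfadjoint A \<longleftrightarrow> (\<forall>x y. inner (A x) y = inner x (A y))"

locale irreducible_operators =
  fixes \<U> :: "('h::chilbert_space \<Rightarrow> 'h) set"
  assumes bounded_linear_op: "U \<in> \<U> \<Longrightarrow> bounded_linear U"
    and scaleC_op: "U \<in> \<U> \<Longrightarrow> U (a *\<^sub>C x) = a *\<^sub>C U x"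
    and irreducible: "csubspace V \<Longrightarrow> closed V \<Longrightarrow> \<forall>U\<in>\<U>. U ` V \<subseteq> V \<Longrightarrow> V = {0} \<or> V = UNIV"
    and nontrivial: "\<exists>v::'h. v \<noteq> 0"
begin

lemma commutantD:
  assumes "A \<in> commutant \<U>"
  shows "bounded_linear A" "A (a *\<^sub>C x) = a *\<^sub>C A x" "U \<in> \<U> \<Longrightarrow> A (U x) = U (A x)"
  using assms by (auto simp: commutant_def)

lemma commutant_diff:
  assumes "A \<in> commutant \<U>" "B \<in> commutant \<U>"
  shows "(\<lambda>x. A x - B x) \<in> commutant \<U>"
  using assms by (simp add: commutant_def scaleC_diff_right linear_diff[OF bounded_linear.linear]
      bounded_linear_op bounded_linear_sub)

lemma commutant_scaleC:
  assumes "A \<in> commutant \<U>"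
  shows "(\<lambda>x. a *\<^sub>C A x) \<in> commutant \<U>"
  using assms scaleC_op bounded_linear_compose[OF bounded_linear_scaleC, of A a]
  by (simp add: commutant_def scaleC_scaleC mult.commute)

lemma commutant_id: "(\<lambda>x. x) \<in> commutant \<U>"
  by (simp add: commutant_def bounded_linear_ident)

lemma commutant_comp:
  assumes "A \<in> commutant \<U>" "B \<in> commutant \<U>"
  shows "(\<lambda>x. A (B x)) \<in> commutant \<U>"
  using assms bounded_linear_compose[of A B] by (simp add: commutant_def)

text \<open>Irreducibility enters Schur's lemma only here: the kernel is a closed invariant
  subspace.\<close>

lemma commutant_kernel:
  assumes "A \<in> commutant \<U>"
  shows "(\<forall>v. A v = 0 \<longrightarrow> v = 0) \<or> (\<forall>v. A v = 0)"
proof -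
  interpret A: bounded_linear A using assms by (rule commutantD)
  let ?V = "{v. A v = 0}"
  have "csubspace ?V"
    using commutantD(2)[OF assms] by (auto simp: csubspace_def subspace_def A.zero A.add A.scaleR)
  moreover have "closed ?V" by (intro closed_Collect_eq continuous_intros A.continuous_on)
  moreover have "\<forall>U\<in>\<U>. U ` ?V \<subseteq> ?V"
    using commutantD(3)[OF assms] bounded_linear_op linear_0 bounded_linear.linear by fastforce
  ultimately have "?V = {0} \<or> ?V = UNIV" by (rule irreducible)
  then show ?thesis by auto
qed

text \<open>With \<open>S = \<bar>A\<bar>\<close> one has \<open>(S + A) (S - A) = 0\<close>, and the kernel of \<open>S + A\<close> is an invariant
  subspace, so \<open>A = S\<close> or \<open>A = - S\<close>.\<close>

lemma commutant_contraction_definite: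
  assumes A: "A \<in> commutant \<U>" "selfadjoint A" and le: "\<And>v. norm (A v) \<le> norm v"
  shows "(\<forall>v. 0 \<le> inner (A v) v) \<or> (\<forall>v. inner (A v) v \<le> 0)"
proof -
  interpret A: bounded_linear A using A(1) by (rule commutantD)
  \<comment> \<open>Chosen so that S = 1 - \<open>sqrt_defect B\<close> = sqrt (1 - B) is the square
    root of A^2. It is a contraction because A is Hermitian with norm at most 1.\<close>
  define B where "B = (\<lambda>v. v - A (A v))"
  have B: "B \<in> commutant \<U>"
    unfolding B_def by (rule commutant_diff[OF commutant_id commutant_comp[OF A(1) A(1)]])
  have sa: "inner (A (A v)) v = inner (A v) (A v)" for v using A(2) by (simp add: selfadjoint_def)
  have Ble: "norm (B v) \<le> norm v" for v
  proof -
    have "(norm (B v))\<^sup>2 = (norm v)\<^sup>2 - 2 * (norm (A v))\<^sup>2 + (norm (A (A v)))\<^sup>2"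
      unfolding B_def using sa[of v]
      by (simp add: power2_norm_eq_inner inner_diff inner_commute)
    also have "\<dots> \<le> (norm v)\<^sup>2"
    proof -
      have "(norm (A (A v)))\<^sup>2 \<le> (norm (A v))\<^sup>2" by (intro power_mono le) simp
      then show ?thesis using zero_le_power2[of "norm (A v)"] by linarith
    qed
    finally show ?thesis by (rule power2_le_imp_le) simp
  qed
  note Bb = commutantD(1)[OF B] Ble
  define S where "S = (\<lambda>v. v - sqrt_defect B v)"
  have F: "sqrt_defect B \<in> commutant \<U>"
    unfolding commutant_def
  proof (intro CollectI conjI ballI allI)
    show "bounded_linear (sqrt_defect B)" by (rule bounded_linear_sqrt_defect[OF Bb])
    show "sqrt_defect B (a *\<^sub>C x) = a *\<^sub>C sqrt_defect B x" for a x
      by (rule sqrt_defect_commute[OF Bb bounded_linear_scaleC, symmetric]) (simp add: commutantD(2)[OF B])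
    show "sqrt_defect B (U x) = U (sqrt_defect B x)" if "U \<in> \<U>" for U x
      using that by (intro sqrt_defect_commute[OF Bb bounded_linear_op, symmetric]) (simp_all add: commutantD(3)[OF B])
  qed
  have S: "S \<in> commutant \<U>" unfolding S_def by (rule commutant_diff[OF commutant_id F])
  have SS: "S (S v) = A (A v)" for v
  proof -
    interpret F: bounded_linear "sqrt_defect B" by (rule bounded_linear_sqrt_defect[OF Bb])
    have "S (S v) = v - 2 *\<^sub>R sqrt_defect B v + sqrt_defect B (sqrt_defect B v)"
      by (simp add: S_def F.diff scaleR_2)
    then have "S (S v) = v - B v" by (simp add: sqrt_defect_square[OF Bb])
    then show ?thesis by (simp add: B_def)
  qed
  have SA: "A (S v) = S (A v)" for v
    using sqrt_defect_commute[OF Bb A.bounded_linear_axioms, of v]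
    by (simp add: S_def A.diff B_def)
  have Spos: "0 \<le> inner (S v) v" for v
  proof -
    have "inner (sqrt_defect B v) v \<le> norm (sqrt_defect B v) * norm v" by (rule norm_cauchy_schwarz)
    also have "\<dots> \<le> norm v * norm v" by (intro mult_right_mono norm_sqrt_defect_le[OF Bb]) simp
    finally show ?thesis by (simp add: S_def inner_diff_left dot_square_norm power2_eq_square)
  qed
  have T: "(\<lambda>v. S v - (-1) *\<^sub>C A v) \<in> commutant \<U>"
    by (rule commutant_diff[OF S commutant_scaleC[OF A(1)]])
  have T': "S v - (-1) *\<^sub>C A v = S v + A v" for v by (simp add: scaleC_minus_left)
  from commutant_kernel[OF T, unfolded T'] show ?thesis
  proof
    assume *: "\<forall>v. S v + A v = 0 \<longrightarrow> v = 0"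
    have "S (S v - A v) + A (S v - A v) = 0" for v
    proof -
      interpret S: bounded_linear S using S by (rule commutantD)
      show ?thesis by (simp add: S.diff A.diff SS SA)
    qed
    then have "S v - A v = 0" for v using * by blast
    then have "A v = S v" for v by simp
    then show ?thesis using Spos by simp
  next
    assume "\<forall>v. S v + A v = 0"
    then have "A v = - S v" for v by (metis add.commute add_eq_0_iff)
    then show ?thesis using Spos by simp
  qed
qed

lemma commutant_definite:
  assumes A: "A \<in> commutant \<U>" "selfadjoint A"
  shows "(\<forall>v. 0 \<le> inner (A v) v) \<or> (\<forall>v. inner (A v) v \<le> 0)"
proof -
  interpret A: bounded_linear A using A(1) by (rule commutantD)
  obtain K where K: "K > 0" "\<And>v. norm (A v) \<le> norm v * K" using A.pos_bounded by blast
  define A' where "A' = (\<lambda>v. complex_of_real (1 / K) *\<^sub>C A v)"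
  have A': "A' v = A v /\<^sub>R K" for v by (simp add: A'_def scaleR_scaleC inverse_eq_divide)
  have "A' \<in> commutant \<U>" unfolding A'_def by (rule commutant_scaleC[OF A(1)])
  moreover have "selfadjoint A'" using A(2) by (simp add: A' selfadjoint_def)
  moreover have "norm (A' v) \<le> norm v" for v
    using K(1) K(2)[of v] by (simp add: A' field_simps)
  ultimately have "(\<forall>v. 0 \<le> inner (A' v) v) \<or> (\<forall>v. inner (A' v) v \<le> 0)"
    by (rule commutant_contraction_definite)
  then show ?thesis using K(1) by (simp add: A' zero_le_mult_iff mult_le_0_iff)
qed

text \<open>By \<open>commutant_definite\<close>, every real l is a lower or an upper bound of the
  quadratic form of A relative to the squared norm. At the supremum r of the lower bounds both
  inequalities hold: the one by letting l tend to r from below, the other from above. So A and r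
  have the same quadratic form, and symmetry makes them equal.\<close>

lemma commutant_selfadjoint_scalar:
  assumes A: "A \<in> commutant \<U>" "selfadjoint A"
  obtains r where "\<And>v. A v = r *\<^sub>R v"
proof -
  interpret A: bounded_linear A using A(1) by (rule commutantD)
  obtain K where K: "K > 0" "\<And>v. norm (A v) \<le> norm v * K" using A.pos_bounded by blast
  define L where "L = {l. \<forall>v. l * inner v v \<le> inner (A v) v}"
  have alt: "l \<in> L \<or> (\<forall>v. inner (A v) v \<le> l * inner v v)" for l
  proof -
    have "(\<lambda>v. A v - complex_of_real l *\<^sub>C v) \<in> commutant \<U>"
      by (rule commutant_diff[OF A(1) commutant_scaleC[OF commutant_id]])
    moreover have "selfadjoint (\<lambda>v. A v - complex_of_real l *\<^sub>C v)"
      using A(2) by (simp add: selfadjoint_def scaleR_scaleC[symmetric] inner_diff)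
    ultimately have "(\<forall>v. 0 \<le> inner (A v - complex_of_real l *\<^sub>C v) v)
        \<or> (\<forall>v. inner (A v - complex_of_real l *\<^sub>C v) v \<le> 0)"
      by (rule commutant_definite)
    then show ?thesis by (simp add: L_def scaleR_scaleC[symmetric] inner_diff_left)
  qed
  have abs: "\<bar>inner (A v) v\<bar> \<le> K * inner v v" for v
  proof -
    have "\<bar>inner (A v) v\<bar> \<le> norm (A v) * norm v" by (rule Cauchy_Schwarz_ineq2)
    also have "\<dots> \<le> (norm v * K) * norm v" by (intro mult_right_mono K) simp
    finally show ?thesis by (simp add: dot_square_norm power2_eq_square mult_ac)
  qed
  have ne: "- K \<in> L"
  proof -
    have "- K * inner v v \<le> inner (A v) v" for v using abs[of v] by linarith
    then show ?thesis by (simp add: L_def)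
  qed
  obtain u :: 'h where u: "u \<noteq> 0" using nontrivial by blast
  have bdd: "bdd_above L"
  proof (rule bdd_aboveI)
    fix l assume "l \<in> L"
    then have "l * inner u u \<le> inner (A u) u" unfolding L_def by blast
    then have "l * inner u u \<le> K * inner u u" using abs[of u] by linarith
    then show "l \<le> K" using u by simp
  qed
  define r where "r = Sup L"
  have "inner (A v) v = r * inner v v" for v
  proof (rule antisym)
    have *: "((\<lambda>l. l * inner v v) \<longlongrightarrow> r * inner v v) (at r within X)" for X by (intro tendsto_intros)
    show "r * inner v v \<le> inner (A v) v"
    proof (rule tendsto_upperbound[OF *[of "{..<r}"]])
      show "\<forall>\<^sub>F l in at_left r. l * inner v v \<le> inner (A v) v"
        unfolding eventually_at_filter
      proof (intro always_eventually allI impI)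
        fix l assume "l \<noteq> r" "l \<in> {..<r}"
        then obtain l' where "l' \<in> L" "l < l'"
          using less_cSup_iff[OF _ bdd, of l] ne unfolding r_def by blast
        then have "l * inner v v \<le> l' * inner v v" by (intro mult_right_mono) auto
        then show "l * inner v v \<le> inner (A v) v"
          using \<open>l' \<in> L\<close> unfolding L_def by (auto intro: order_trans)
      qed
    qed simp
    show "inner (A v) v \<le> r * inner v v"
    proof (rule tendsto_lowerbound[OF *[of "{r<..}"]])
      show "\<forall>\<^sub>F l in at_right r. inner (A v) v \<le> l * inner v v"
        unfolding eventually_at_filter
      proof (intro always_eventually allI impI)
        fix l assume "l \<noteq> r" "l \<in> {r<..}"
        then have "l \<notin> L" using cSup_upper[OF _ bdd, of l] unfolding r_def by force
        then show "inner (A v) v \<le> l * inner v v" using alt by blast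
      qed
    qed simp
  qed
  then have zero: "inner (A v - r *\<^sub>R v) v = 0" for v by (simp add: inner_diff_left)
  have "A v - r *\<^sub>R v = 0" for v
  proof -
    define D where "D = (\<lambda>v. A v - r *\<^sub>R v)"
    have Dadd: "D (x + y) = D x + D y" for x y by (simp add: D_def A.add scaleR_add_right)
    have sym: "inner (D x) y = inner (D y) x" for x y
      using A(2) by (simp add: D_def selfadjoint_def inner_diff inner_commute)
    have z: "inner (D x) x = 0" for x using zero by (simp add: D_def)
    \<comment> \<open>A symmetric operator with vanishing quadratic form is zero: evaluating the
      form at v + D v isolates the squared norm of D v.\<close>
    have "inner (D (v + D v)) (v + D v) = 2 * inner (D v) (D v)"
      using z[of v] z[of "D v"] sym[of "D v" v] by (simp add: Dadd inner_add)
    then have "inner (D v) (D v) = 0" using z by simp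
    then show ?thesis by (simp add: D_def)
  qed
  then show ?thesis using that[of r] by simp
qed

text \<open>T is a combination of the Hermitian operators T + T' and i (T - T'), each of which is a
  real scalar. The set of operators is not assumed to be closed under adjoints, so it has to be
  given that the adjoint T' lies in the commutant.\<close>

lemma schur:
  assumes T: "T \<in> commutant \<U>" and T': "T' \<in> commutant \<U>"
    and adj: "\<And>x y. cinner (T x) y = cinner x (T' y)"
  obtains s where "\<And>v. T v = s *\<^sub>C v"
proof -
  have adj': "cinner (T' x) y = cinner x (T y)" for x y by (metis adj cinner_commute)
  define A where "A = (\<lambda>v. T v - (- 1) *\<^sub>C T' v)"
  define D where "D = (\<lambda>v. \<i> *\<^sub>C (T v - T' v))"
  have A: "A v = T v + T' v" for v by (simp add: A_def scaleC_minus_left)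
  have cA: "A \<in> commutant \<U>" "D \<in> commutant \<U>"
    unfolding A_def D_def
    by (rule commutant_diff[OF T commutant_scaleC[OF T']]) (rule commutant_scaleC[OF commutant_diff[OF T T']])
  have "selfadjoint A"
    by (simp add: selfadjoint_def inner_cinner A cinner_add_left cinner_add_right adj adj')
  then obtain a where a: "\<And>v. A v = a *\<^sub>R v" using commutant_selfadjoint_scalar cA(1) by blast
  have "selfadjoint D"
    by (simp add: selfadjoint_def inner_cinner D_def cinner_scaleC_left cinner_scaleC_right
        cinner.diff_left cinner.diff_right adj adj')
  then obtain d where d: "\<And>v. D v = d *\<^sub>R v" using commutant_selfadjoint_scalar cA(2) by blast
  have "T v = (complex_of_real (a / 2) - \<i> * complex_of_real (d / 2)) *\<^sub>C v" for v
  proof -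
    have "- \<i> *\<^sub>C D v = T v - T' v" by (simp add: D_def scaleC_scaleC)
    then have "2 *\<^sub>R T v = A v + (- \<i>) *\<^sub>C D v" by (simp add: A scaleR_2)
    also have "\<dots> = complex_of_real a *\<^sub>C v + (- \<i>) *\<^sub>C (complex_of_real d *\<^sub>C v)"
      by (simp only: a d scaleR_scaleC)
    finally have "(1/2) *\<^sub>R 2 *\<^sub>R T v = (1/2) *\<^sub>R ((complex_of_real a - \<i> * complex_of_real d) *\<^sub>C v)"
      by (simp add: scaleC_scaleC scaleC_add_left[symmetric])
    then show ?thesis
      by (simp add: scaleR_scaleC[of "1/2"] scaleC_scaleC algebra_simps)
  qed
  then show ?thesis using that by blast
qed

end

section \<open>Boards\<close>

text \<open>The part of \<open>is_board\<close> that holds before empty chebureks are discarded and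
  that survives a change of label sets. Intermediate results of cutting, gluing and forgetting
  labels are boards only in this sense.\<close>

definition pre_board :: "nat \<Rightarrow> enat \<Rightarrow> enat \<Rightarrow> 'f board \<Rightarrow> bool" where
  "pre_board n \<beta> \<alpha> X \<longleftrightarrow>
     (\<forall>i\<in>{1..n}. bij_betw (glue X i) (black X) (white X)) \<and>
     inj_on (blab X) (labels \<beta>) \<and> blab X ` labels \<beta> \<subseteq> black X \<and>
     inj_on (wlab X) (labels \<alpha>) \<and> wlab X ` labels \<alpha> \<subseteq> white X"

definition nontrivial_faces :: "nat \<Rightarrow> 'f board \<Rightarrow> 'f set" where
  "nontrivial_faces n X = {b \<in> black X. \<nexists>w. cheburek n X b w}"

text \<open>The maps are explicit arguments so that isomorphisms can be composed, inverted and
  carried through discarding and gluing.\<close>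

definition iso_by :: "nat \<Rightarrow> enat \<Rightarrow> enat \<Rightarrow> ('f \<Rightarrow> 'g) \<Rightarrow> ('f \<Rightarrow> 'g) \<Rightarrow> 'f board \<Rightarrow> 'g board \<Rightarrow> bool" where
  "iso_by n \<beta> \<alpha> \<phi> \<psi> X Y \<longleftrightarrow>
     bij_betw \<phi> (black X) (black Y) \<and> bij_betw \<psi> (white X) (white Y) \<and>
     (\<forall>i\<in>{1..n}. \<forall>b\<in>black X. \<psi> (glue X i b) = glue Y i (\<phi> b)) \<and>
     (\<forall>j\<in>labels \<beta>. \<phi> (blab X j) = blab Y j) \<and> (\<forall>j\<in>labels \<alpha>. \<psi> (wlab X j) = wlab Y j)"

lemma board_iso_iff: "board_iso n \<beta> \<alpha> X Y \<longleftrightarrow> (\<exists>\<phi> \<psi>. iso_by n \<beta> \<alpha> \<phi> \<psi> X Y)"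
  by (simp add: board_iso_def iso_by_def)

lemma labels_0 [simp]: "labels 0 = {}"
  and labels_infinity [simp]: "labels \<infinity> = UNIV"
  and labels_enat: "labels (enat k) = {..<k}"
  by (auto simp: labels_def)

lemma labels_mono: "\<beta> \<le> \<gamma> \<Longrightarrow> labels \<beta> \<subseteq> labels \<gamma>"
  by (auto simp: labels_def)

lemma pre_boardD:
  assumes "pre_board n \<beta> \<alpha> X"
  shows "i \<in> {1..n} \<Longrightarrow> bij_betw (glue X i) (black X) (white X)"
    and "i \<in> {1..n} \<Longrightarrow> b \<in> black X \<Longrightarrow> glue X i b \<in> white X"
    and "i \<in> {1..n} \<Longrightarrow> b \<in> black X \<Longrightarrow> b' \<in> black X \<Longrightarrow> glue X i b = glue X i b' \<longleftrightarrow> b = b'"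
    and "i \<in> {1..n} \<Longrightarrow> w \<in> white X \<Longrightarrow> \<exists>b\<in>black X. w = glue X i b"
    and "j \<in> labels \<beta> \<Longrightarrow> blab X j \<in> black X"
    and "j \<in> labels \<alpha> \<Longrightarrow> wlab X j \<in> white X"
    and "j \<in> labels \<beta> \<Longrightarrow> k \<in> labels \<beta> \<Longrightarrow> blab X j = blab X k \<longleftrightarrow> j = k"
    and "j \<in> labels \<alpha> \<Longrightarrow> k \<in> labels \<alpha> \<Longrightarrow> wlab X j = wlab X k \<longleftrightarrow> j = k"
proof -
  have glue: "bij_betw (glue X i) (black X) (white X)" if "i \<in> {1..n}" for i
    using assms that unfolding pre_board_def by blast
  show "i \<in> {1..n} \<Longrightarrow> bij_betw (glue X i) (black X) (white X)"
    and "i \<in> {1..n} \<Longrightarrow> b \<in> black X \<Longrightarrow> glue X i b \<in> white X"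
    and "i \<in> {1..n} \<Longrightarrow> b \<in> black X \<Longrightarrow> b' \<in> black X \<Longrightarrow> glue X i b = glue X i b' \<longleftrightarrow> b = b'"
    and "i \<in> {1..n} \<Longrightarrow> w \<in> white X \<Longrightarrow> \<exists>b\<in>black X. w = glue X i b"
    using glue[of i] by (auto simp: bij_betw_def inj_on_eq_iff)
qed (use assms in \<open>auto simp: pre_board_def inj_on_eq_iff\<close>)

lemma pre_board_mono:
  assumes "pre_board n \<beta> \<alpha> X" "\<beta>' \<le> \<beta>" "\<alpha>' \<le> \<alpha>"
  shows "pre_board n \<beta>' \<alpha>' X"
  using assms labels_mono[OF assms(2)] labels_mono[OF assms(3)]
  unfolding pre_board_def by (blast intro: inj_on_subset)

lemma cheburek_unique:
  assumes "pre_board n \<beta> \<alpha> X" "n \<ge> 1" "cheburek n X b w"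
  shows "i \<in> {1..n} \<Longrightarrow> b' \<in> black X \<Longrightarrow> glue X i b' = w \<longleftrightarrow> b' = b"
    and "cheburek n X b w' \<longleftrightarrow> w' = w" "cheburek n X b' w \<longleftrightarrow> b' = b"
proof -
  show *: "glue X i b' = w \<longleftrightarrow> b' = b" if "i \<in> {1..n}" "b' \<in> black X" for i b'
    using assms(3) that pre_boardD(3)[OF assms(1), of i b' b] unfolding cheburek_def by auto
  have 1: "(1::nat) \<in> {1..n}" using assms(2) by simp
  show "cheburek n X b w' \<longleftrightarrow> w' = w" "cheburek n X b' w \<longleftrightarrow> b' = b"
    using assms(3) 1 *[OF 1] unfolding cheburek_def by metis+
qed

subsection \<open>Components\<close>

lemma rtrancl_Image_closed:
  fixes r :: "('a \<times> 'a) set"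
  assumes "x \<in> S" "\<And>y z. (y, z) \<in> r \<Longrightarrow> y \<in> S \<Longrightarrow> z \<in> S"
  shows "r\<^sup>* `` {x} \<subseteq> S"
proof
  fix y assume "y \<in> r\<^sup>* `` {x}"
  then have "(x, y) \<in> r\<^sup>*" by simp
  then show "y \<in> S" by (induction rule: rtrancl_induct) (use assms in auto)
qed

text \<open>Let S consist of the black faces outside chebureks and their white neighbors. Since
  gluing is injective, S is closed under adjacency, so each component lies inside S or is a
  cheburek. Conversely, each face outside chebureks lies in one of the finitely many components that
  are not chebureks. After this lemma only faces are counted and connectedness is no longer
  discussed.\<close>

lemma components_finite_iff:
  fixes X :: "'f board"
  assumes "pre_board n \<beta> \<alpha> X" "n \<ge> 1"
  shows "(\<forall>C\<in>components_of_board n X. finite C) \<and>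
      finite {C \<in> components_of_board n X. \<not> (\<exists>b w. cheburek n X b w \<and> C = {Inl b, Inr w})}
    \<longleftrightarrow> finite (nontrivial_faces n X)" (is "?L1 \<and> finite ?L2 \<longleftrightarrow> finite ?N")
proof
  let ?r = "(adjacent n X \<union> (adjacent n X)\<inverse>)\<^sup>*"
  assume L: "?L1 \<and> finite ?L2"
  have "Inl ` ?N \<subseteq> \<Union>?L2"
  proof
    fix x :: "'f + 'f" assume "x \<in> Inl ` ?N"
    then obtain b where b: "x = Inl b" "b \<in> black X" "\<nexists>w. cheburek n X b w"
      by (auto simp: nontrivial_faces_def)
    have "?r `` {x} \<in> components_of_board n X"
      unfolding components_of_board_def by (rule quotientI) (use b in auto)
    moreover have "x \<in> ?r `` {x}" by simp
    moreover have "\<not> (cheburek n X b' w' \<and> ?r `` {x} = {Inl b', Inr w'})" for b' w'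
    proof
      assume *: "cheburek n X b' w' \<and> ?r `` {x} = {Inl b', Inr w'}"
      then have "x \<in> {Inl b', Inr w'}" using \<open>x \<in> ?r `` {x}\<close> by simp
      then show False using * b by auto
    qed
    ultimately show "x \<in> \<Union>?L2" by (intro UnionI[of "?r `` {x}"]) simp_all
  qed
  moreover have "finite (\<Union>?L2)" using L by blast
  ultimately have "finite (Inl ` ?N :: ('f + 'f) set)" by (rule finite_subset)
  then show "finite ?N" by (rule finite_imageD) simp
next
  let ?E = "adjacent n X \<union> (adjacent n X)\<inverse>"
  note D = pre_boardD[OF assms(1)]
  assume fin: "finite ?N"
  have one: "(1::nat) \<in> {1..n}" using assms(2) by simp
  define S where "S = (Inl ` ?N \<union> (\<Union>i\<in>{1..n}. Inr ` glue X i ` ?N) :: ('f + 'f) set)"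
  have S: "finite S" using fin by (simp add: S_def)
  have S_iff: "Inl b \<in> S \<longleftrightarrow> b \<in> ?N" "Inr w \<in> S \<longleftrightarrow> (\<exists>i\<in>{1..n}. \<exists>b\<in>?N. w = glue X i b)" for b w
    unfolding S_def by (auto simp: image_iff)
  have memS: "Inl b \<in> S" "i \<in> {1..n} \<Longrightarrow> Inr (glue X i b) \<in> S" if "b \<in> ?N" for b i
    using that S_iff by blast+
  have NT: "b \<in> ?N" if "b \<in> black X" "i \<in> {1..n}" "Inr (glue X i b) \<in> S" for b i
  proof -
    from that(3) obtain j b' where j: "j \<in> {1..n}" "b' \<in> ?N" "glue X i b = glue X j b'"
      unfolding S_iff by blast
    have b': "b' \<in> black X" using j(2) by (simp add: nontrivial_faces_def)
    show ?thesis
    proof (rule ccontr)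
      assume "b \<notin> ?N"
      with that(1) obtain w where w: "cheburek n X b w" by (auto simp: nontrivial_faces_def)
      then have "glue X j b' = w" using j(3) that(2) by (simp add: cheburek_def)
      then have "b' = b" using cheburek_unique(1)[OF assms w] j b' by blast
      then show False using \<open>b \<notin> ?N\<close> j(2) by simp
    qed
  qed
  have subS: "?E\<^sup>* `` {x} \<subseteq> S" if "x \<in> S" for x
  proof (rule rtrancl_Image_closed[OF that])
    fix y z assume yz: "(y, z) \<in> ?E" "y \<in> S"
    then obtain i b where i: "i \<in> {1..n}" "b \<in> black X"
      "(y = Inl b \<and> z = Inr (glue X i b)) \<or> (z = Inl b \<and> y = Inr (glue X i b))"
      by (auto simp: adjacent_def)
    then have "b \<in> ?N" using NT yz(2) S_iff(1) by metis
    then show "z \<in> S" using i memS by blast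
  qed
  have cheb: "?E\<^sup>* `` {x} = {Inl b, Inr w}" if bw: "cheburek n X b w" and x: "x \<in> {Inl b, Inr w}" for b w x
  proof
    show "?E\<^sup>* `` {x} \<subseteq> {Inl b, Inr w}"
    proof (rule rtrancl_Image_closed[OF x])
      fix y z assume "(y, z) \<in> ?E" "y \<in> {Inl b, Inr w}"
      then show "z \<in> {Inl b, Inr w}"
        using cheburek_unique(1)[OF assms bw] bw unfolding adjacent_def cheburek_def by fastforce
    qed
    have "(Inl b, Inr w) \<in> adjacent n X"
      using bw one unfolding adjacent_def cheburek_def by force
    then show "{Inl b, Inr w} \<subseteq> ?E\<^sup>* `` {x}" using x by auto
  qed
  have main: "C \<subseteq> S \<or> (\<exists>b w. cheburek n X b w \<and> C = {Inl b, Inr w})"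
    if "C \<in> components_of_board n X" for C
  proof -
    obtain x where x: "x \<in> Sum_Type.Plus (black X) (white X)" "C = ?E\<^sup>* `` {x}"
      using \<open>C \<in> components_of_board n X\<close> unfolding components_of_board_def by (rule quotientE)
    show ?thesis
    proof (cases "x \<in> S")
      case True
      then show ?thesis using subS x by blast
    next
      case False
      obtain b where b: "b \<in> black X" "x = Inl b \<or> x = Inr (glue X 1 b)"
        using x(1) D(4)[OF one] by blast
      have "b \<notin> ?N" using False b memS one by blast
      then obtain w where w: "cheburek n X b w" using b(1) by (auto simp: nontrivial_faces_def)
      then have "x \<in> {Inl b, Inr w}" using b(2) one by (auto simp: cheburek_def)
      then show ?thesis using cheb[OF w] w x(2) by blast
    qed
  qed
  have "finite C" if "C \<in> components_of_board n X" for C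
    using main[OF that] S finite_subset by auto
  moreover have "?L2 \<subseteq> Pow S" using main by blast
  then have "finite ?L2" using S finite_subset by blast
  ultimately show "?L1 \<and> finite ?L2" by blast
qed

lemma is_board_iff:
  assumes "n \<ge> 1"
  shows "is_board n \<beta> \<alpha> X \<longleftrightarrow> pre_board n \<beta> \<alpha> X \<and> finite (nontrivial_faces n X) \<and>
     (\<nexists>b w. empty_cheburek n \<beta> \<alpha> X b w)" (is "_ \<longleftrightarrow> ?R")
proof -
  have "is_board n \<beta> \<alpha> X \<longleftrightarrow> pre_board n \<beta> \<alpha> X \<and> ((\<forall>C\<in>components_of_board n X. finite C) \<and>
      finite {C \<in> components_of_board n X. \<not> (\<exists>b w. cheburek n X b w \<and> C = {Inl b, Inr w})})
      \<and> (\<nexists>b w. empty_cheburek n \<beta> \<alpha> X b w)"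
    unfolding is_board_def pre_board_def by blast
  also have "\<dots> \<longleftrightarrow> ?R" using components_finite_iff[OF _ assms] by blast
  finally show ?thesis .
qed

lemma is_boardD:
  assumes "is_board n \<beta> \<alpha> X"
  shows "pre_board n \<beta> \<alpha> X" "\<not> empty_cheburek n \<beta> \<alpha> X b w"
  using assms unfolding is_board_def pre_board_def by blast+

subsection \<open>Isomorphisms\<close>

lemma iso_byD:
  assumes "iso_by n \<beta> \<alpha> \<phi> \<psi> X Y"
  shows "bij_betw \<phi> (black X) (black Y)" "bij_betw \<psi> (white X) (white Y)"
    and "i \<in> {1..n} \<Longrightarrow> b \<in> black X \<Longrightarrow> glue Y i (\<phi> b) = \<psi> (glue X i b)"
    and "j \<in> labels \<beta> \<Longrightarrow> blab Y j = \<phi> (blab X j)" "j \<in> labels \<alpha> \<Longrightarrow> wlab Y j = \<psi> (wlab X j)"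
    and "b \<in> black X \<Longrightarrow> \<phi> b \<in> black Y" "w \<in> white X \<Longrightarrow> \<psi> w \<in> white Y"
    and "b \<in> black X \<Longrightarrow> b' \<in> black X \<Longrightarrow> \<phi> b = \<phi> b' \<longleftrightarrow> b = b'"
    and "w \<in> white X \<Longrightarrow> w' \<in> white X \<Longrightarrow> \<psi> w = \<psi> w' \<longleftrightarrow> w = w'"
    and "c \<in> black Y \<Longrightarrow> \<exists>b\<in>black X. c = \<phi> b" "u \<in> white Y \<Longrightarrow> \<exists>w\<in>white X. u = \<psi> w"
  using assms unfolding iso_by_def bij_betw_def by (auto simp: inj_on_eq_iff)

lemma iso_by_mono:
  assumes "iso_by n \<beta> \<alpha> \<phi> \<psi> X Y" "\<beta>' \<le> \<beta>" "\<alpha>' \<le> \<alpha>"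
  shows "iso_by n \<beta>' \<alpha>' \<phi> \<psi> X Y"
  using assms(1) labels_mono[OF assms(2)] labels_mono[OF assms(3)] unfolding iso_by_def by blast

lemma iso_by_trans:
  assumes "iso_by n \<beta> \<alpha> \<phi> \<psi> X Y" "iso_by n \<beta> \<alpha> \<phi>' \<psi>' Y Z"
  shows "iso_by n \<beta> \<alpha> (\<phi>' \<circ> \<phi>) (\<psi>' \<circ> \<psi>) X Z"
  unfolding iso_by_def
proof (intro conjI ballI)
  show "bij_betw (\<phi>' \<circ> \<phi>) (black X) (black Z)" "bij_betw (\<psi>' \<circ> \<psi>) (white X) (white Z)"
    using iso_byD(1,2)[OF assms(1)] iso_byD(1,2)[OF assms(2)] bij_betw_trans by blast+
qed (use iso_byD(3-7)[OF assms(1)] iso_byD(3-5)[OF assms(2)] in auto)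

lemma iso_by_sym:
  assumes X: "pre_board n \<beta> \<alpha> X" and "iso_by n \<beta> \<alpha> \<phi> \<psi> X Y"
  shows "iso_by n \<beta> \<alpha> (the_inv_into (black X) \<phi>) (the_inv_into (white X) \<psi>) Y X"
proof -
  note I = iso_byD[OF assms(2)] and D = pre_boardD[OF X]
  have inv: "the_inv_into (black X) \<phi> (\<phi> b) = b" "the_inv_into (white X) \<psi> (\<psi> w) = w"
    if "b \<in> black X" "w \<in> white X" for b w
    using that I(1,2) by (auto simp: bij_betw_def the_inv_into_f_f)
  show ?thesis unfolding iso_by_def
  proof (intro conjI ballI)
    show "bij_betw (the_inv_into (black X) \<phi>) (black Y) (black X)"
      "bij_betw (the_inv_into (white X) \<psi>) (white Y) (white X)"
      using I(1,2) by (auto intro: bij_betw_the_inv_into)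
    fix i c assume i: "i \<in> {1..n}" and "c \<in> black Y"
    then obtain b where b: "b \<in> black X" "c = \<phi> b" using I(10) by blast
    then show "the_inv_into (white X) \<psi> (glue Y i c) = glue X i (the_inv_into (black X) \<phi> c)"
      using I(1,2) D(2)[OF i] i by (simp add: I(3) bij_betw_def the_inv_into_f_f)
  qed (use I D in \<open>auto simp: bij_betw_def the_inv_into_f_f\<close>)
qed

lemma iso_by_pre_board:
  assumes X: "pre_board n \<beta> \<alpha> X" and iso: "iso_by n \<beta> \<alpha> \<phi> \<psi> X Y"
  shows "pre_board n \<beta> \<alpha> Y"
  unfolding pre_board_def
proof (intro conjI ballI)
  note I = iso_byD[OF iso] and D = pre_boardD[OF X]
  fix i assume i: "i \<in> {1..n}"
  have "bij_betw (\<psi> \<circ> glue X i) (black X) (white Y)"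
    using bij_betw_trans[OF D(1)[OF i] I(2)] .
  then have "bij_betw (glue Y i \<circ> \<phi>) (black X) (white Y)"
    by (rule iffD1[OF bij_betw_cong, rotated]) (use I(3)[OF i] in auto)
  then show "bij_betw (glue Y i) (black Y) (white Y)" using I(1) by (simp add: bij_betw_comp_iff)
next
  note I = iso_byD[OF iso] and D = pre_boardD[OF X]
  show "inj_on (blab Y) (labels \<beta>)" "inj_on (wlab Y) (labels \<alpha>)"
    by (auto simp: inj_on_def I(4,5,8,9) D(5-8))
  show "blab Y ` labels \<beta> \<subseteq> black Y" "wlab Y ` labels \<alpha> \<subseteq> white Y"
    by (auto simp: I(4-7) D(5,6))
qed

lemma iso_by_cheburek:
  assumes X: "pre_board n \<beta> \<alpha> X" and iso: "iso_by n \<beta> \<alpha> \<phi> \<psi> X Y"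
    and "b \<in> black X" "w \<in> white X"
  shows "cheburek n Y (\<phi> b) (\<psi> w) \<longleftrightarrow> cheburek n X b w"
    and "empty_cheburek n \<beta> \<alpha> Y (\<phi> b) (\<psi> w) \<longleftrightarrow> empty_cheburek n \<beta> \<alpha> X b w"
proof -
  note I = iso_byD[OF iso] and D = pre_boardD[OF X]
  show *: "cheburek n Y (\<phi> b) (\<psi> w) \<longleftrightarrow> cheburek n X b w"
    using assms(3,4) by (auto simp: cheburek_def I(3,6,7,9) D(2))
  have "\<phi> b \<in> blab Y ` labels \<beta> \<longleftrightarrow> b \<in> blab X ` labels \<beta>"
    "\<psi> w \<in> wlab Y ` labels \<alpha> \<longleftrightarrow> w \<in> wlab X ` labels \<alpha>"
    using assms(3,4) by (auto simp: image_iff I(4,5,8,9) D(5,6))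
  then show "empty_cheburek n \<beta> \<alpha> Y (\<phi> b) (\<psi> w) \<longleftrightarrow> empty_cheburek n \<beta> \<alpha> X b w"
    unfolding empty_cheburek_def using * by blast
qed

lemma iso_by_nontrivial_faces:
  assumes X: "pre_board n \<beta> \<alpha> X" and iso: "iso_by n \<beta> \<alpha> \<phi> \<psi> X Y"
  shows "nontrivial_faces n Y = \<phi> ` nontrivial_faces n X"
proof -
  note I = iso_byD[OF iso] and C = iso_by_cheburek(1)[OF assms]
  have *: "(\<exists>u. cheburek n Y (\<phi> b) u) \<longleftrightarrow> (\<exists>w. cheburek n X b w)" if "b \<in> black X" for b
  proof -
    have "cheburek n X b w \<Longrightarrow> w \<in> white X" "cheburek n Y c u \<Longrightarrow> u \<in> white Y" for c w u
      by (simp_all add: cheburek_def)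
    then show ?thesis using C[OF that] I(11) by blast
  qed
  show ?thesis
  proof
    show "\<phi> ` nontrivial_faces n X \<subseteq> nontrivial_faces n Y"
      using * I(6) by (auto simp: nontrivial_faces_def)
    show "nontrivial_faces n Y \<subseteq> \<phi> ` nontrivial_faces n X"
    proof
      fix c assume c: "c \<in> nontrivial_faces n Y"
      then obtain b where b: "b \<in> black X" "c = \<phi> b" using I(10) by (auto simp: nontrivial_faces_def)
      then have "b \<in> nontrivial_faces n X" using * c by (auto simp: nontrivial_faces_def)
      then show "c \<in> \<phi> ` nontrivial_faces n X" using b by blast
    qed
  qed
qed

lemma iso_by_is_board:
  assumes X: "is_board n \<beta> \<alpha> X" and iso: "iso_by n \<beta> \<alpha> \<phi> \<psi> X Y" and n: "n \<ge> 1"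
  shows "is_board n \<beta> \<alpha> Y"
proof -
  note I = iso_byD[OF iso] and P = is_boardD(1)[OF X]
  have "\<not> empty_cheburek n \<beta> \<alpha> Y c u" for c u
  proof
    assume *: "empty_cheburek n \<beta> \<alpha> Y c u"
    then obtain b w where "b \<in> black X" "w \<in> white X" "c = \<phi> b" "u = \<psi> w"
      using I(10,11) unfolding empty_cheburek_def cheburek_def by blast
    then show False using * iso_by_cheburek(2)[OF P iso] is_boardD(2)[OF X] by blast
  qed
  then show ?thesis
    using X iso_by_pre_board[OF P iso] iso_by_nontrivial_faces[OF P iso] by (simp add: is_board_iff[OF n])
qed

lemma board_class_eq:
  assumes "pre_board n \<beta> \<alpha> X" "iso_by n \<beta> \<alpha> \<phi> \<psi> X Y"
  shows "board_class n \<beta> \<alpha> X = board_class n \<beta> \<alpha> Y"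
  using assms unfolding board_class_def board_iso_iff by (blast intro: iso_by_trans iso_by_sym)

text \<open>Classes contain only boards whose faces are natural numbers, while gluing and disjoint
  union produce faces in sum types; these have to be renumbered before they can represent a
  class.\<close>

lemma nat_board_exists:
  fixes X :: "'f::countable board"
  obtains Y :: "nat board" and \<phi> \<psi> where "iso_by n \<beta> \<alpha> \<phi> \<psi> X Y"
proof
  show "iso_by n \<beta> \<alpha> to_nat to_nat X
    \<lparr>black = to_nat ` black X, white = to_nat ` white X, glue = (\<lambda>i. to_nat \<circ> glue X i \<circ> from_nat),
     blab = to_nat \<circ> blab X, wlab = to_nat \<circ> wlab X\<rparr>"
    by (auto simp: iso_by_def bij_betw_def)
qed

lemma board_class_nonempty:
  fixes X :: "'f::countable board"
  assumes "is_board n \<beta> \<alpha> X" "n \<ge> 1"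
  obtains Y \<phi> \<psi> where "Y \<in> board_class n \<beta> \<alpha> X" "is_board n \<beta> \<alpha> Y" "iso_by n \<beta> \<alpha> \<phi> \<psi> X Y"
proof -
  obtain Y :: "nat board" and \<phi> \<psi> where "iso_by n \<beta> \<alpha> \<phi> \<psi> X Y" by (rule nat_board_exists)
  then show ?thesis
    using that iso_by_is_board[OF assms(1) _ assms(2)] unfolding board_class_def board_iso_iff by blast
qed

lemma board_class_in_Mor:
  fixes X :: "'f::countable board"
  assumes "is_board n \<beta> \<alpha> X" "n \<ge> 1"
  shows "board_class n \<beta> \<alpha> X \<in> Mor n \<beta> \<alpha>"
proof -
  obtain Y \<phi> \<psi> where Y: "Y \<in> board_class n \<beta> \<alpha> X" "is_board n \<beta> \<alpha> Y" "iso_by n \<beta> \<alpha> \<phi> \<psi> X Y"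
    by (rule board_class_nonempty[OF assms])
  have "board_class n \<beta> \<alpha> X = board_class n \<beta> \<alpha> Y"
    by (rule board_class_eq[OF is_boardD(1)[OF assms(1)] Y(3)])
  then show ?thesis unfolding Mor_def using Y(2) by simp
qed

lemma board_classE:
  assumes "Y \<in> board_class n \<beta> \<alpha> X"
  obtains \<phi> \<psi> where "is_board n \<beta> \<alpha> Y" "iso_by n \<beta> \<alpha> \<phi> \<psi> X Y"
  using assms unfolding board_class_def board_iso_iff by blast

subsection \<open>Discarding and composing\<close>

lemma discard_empty_simps [simp]:
  "glue (discard_empty n \<beta> \<alpha> X) = glue X" "blab (discard_empty n \<beta> \<alpha> X) = blab X"
  "wlab (discard_empty n \<beta> \<alpha> X) = wlab X"
  "black (discard_empty n \<beta> \<alpha> X) = {b \<in> black X. \<nexists>w. empty_cheburek n \<beta> \<alpha> X b w}"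
  "white (discard_empty n \<beta> \<alpha> X) = {w \<in> white X. \<nexists>b. empty_cheburek n \<beta> \<alpha> X b w}"
  by (simp_all add: discard_empty_def)

lemma discard_empty_id:
  assumes "\<And>b w. \<not> empty_cheburek n \<beta> \<alpha> X b w"
  shows "discard_empty n \<beta> \<alpha> X = X"
  using assms by (simp add: discard_empty_def)

context
  fixes n \<beta> \<alpha> and X :: "'f board"
  assumes X: "pre_board n \<beta> \<alpha> X" and n: "n \<ge> 1"
begin

text \<open>Discarding removes black and white faces in matching pairs, which is why the gluing maps
  remain bijections.\<close>

lemma glue_in_empty_cheburek_iff:
  assumes "i \<in> {1..n}" "b \<in> black X"
  shows "(\<exists>b'. empty_cheburek n \<beta> \<alpha> X b' (glue X i b)) \<longleftrightarrow> (\<exists>w. empty_cheburek n \<beta> \<alpha> X b w)"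
proof -
  have "b' = b" if "empty_cheburek n \<beta> \<alpha> X b' (glue X i b)" for b'
    using that cheburek_unique(1)[OF X n _ assms] unfolding empty_cheburek_def by metis
  moreover have "w = glue X i b" if "empty_cheburek n \<beta> \<alpha> X b w" for w
    using that assms unfolding empty_cheburek_def cheburek_def by auto
  ultimately show ?thesis by blast
qed

lemma pre_board_discard_empty: "pre_board n \<beta> \<alpha> (discard_empty n \<beta> \<alpha> X)"
  unfolding pre_board_def discard_empty_simps
proof (intro conjI ballI)
  note D = pre_boardD[OF X]
  fix i assume i: "i \<in> {1..n}"
  have "glue X i ` {b \<in> black X. \<nexists>w. empty_cheburek n \<beta> \<alpha> X b w}
      = {w \<in> white X. \<nexists>b. empty_cheburek n \<beta> \<alpha> X b w}"
    using glue_in_empty_cheburek_iff[OF i] D(2,4)[OF i] by blast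
  then show "bij_betw (glue X i) {b \<in> black X. \<nexists>w. empty_cheburek n \<beta> \<alpha> X b w}
      {w \<in> white X. \<nexists>b. empty_cheburek n \<beta> \<alpha> X b w}"
    by (rule bij_betw_subset[OF D(1)[OF i], rotated]) blast
next
  show "blab X ` labels \<beta> \<subseteq> {b \<in> black X. \<nexists>w. empty_cheburek n \<beta> \<alpha> X b w}"
    "wlab X ` labels \<alpha> \<subseteq> {w \<in> white X. \<nexists>b. empty_cheburek n \<beta> \<alpha> X b w}"
    using pre_boardD(5,6)[OF X] by (auto simp: empty_cheburek_def)
qed (use X in \<open>simp_all add: pre_board_def\<close>)

lemma cheburek_discard_empty:
  "cheburek n (discard_empty n \<beta> \<alpha> X) b w \<longleftrightarrow> cheburek n X b w \<and> \<not> empty_cheburek n \<beta> \<alpha> X b w"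
proof
  assume "cheburek n (discard_empty n \<beta> \<alpha> X) b w"
  then show "cheburek n X b w \<and> \<not> empty_cheburek n \<beta> \<alpha> X b w" by (simp add: cheburek_def)
next
  assume *: "cheburek n X b w \<and> \<not> empty_cheburek n \<beta> \<alpha> X b w"
  have "w' = w" if "empty_cheburek n \<beta> \<alpha> X b w'" for w'
    using that * cheburek_unique(2)[OF X n] unfolding empty_cheburek_def by metis
  moreover have "b' = b" if "empty_cheburek n \<beta> \<alpha> X b' w" for b'
    using that * cheburek_unique(3)[OF X n] unfolding empty_cheburek_def by metis
  ultimately show "cheburek n (discard_empty n \<beta> \<alpha> X) b w"
    using * by (auto simp: cheburek_def)
qed

lemma nontrivial_faces_discard_empty:
  "nontrivial_faces n (discard_empty n \<beta> \<alpha> X) = nontrivial_faces n X"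
  unfolding nontrivial_faces_def cheburek_discard_empty discard_empty_simps
  by (auto simp: empty_cheburek_def)

lemma is_board_discard_empty:
  assumes "finite (nontrivial_faces n X)"
  shows "is_board n \<beta> \<alpha> (discard_empty n \<beta> \<alpha> X)"
  unfolding is_board_iff[OF n] nontrivial_faces_discard_empty
  using assms pre_board_discard_empty by (auto simp: empty_cheburek_def cheburek_discard_empty)

lemma iso_by_discard_empty:
  assumes "iso_by n \<beta> \<alpha> \<phi> \<psi> X Y"
  shows "iso_by n \<beta> \<alpha> \<phi> \<psi> (discard_empty n \<beta> \<alpha> X) (discard_empty n \<beta> \<alpha> Y)"
proof -
  note I = iso_byD[OF assms] and C = iso_by_cheburek(2)[OF X assms]
  have emp: "empty_cheburek n \<beta> \<alpha> X b w \<Longrightarrow> b \<in> black X \<and> w \<in> white X"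
    "empty_cheburek n \<beta> \<alpha> Y c u \<Longrightarrow> c \<in> black Y \<and> u \<in> white Y" for b w c u
    by (simp_all add: empty_cheburek_def cheburek_def)
  have b: "(\<exists>u. empty_cheburek n \<beta> \<alpha> Y (\<phi> b) u) \<longleftrightarrow> (\<exists>w. empty_cheburek n \<beta> \<alpha> X b w)" if "b \<in> black X" for b
    using emp C[OF that] I(11) by blast
  have w: "(\<exists>c. empty_cheburek n \<beta> \<alpha> Y c (\<psi> w)) \<longleftrightarrow> (\<exists>b. empty_cheburek n \<beta> \<alpha> X b w)" if "w \<in> white X" for w
    using emp C[OF _ that] I(10) by blast
  have "\<phi> ` black (discard_empty n \<beta> \<alpha> X) = black (discard_empty n \<beta> \<alpha> Y)"
    "\<psi> ` white (discard_empty n \<beta> \<alpha> X) = white (discard_empty n \<beta> \<alpha> Y)"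
    unfolding discard_empty_simps using I(6,7,10,11) b w by blast+
  then have "bij_betw \<phi> (black (discard_empty n \<beta> \<alpha> X)) (black (discard_empty n \<beta> \<alpha> Y))"
    "bij_betw \<psi> (white (discard_empty n \<beta> \<alpha> X)) (white (discard_empty n \<beta> \<alpha> Y))"
    by (auto intro: bij_betw_subset[OF I(1)] bij_betw_subset[OF I(2)])
  then show ?thesis using assms by (simp add: iso_by_def)
qed

end

section \<open>Cutting and gluing two boards\<close>

lemma bij_betw_map_sum:
  assumes "bij_betw f A A'" "bij_betw g B B'"
  shows "bij_betw (map_sum f g) (Sum_Type.Plus A B) (Sum_Type.Plus A' B')"
proof -
  have "map_sum f g ` Sum_Type.Plus A B = Sum_Type.Plus (f ` A) (g ` B)"
    by (simp add: Sum_Type.Plus_def image_Un image_image)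
  moreover have "inj_on (map_sum f g) (Sum_Type.Plus A B)"
  proof (rule inj_onI)
    fix x y assume *: "x \<in> Sum_Type.Plus A B" "y \<in> Sum_Type.Plus A B" "map_sum f g x = map_sum f g y"
    have inj: "inj_on f A" "inj_on g B" using assms by (auto simp: bij_betw_def)
    show "x = y"
      using * inj_onD[OF inj(1)] inj_onD[OF inj(2)] by (cases x; cases y) auto
  qed
  ultimately show ?thesis using assms by (simp add: bij_betw_def)
qed

lemma cut_and_glue_simps [simp]:
  "black (cut_and_glue \<beta> X Y) = Sum_Type.Plus (black X - blab X ` labels \<beta>) (black Y)"
  "white (cut_and_glue \<beta> X Y) = Sum_Type.Plus (white X) (white Y - wlab Y ` labels \<beta>)"
  "blab (cut_and_glue \<beta> X Y) j = Inr (blab Y j)"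
  "wlab (cut_and_glue \<beta> X Y) j = Inl (wlab X j)"
  "glue (cut_and_glue \<beta> X Y) i (Inl b) = Inl (glue X i b)"
  by (simp_all add: cut_and_glue_def)

context
  fixes n \<alpha> \<beta> \<gamma> and X :: "'f board" and Y :: "'g board"
  assumes X: "pre_board n \<beta> \<alpha> X" and Y: "pre_board n \<gamma> \<beta> Y"
begin

lemma glue_cut_and_glue_Inr:
  shows "j \<in> labels \<beta> \<Longrightarrow> glue Y i c = wlab Y j \<Longrightarrow>
      glue (cut_and_glue \<beta> X Y) i (Inr c) = Inl (glue X i (blab X j))"
    and "glue Y i c \<notin> wlab Y ` labels \<beta> \<Longrightarrow> glue (cut_and_glue \<beta> X Y) i (Inr c) = Inr (glue Y i c)"
  using Y by (auto simp: cut_and_glue_def pre_board_def the_inv_into_f_f)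

lemma glue_cut_and_glue_Inr_iff:
  shows "glue (cut_and_glue \<beta> X Y) i (Inr c) = Inl w \<longleftrightarrow>
      (\<exists>j\<in>labels \<beta>. glue Y i c = wlab Y j \<and> w = glue X i (blab X j))"
    and "glue (cut_and_glue \<beta> X Y) i (Inr c) = Inr u \<longleftrightarrow>
      glue Y i c \<notin> wlab Y ` labels \<beta> \<and> u = glue Y i c"
proof -
  have "(\<exists>j\<in>labels \<beta>. glue Y i c = wlab Y j) \<or> glue Y i c \<notin> wlab Y ` labels \<beta>" by blast
  then have "(glue (cut_and_glue \<beta> X Y) i (Inr c) = Inl w \<longleftrightarrow>
      (\<exists>j\<in>labels \<beta>. glue Y i c = wlab Y j \<and> w = glue X i (blab X j))) \<and>
    (glue (cut_and_glue \<beta> X Y) i (Inr c) = Inr u \<longleftrightarrow>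
      glue Y i c \<notin> wlab Y ` labels \<beta> \<and> u = glue Y i c)"
  proof
    assume "\<exists>j\<in>labels \<beta>. glue Y i c = wlab Y j"
    then obtain j where j: "j \<in> labels \<beta>" "glue Y i c = wlab Y j" by blast
    then show ?thesis
      using glue_cut_and_glue_Inr(1)[OF j] pre_boardD(8)[OF Y] by auto
  next
    assume *: "glue Y i c \<notin> wlab Y ` labels \<beta>"
    then show ?thesis using glue_cut_and_glue_Inr(2)[OF *] by auto
  qed
  then show "glue (cut_and_glue \<beta> X Y) i (Inr c) = Inl w \<longleftrightarrow>
      (\<exists>j\<in>labels \<beta>. glue Y i c = wlab Y j \<and> w = glue X i (blab X j))"
    and "glue (cut_and_glue \<beta> X Y) i (Inr c) = Inr u \<longleftrightarrow>
      glue Y i c \<notin> wlab Y ` labels \<beta> \<and> u = glue Y i c" by blast+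
qed

text \<open>Along each colour, the white face of X that bordered the removed black face j is matched
  with the black face of Y that bordered the removed white face j. All other sides keep their
  partners, so bijectivity is inherited from X and Y.\<close>

lemma pre_board_cut_and_glue: "pre_board n \<gamma> \<alpha> (cut_and_glue \<beta> X Y)"
  unfolding pre_board_def
proof (intro conjI ballI)
  note DX = pre_boardD[OF X] and DY = pre_boardD[OF Y] and G = glue_cut_and_glue_Inr_iff
  let ?C = "cut_and_glue \<beta> X Y"
  fix i assume i: "i \<in> {1..n}"
  show "bij_betw (glue ?C i) (black ?C) (white ?C)"
    unfolding bij_betw_def
  proof
    show "inj_on (glue ?C i) (black ?C)"
    proof (rule inj_onI)
      fix x y assume xy: "x \<in> black ?C" "y \<in> black ?C" "glue ?C i x = glue ?C i y"
      have mixed: False if "b \<in> black X" "b \<notin> blab X ` labels \<beta>" "glue ?C i (Inr c) = Inl (glue X i b)" for b c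
      proof -
        from that(3) obtain j where j: "j \<in> labels \<beta>" "glue X i b = glue X i (blab X j)"
          unfolding G by blast
        then have "b = blab X j" using DX(3)[OF i that(1) DX(5)[OF j(1)]] by simp
        then show False using j(1) that(2) by blast
      qed
      show "x = y"
      proof (cases x)
        case (Inl b)
        show ?thesis
        proof (cases y)
          case (Inl b')
          then show ?thesis using xy \<open>x = Inl b\<close> DX(3)[OF i] by auto
        next
          case (Inr c)
          then show ?thesis using xy \<open>x = Inl b\<close> mixed[of b c] by auto
        qed
      next
        case (Inr c)
        show ?thesis
        proof (cases y)
          case (Inl b)
          then show ?thesis using xy \<open>x = Inr c\<close> mixed[of b c] by auto
        next
          case (Inr c')
          have c: "c \<in> black Y" "c' \<in> black Y" using xy \<open>x = Inr c\<close> Inr by auto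
          have eq: "glue ?C i (Inr c) = glue ?C i (Inr c')" using xy \<open>x = Inr c\<close> Inr by simp
          have "glue Y i c = glue Y i c'"
          proof (cases "glue ?C i (Inr c)")
            case (Inl w)
            then obtain j j' where j: "j \<in> labels \<beta>" "glue Y i c = wlab Y j" "w = glue X i (blab X j)"
              "j' \<in> labels \<beta>" "glue Y i c' = wlab Y j'" "w = glue X i (blab X j')"
              using eq G(1)[of i c w] G(1)[of i c' w] by auto
            then have "blab X j = blab X j'" using DX(3)[OF i DX(5) DX(5), of j j'] by simp
            then show ?thesis using j DX(7)[of j j'] by simp
          next
            case (Inr u)
            then show ?thesis using eq G(2)[of i c u] G(2)[of i c' u] by simp
          qed
          then show ?thesis using DY(3)[OF i c] \<open>x = Inr c\<close> Inr by simp
        qed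
      qed
    qed
    show "glue ?C i ` black ?C = white ?C"
    proof
      show "glue ?C i ` black ?C \<subseteq> white ?C"
      proof
        fix y assume "y \<in> glue ?C i ` black ?C"
        then obtain x where x: "x \<in> black ?C" "y = glue ?C i x" by blast
        show "y \<in> white ?C"
        proof (cases x)
          case (Inl b)
          then show ?thesis using x DX(2)[OF i] by auto
        next
          case (Inr c)
          show ?thesis
          proof (cases y)
            case (Inl w)
            then show ?thesis using x Inr G(1)[of i c w] DX(2)[OF i DX(5)] by auto
          next
            case (Inr u)
            then show ?thesis using x \<open>x = Inr c\<close> G(2)[of i c u] DY(2)[OF i, of c] by auto
          qed
        qed
      qed
      show "white ?C \<subseteq> glue ?C i ` black ?C"
      proof
        fix y assume y: "y \<in> white ?C"
        show "y \<in> glue ?C i ` black ?C"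
        proof (cases y)
          case (Inl w)
          then have "w \<in> white X" using y by auto
          then obtain b where b: "b \<in> black X" "w = glue X i b" using DX(4)[OF i] by blast
          show ?thesis
          proof (cases "b \<in> blab X ` labels \<beta>")
            case True
            then obtain j where j: "j \<in> labels \<beta>" "b = blab X j" by blast
            obtain c where c: "c \<in> black Y" "wlab Y j = glue Y i c" using DY(4)[OF i DY(6)[OF j(1)]] by blast
            have "y = glue ?C i (Inr c)"
              using Inl b j glue_cut_and_glue_Inr(1)[OF j(1) c(2)[symmetric]] by simp
            then show ?thesis using c(1) by auto
          next
            case False
            then have "Inl b \<in> black ?C" using b by auto
            then show ?thesis using Inl b by (intro image_eqI[of _ _ "Inl b"]) auto
          qed
        next
          case (Inr u)
          then have u: "u \<in> white Y" "u \<notin> wlab Y ` labels \<beta>" using y by auto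
          obtain c where c: "c \<in> black Y" "u = glue Y i c" using DY(4)[OF i u(1)] by blast
          have "y = glue ?C i (Inr c)" using Inr c u glue_cut_and_glue_Inr(2)[of i c] by simp
          then show ?thesis using c(1) by auto
        qed
      qed
    qed
  qed
next
  note DX = pre_boardD[OF X] and DY = pre_boardD[OF Y]
  show "inj_on (blab (cut_and_glue \<beta> X Y)) (labels \<gamma>)" "inj_on (wlab (cut_and_glue \<beta> X Y)) (labels \<alpha>)"
    using DX(8) DY(7) by (auto simp: inj_on_def)
  show "blab (cut_and_glue \<beta> X Y) ` labels \<gamma> \<subseteq> black (cut_and_glue \<beta> X Y)"
    "wlab (cut_and_glue \<beta> X Y) ` labels \<alpha> \<subseteq> white (cut_and_glue \<beta> X Y)"
    using DX(6) DY(5) by auto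
qed

lemma cheburek_cut_and_glueI:
  shows "cheburek n X b w \<Longrightarrow> b \<notin> blab X ` labels \<beta> \<Longrightarrow> cheburek n (cut_and_glue \<beta> X Y) (Inl b) (Inl w)"
    and "cheburek n Y c u \<Longrightarrow> u \<notin> wlab Y ` labels \<beta> \<Longrightarrow> cheburek n (cut_and_glue \<beta> X Y) (Inr c) (Inr u)"
    and "cheburek n Y c (wlab Y j) \<Longrightarrow> j \<in> labels \<beta> \<Longrightarrow> cheburek n X (blab X j) w \<Longrightarrow>
      cheburek n (cut_and_glue \<beta> X Y) (Inr c) (Inl w)"
  by (auto simp: cheburek_def glue_cut_and_glue_Inr)

text \<open>A cheburek of Y can be spoilt only if it is cut open at a white label j whose black face
  in X lies outside chebureks. As \<open>blab X\<close> is injective, there are finitely many such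
  j; \<open>?f j\<close> is the black face of Y that met the cut white face along side 1.\<close>

lemma finite_nontrivial_faces_cut_and_glue:
  assumes "n \<ge> 1" "finite (nontrivial_faces n X)" "finite (nontrivial_faces n Y)"
  shows "finite (nontrivial_faces n (cut_and_glue \<beta> X Y))"
proof (rule finite_subset)
  let ?J = "blab X -` nontrivial_faces n X \<inter> labels \<beta>"
  let ?f = "\<lambda>j. the_inv_into (black Y) (glue Y 1) (wlab Y j)"
  let ?S = "Inl ` nontrivial_faces n X \<union> Inr ` (nontrivial_faces n Y \<union> ?f ` ?J)"
  have one: "(1::nat) \<in> {1..n}" using assms(1) by simp
  have "finite ?J" using X assms(2) by (intro finite_vimage_IntI) (auto simp: pre_board_def)
  then show "finite ?S" using assms(2,3) by simp
  show "nontrivial_faces n (cut_and_glue \<beta> X Y) \<subseteq> ?S"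
  proof
    fix x assume "x \<in> nontrivial_faces n (cut_and_glue \<beta> X Y)"
    then have x: "x \<in> black (cut_and_glue \<beta> X Y)" "\<And>y. \<not> cheburek n (cut_and_glue \<beta> X Y) x y"
      unfolding nontrivial_faces_def by blast+
    show "x \<in> ?S"
    proof (cases x)
      case (Inl b)
      then have b: "b \<in> black X" "b \<notin> blab X ` labels \<beta>" using x(1) by auto
      have "b \<in> nontrivial_faces n X"
        unfolding nontrivial_faces_def using b cheburek_cut_and_glueI(1)[OF _ b(2)] x(2) Inl by blast
      then show ?thesis using Inl by blast
    next
      case (Inr c)
      then have c: "c \<in> black Y" using x(1) by auto
      have "c \<in> nontrivial_faces n Y \<union> ?f ` ?J"
      proof (cases "c \<in> nontrivial_faces n Y")
        case False
        then obtain u where u: "cheburek n Y c u" using c unfolding nontrivial_faces_def by blast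
        then have "u \<in> wlab Y ` labels \<beta>" using cheburek_cut_and_glueI(2)[OF u] x(2) Inr by blast
        then obtain j where j: "j \<in> labels \<beta>" "u = wlab Y j" by blast
        have "blab X j \<in> nontrivial_faces n X"
          unfolding nontrivial_faces_def
          using cheburek_cut_and_glueI(3)[OF u[unfolded j(2)] j(1)] x(2) Inr pre_boardD(5)[OF X j(1)] by blast
        then have "j \<in> ?J" using j by simp
        moreover have "c = ?f j"
        proof -
          have "inj_on (glue Y 1) (black Y)" using pre_boardD(1)[OF Y one] by (simp add: bij_betw_def)
          moreover have "wlab Y j = glue Y 1 c" using u j one by (simp add: cheburek_def)
          ultimately show ?thesis using c by (simp add: the_inv_into_f_f)
        qed
        ultimately show ?thesis by blast
      qed simp
      then show ?thesis using Inr by blast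
    qed
  qed
qed

lemma is_board_cut_and_glue:
  assumes "n \<ge> 1" "is_board n \<beta> \<alpha> X" "is_board n \<gamma> \<beta> Y"
  shows "is_board n \<gamma> \<alpha> (discard_empty n \<gamma> \<alpha> (cut_and_glue \<beta> X Y))"
  using assms finite_nontrivial_faces_cut_and_glue pre_board_cut_and_glue
  by (intro is_board_discard_empty) (simp_all add: is_board_iff)

lemma iso_by_cut_and_glue:
  assumes iX: "iso_by n \<beta> \<alpha> \<phi>1 \<psi>1 X X'" and iY: "iso_by n \<gamma> \<beta> \<phi>2 \<psi>2 Y Y'"
  shows "iso_by n \<gamma> \<alpha> (map_sum \<phi>1 \<phi>2) (map_sum \<psi>1 \<psi>2) (cut_and_glue \<beta> X Y) (cut_and_glue \<beta> X' Y')"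
proof -
  note IX = iso_byD[OF iX] and IY = iso_byD[OF iY]
  note DX = pre_boardD[OF X] and DY = pre_boardD[OF Y]
  have Y': "pre_board n \<gamma> \<beta> Y'" by (rule iso_by_pre_board[OF Y iY])

  have imb: "\<phi>1 ` blab X ` labels \<beta> = blab X' ` labels \<beta>" "\<psi>2 ` wlab Y ` labels \<beta> = wlab Y' ` labels \<beta>"
    using IX(4) IY(5) by (simp_all add: image_image)
  have b1: "bij_betw \<phi>1 (black X - blab X ` labels \<beta>) (black X' - blab X' ` labels \<beta>)"
    using IX(1) DX(5) unfolding bij_betw_def imb[symmetric]
    by (auto intro: inj_on_subset simp: inj_on_image_set_diff[of \<phi>1 "black X"] image_subset_iff)
  have b2: "bij_betw \<psi>2 (white Y - wlab Y ` labels \<beta>) (white Y' - wlab Y' ` labels \<beta>)"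
    using IY(2) DY(6) unfolding bij_betw_def imb[symmetric]
    by (auto intro: inj_on_subset simp: inj_on_image_set_diff[of \<psi>2 "white Y"] image_subset_iff)
  show ?thesis unfolding iso_by_def
  proof (intro conjI ballI)
    show "bij_betw (map_sum \<phi>1 \<phi>2) (black (cut_and_glue \<beta> X Y)) (black (cut_and_glue \<beta> X' Y'))"
      using bij_betw_map_sum[OF b1 IY(1)] by simp
    show "bij_betw (map_sum \<psi>1 \<psi>2) (white (cut_and_glue \<beta> X Y)) (white (cut_and_glue \<beta> X' Y'))"
      using bij_betw_map_sum[OF IX(2) b2] by simp
    show "map_sum \<phi>1 \<phi>2 (blab (cut_and_glue \<beta> X Y) j) = blab (cut_and_glue \<beta> X' Y') j" if "j \<in> labels \<gamma>" for j
      using IY(4)[OF that] by simp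
    show "map_sum \<psi>1 \<psi>2 (wlab (cut_and_glue \<beta> X Y) j) = wlab (cut_and_glue \<beta> X' Y') j" if "j \<in> labels \<alpha>" for j
      using IX(5)[OF that] by simp
    fix i x assume i: "i \<in> {1..n}" and x: "x \<in> black (cut_and_glue \<beta> X Y)"
    show "map_sum \<psi>1 \<psi>2 (glue (cut_and_glue \<beta> X Y) i x) = glue (cut_and_glue \<beta> X' Y') i (map_sum \<phi>1 \<phi>2 x)"
    proof (cases x)
      case (Inl b)
      then show ?thesis using x IX(3)[OF i] by auto
    next
      case (Inr c)
      then have c: "c \<in> black Y" using x by auto
      show ?thesis
      proof (cases "glue Y i c \<in> wlab Y ` labels \<beta>")
        case True
        then obtain j where j: "j \<in> labels \<beta>" "glue Y i c = wlab Y j" by blast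
        have "glue Y' i (\<phi>2 c) = wlab Y' j" using IY(3)[OF i c] IY(5)[OF j(1)] j(2) by simp
        then have "glue (cut_and_glue \<beta> X' Y') i (Inr (\<phi>2 c)) = Inl (glue X' i (blab X' j))"
          using j(1) Y' by (auto simp: cut_and_glue_def pre_board_def the_inv_into_f_f)
        then show ?thesis
          using Inr glue_cut_and_glue_Inr(1)[OF j] IX(3)[OF i DX(5)[OF j(1)]] IX(4)[OF j(1)] by simp
      next
        case False
        have "glue Y' i (\<phi>2 c) \<notin> wlab Y' ` labels \<beta>"
        proof
          assume "glue Y' i (\<phi>2 c) \<in> wlab Y' ` labels \<beta>"
          then obtain j where j: "j \<in> labels \<beta>" "glue Y' i (\<phi>2 c) = wlab Y' j" by blast
          then have "\<psi>2 (glue Y i c) = \<psi>2 (wlab Y j)" using IY(3)[OF i c] IY(5)[OF j(1)] by simp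
          then have "glue Y i c = wlab Y j" using IY(9)[OF DY(2)[OF i c] DY(6)[OF j(1)]] by simp
          then show False using False j(1) by blast
        qed
        then have "glue (cut_and_glue \<beta> X' Y') i (Inr (\<phi>2 c)) = Inr (glue Y' i (\<phi>2 c))"
          by (simp add: cut_and_glue_def)
        then show ?thesis using Inr glue_cut_and_glue_Inr(2)[OF False] IY(3)[OF i c] by simp
      qed
    qed
  qed
qed

end

text \<open>Any two choices of representatives give isomorphic results, so all members of the union
  in \<open>board_comp\<close> coincide. The classes are nonempty, so the union is this common
  value.\<close>

lemma board_comp_board_class:
  fixes X :: "'f::countable board" and Y :: "'g::countable board"
  assumes "n \<ge> 1" "is_board n \<beta> \<alpha> X" "is_board n \<gamma> \<beta> Y"
  shows "board_comp n \<gamma> \<beta> \<alpha> (board_class n \<beta> \<alpha> X) (board_class n \<gamma> \<beta> Y)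
    = board_class n \<gamma> \<alpha> (discard_empty n \<gamma> \<alpha> (cut_and_glue \<beta> X Y))" (is "?L = ?R")
proof -
  note PX = is_boardD(1)[OF assms(2)] and PY = is_boardD(1)[OF assms(3)]
  note pre = pre_board_cut_and_glue[OF PX PY]
  have eq: "board_class n \<gamma> \<alpha> (discard_empty n \<gamma> \<alpha> (cut_and_glue \<beta> X' Y')) = ?R"
    if "X' \<in> board_class n \<beta> \<alpha> X" "Y' \<in> board_class n \<gamma> \<beta> Y" for X' Y'
  proof -
    from that(1) obtain \<phi>1 \<psi>1 where 1: "iso_by n \<beta> \<alpha> \<phi>1 \<psi>1 X X'" by (rule board_classE)
    from that(2) obtain \<phi>2 \<psi>2 where 2: "iso_by n \<gamma> \<beta> \<phi>2 \<psi>2 Y Y'" by (rule board_classE)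
    show ?thesis
      by (rule board_class_eq[OF pre_board_discard_empty[OF pre assms(1)]
            iso_by_discard_empty[OF pre assms(1) iso_by_cut_and_glue[OF PX PY 1 2]], symmetric])
  qed
  obtain X' where X': "X' \<in> board_class n \<beta> \<alpha> X" by (rule board_class_nonempty[OF assms(2,1)])
  obtain Y' where Y': "Y' \<in> board_class n \<gamma> \<beta> Y" by (rule board_class_nonempty[OF assms(3,1)])
  have "?L = (\<Union>X'\<in>board_class n \<beta> \<alpha> X. \<Union>Y'\<in>board_class n \<gamma> \<beta> Y. ?R)"
    unfolding board_comp_def using eq by simp
  then show ?thesis using X' Y' by auto
qed

subsection \<open>Disjoint unions and the elements \<open>z\<close>\<close>

text \<open>Labels come from the second board only. One definition thus serves for the product of
  unlabelled boards and for the product of z_c with a labelled board.\<close>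

definition disjoint_board :: "'f board \<Rightarrow> 'g board \<Rightarrow> ('f + 'g) board" where
  "disjoint_board X Y = \<lparr>
     black = Sum_Type.Plus (black X) (black Y),
     white = Sum_Type.Plus (white X) (white Y),
     glue = (\<lambda>i. map_sum (glue X i) (glue Y i)),
     blab = Inr \<circ> blab Y,
     wlab = Inr \<circ> wlab Y\<rparr>"

lemma add_chebureks_simps [simp]:
  "black (add_chebureks X) = Sum_Type.Plus (black X) UNIV"
  "white (add_chebureks X) = Sum_Type.Plus (white X) UNIV"
  "glue (add_chebureks X) i (Inl b) = Inl (glue X i b)"
  "glue (add_chebureks X) i (Inr j) = Inr j"
  "blab (add_chebureks X) j = Inr j" "wlab (add_chebureks X) j = Inr j"
  by (simp_all add: add_chebureks_def)

lemma glue_add_chebureks: "glue (add_chebureks X) i = map_sum (glue X i) id"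
proof
  show "glue (add_chebureks X) i x = map_sum (glue X i) id x" for x by (cases x) simp_all
qed

lemma pre_board_add_chebureks:
  assumes "pre_board n 0 0 X"
  shows "pre_board n \<infinity> \<infinity> (add_chebureks X)"
  unfolding pre_board_def
proof (intro conjI ballI)
  fix i assume "i \<in> {1..n}"
  then have "bij_betw (glue X i) (black X) (white X)" by (rule pre_boardD(1)[OF assms])
  then show "bij_betw (glue (add_chebureks X) i) (black (add_chebureks X)) (white (add_chebureks X))"
    using bij_betw_map_sum[OF _ bij_betw_id, of "glue X i"] by (simp add: glue_add_chebureks)
qed (auto simp: inj_on_def)

lemma is_board_add_chebureks:
  assumes "is_board n 0 0 X" "n \<ge> 1"
  shows "is_board n \<infinity> \<infinity> (add_chebureks X)"
proof -
  have nt: "nontrivial_faces n (add_chebureks X) \<subseteq> Inl ` nontrivial_faces n X"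
  proof
    fix x assume x: "x \<in> nontrivial_faces n (add_chebureks X)"
    have "cheburek n (add_chebureks X) (Inr j) (Inr j)" for j by (auto simp: cheburek_def)
    moreover have "cheburek n X b w \<Longrightarrow> cheburek n (add_chebureks X) (Inl b) (Inl w)" for b w
      by (auto simp: cheburek_def)
    ultimately show "x \<in> Inl ` nontrivial_faces n X"
      using x unfolding nontrivial_faces_def by (cases x) (fastforce, blast)
  qed
  have ne: "\<not> empty_cheburek n \<infinity> \<infinity> (add_chebureks X) x y" for x y
  proof
    assume *: "empty_cheburek n \<infinity> \<infinity> (add_chebureks X) x y"
    then obtain b w where "x = Inl b" "y = Inl w"
      by (cases x; cases y) (auto simp: empty_cheburek_def)
    then have "empty_cheburek n 0 0 X b w" using * by (auto simp: empty_cheburek_def cheburek_def)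
    then show False using is_boardD(2)[OF assms(1)] by blast
  qed
  show ?thesis
    using assms(1) ne pre_board_add_chebureks[of n X] finite_subset[OF nt]
    by (simp add: is_board_iff[OF assms(2)])
qed

lemma iso_by_add_chebureks:
  assumes "iso_by n 0 0 \<phi> \<psi> X Y"
  shows "iso_by n \<infinity> \<infinity> (map_sum \<phi> id) (map_sum \<psi> id) (add_chebureks X) (add_chebureks Y)"
  unfolding iso_by_def
proof (intro conjI ballI)
  show "bij_betw (map_sum \<phi> id) (black (add_chebureks X)) (black (add_chebureks Y))"
    "bij_betw (map_sum \<psi> id) (white (add_chebureks X)) (white (add_chebureks Y))"
    using bij_betw_map_sum[OF iso_byD(1)[OF assms] bij_betw_id] bij_betw_map_sum[OF iso_byD(2)[OF assms] bij_betw_id]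
    by simp_all
  fix i x assume i: "i \<in> {1..n}" and x: "x \<in> black (add_chebureks X)"
  then show "map_sum \<psi> id (glue (add_chebureks X) i x) = glue (add_chebureks Y) i (map_sum \<phi> id x)"
    using iso_byD(3)[OF assms i] by (cases x) auto
qed simp_all

lemma z_elem_board_class:
  fixes X :: "'f::countable board"
  assumes "is_board n 0 0 X" "n \<ge> 1"
  shows "z_elem n (board_class n 0 0 X) = board_class n \<infinity> \<infinity> (add_chebureks X)"
proof -
  have eq: "board_class n \<infinity> \<infinity> (add_chebureks Y) = board_class n \<infinity> \<infinity> (add_chebureks X)"
    if "Y \<in> board_class n 0 0 X" for Y
  proof -
    from that obtain \<phi> \<psi> where "iso_by n 0 0 \<phi> \<psi> X Y" by (rule board_classE)
    from board_class_eq[OF pre_board_add_chebureks[OF is_boardD(1)[OF assms(1)]] iso_by_add_chebureks[OF this]]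
    show ?thesis by simp
  qed
  obtain Y where "Y \<in> board_class n 0 0 X" by (rule board_class_nonempty[OF assms])
  then show ?thesis unfolding z_elem_def using eq by auto
qed

text \<open>Gluing in a cheburek (j/j) merely renames a labelled face. Both orders of multiplication
  therefore give the same disjoint union, and this is the centrality of z_c.\<close>

lemma cut_and_glue_add_chebureks:
  fixes X :: "'f board" and Y :: "'g board"
  assumes X: "pre_board n 0 0 X" and Y: "pre_board n \<infinity> \<infinity> Y"
  shows "\<exists>\<phi> \<psi>. iso_by n \<infinity> \<infinity> \<phi> \<psi> (cut_and_glue \<infinity> (add_chebureks X) Y) (disjoint_board X Y)"
    and "\<exists>\<phi> \<psi>. iso_by n \<infinity> \<infinity> \<phi> \<psi> (cut_and_glue \<infinity> Y (add_chebureks X)) (disjoint_board X Y)"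
proof -
  let ?Z = "add_chebureks X"
  have Z: "pre_board n \<infinity> \<infinity> ?Z" by (rule pre_board_add_chebureks[OF X])
  note DY = pre_boardD[OF Y]
  have wl: "wlab Y ` UNIV \<subseteq> white Y" "blab Y ` UNIV \<subseteq> black Y" "inj (wlab Y)" "inj (blab Y)"
    using Y by (auto simp: pre_board_def)
  show "\<exists>\<phi> \<psi>. iso_by n \<infinity> \<infinity> \<phi> \<psi> (cut_and_glue \<infinity> ?Z Y) (disjoint_board X Y)"
  proof (intro exI)
    \<comment> \<open>All black faces \<open>Inr j\<close> of \<open>?Z\<close> are labelled and
      have been cut out, so the value \<open>undefined\<close> is never reached.\<close>
    let ?\<phi> = "case_sum (case_sum Inl undefined) Inr :: ('f + nat) + 'g \<Rightarrow> 'f + 'g"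
    let ?\<psi> = "case_sum (case_sum Inl (\<lambda>j. Inr (wlab Y j))) Inr :: ('f + nat) + 'g \<Rightarrow> 'f + 'g"
    show "iso_by n \<infinity> \<infinity> ?\<phi> ?\<psi> (cut_and_glue \<infinity> ?Z Y) (disjoint_board X Y)"
      unfolding iso_by_def
    proof (intro conjI ballI)
      show "bij_betw ?\<phi> (black (cut_and_glue \<infinity> ?Z Y)) (black (disjoint_board X Y))"
        by (rule bij_betw_byWitness[where f' = "case_sum (Inl \<circ> Inl) Inr"]) (auto simp: disjoint_board_def)
      show "bij_betw ?\<psi> (white (cut_and_glue \<infinity> ?Z Y)) (white (disjoint_board X Y))"
        using wl
        by (intro bij_betw_byWitness[where f' = "case_sum (Inl \<circ> Inl)
            (\<lambda>w. if w \<in> range (wlab Y) then Inl (Inr (inv_into UNIV (wlab Y) w)) else Inr w)"])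
          (auto simp: disjoint_board_def)
      fix i x assume i: "i \<in> {1..n}" and x: "x \<in> black (cut_and_glue \<infinity> ?Z Y)"
      show "?\<psi> (glue (cut_and_glue \<infinity> ?Z Y) i x) = glue (disjoint_board X Y) i (?\<phi> x)"
      proof (cases x)
        case (Inl b')
        then obtain b where "b' = Inl b" using x by auto
        then show ?thesis using Inl by (simp add: disjoint_board_def)
      next
        case (Inr c)
        show ?thesis
        proof (cases "glue Y i c \<in> range (wlab Y)")
          case True
          then obtain j where "glue Y i c = wlab Y j" by blast
          then show ?thesis using Inr glue_cut_and_glue_Inr(1)[OF Z Y, of j i c] by (simp add: disjoint_board_def)
        next
          case False
          then show ?thesis using Inr glue_cut_and_glue_Inr(2)[OF Z Y, of i c] by (simp add: disjoint_board_def)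
        qed
      qed
    qed (simp_all add: disjoint_board_def)
  qed
  show "\<exists>\<phi> \<psi>. iso_by n \<infinity> \<infinity> \<phi> \<psi> (cut_and_glue \<infinity> Y ?Z) (disjoint_board X Y)"
  proof (intro exI)
    let ?\<phi> = "case_sum Inr (case_sum Inl (\<lambda>j. Inr (blab Y j))) :: 'g + ('f + nat) \<Rightarrow> 'f + 'g"
    let ?\<psi> = "case_sum Inr (case_sum Inl undefined) :: 'g + ('f + nat) \<Rightarrow> 'f + 'g"
    show "iso_by n \<infinity> \<infinity> ?\<phi> ?\<psi> (cut_and_glue \<infinity> Y ?Z) (disjoint_board X Y)"
      unfolding iso_by_def
    proof (intro conjI ballI)
      show "bij_betw ?\<psi> (white (cut_and_glue \<infinity> Y ?Z)) (white (disjoint_board X Y))"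
        by (rule bij_betw_byWitness[where f' = "case_sum (Inr \<circ> Inl) Inl"]) (auto simp: disjoint_board_def)
      show "bij_betw ?\<phi> (black (cut_and_glue \<infinity> Y ?Z)) (black (disjoint_board X Y))"
        using wl
        by (intro bij_betw_byWitness[where f' = "case_sum (Inr \<circ> Inl)
            (\<lambda>w. if w \<in> range (blab Y) then Inr (Inr (inv_into UNIV (blab Y) w)) else Inl w)"])
          (auto simp: disjoint_board_def)
      fix i x assume i: "i \<in> {1..n}" and x: "x \<in> black (cut_and_glue \<infinity> Y ?Z)"
      show "?\<psi> (glue (cut_and_glue \<infinity> Y ?Z) i x) = glue (disjoint_board X Y) i (?\<phi> x)"
      proof (cases x)
        case (Inl c)
        then show ?thesis by (simp add: disjoint_board_def)
      next
        case (Inr y)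
        show ?thesis
        proof (cases y)
          case (Inl b)
          have "glue ?Z i (Inl b) \<notin> wlab ?Z ` labels \<infinity>" by auto
          then show ?thesis using Inr Inl glue_cut_and_glue_Inr(2)[OF Y Z, of i "Inl b"] by (simp add: disjoint_board_def)
        next
          case (Inr j)
          then show ?thesis using \<open>x = Inr y\<close> glue_cut_and_glue_Inr(1)[OF Y Z, of j i "Inr j"] by (simp add: disjoint_board_def)
        qed
      qed
    qed (simp_all add: disjoint_board_def)
  qed
qed

lemma EndB_simps [simp]:
  "carrier (EndB n \<alpha>) = Mor n \<alpha> \<alpha>" "mult (EndB n \<alpha>) = board_comp n \<alpha> \<alpha> \<alpha>"
  by (simp_all add: EndB_def)

lemma MorE:
  assumes "c \<in> Mor n \<beta> \<alpha>"
  obtains X :: "nat board" where "is_board n \<beta> \<alpha> X" "c = board_class n \<beta> \<alpha> X"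
  using assms unfolding Mor_def by blast

lemma z_elem_in_center:
  assumes "c \<in> carrier (Delta n)" "n \<ge> 1"
  shows "z_elem n c \<in> center (EndB n \<infinity>)"
proof -
  obtain X :: "nat board" where X: "is_board n 0 0 X" "c = board_class n 0 0 X"
    using assms(1) by (auto elim: MorE)
  note z = z_elem_board_class[OF X(1) assms(2), folded X(2)]
  note Z = is_board_add_chebureks[OF X(1) assms(2)]
  have "board_comp n \<infinity> \<infinity> \<infinity> (z_elem n c) d = board_comp n \<infinity> \<infinity> \<infinity> d (z_elem n c)"
    if "d \<in> Mor n \<infinity> \<infinity>" for d
  proof -
    from that obtain Y :: "nat board" where Y: "is_board n \<infinity> \<infinity> Y" "d = board_class n \<infinity> \<infinity> Y"
      by (rule MorE)
    note PX = is_boardD(1)[OF X(1)] and PY = is_boardD(1)[OF Y(1)] and PZ = is_boardD(1)[OF Z]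
    obtain \<phi> \<psi> \<phi>' \<psi>' where
      1: "iso_by n \<infinity> \<infinity> \<phi> \<psi> (cut_and_glue \<infinity> (add_chebureks X) Y) (disjoint_board X Y)" and
      2: "iso_by n \<infinity> \<infinity> \<phi>' \<psi>' (cut_and_glue \<infinity> Y (add_chebureks X)) (disjoint_board X Y)"
      using cut_and_glue_add_chebureks[OF PX PY] by blast
    have "board_class n \<infinity> \<infinity> (discard_empty n \<infinity> \<infinity> (cut_and_glue \<infinity> (add_chebureks X) Y))
        = board_class n \<infinity> \<infinity> (discard_empty n \<infinity> \<infinity> (disjoint_board X Y))"
      using pre_board_cut_and_glue[OF PZ PY]
      by (intro board_class_eq[OF pre_board_discard_empty iso_by_discard_empty[OF _ assms(2) 1]] assms(2))
    moreover have "board_class n \<infinity> \<infinity> (discard_empty n \<infinity> \<infinity> (cut_and_glue \<infinity> Y (add_chebureks X)))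
        = board_class n \<infinity> \<infinity> (discard_empty n \<infinity> \<infinity> (disjoint_board X Y))"
      using pre_board_cut_and_glue[OF PY PZ]
      by (intro board_class_eq[OF pre_board_discard_empty iso_by_discard_empty[OF _ assms(2) 2]] assms(2))
    ultimately show ?thesis
      unfolding z Y(2) board_comp_board_class[OF assms(2) Z Y(1)] board_comp_board_class[OF assms(2) Y(1) Z] by simp
  qed
  then show ?thesis
    unfolding center_def using board_class_in_Mor[OF Z assms(2)] z by simp
qed

subsection \<open>The center\<close>

text \<open>The presence of a cheburek (j/-). It is an isomorphism invariant, unaffected by
  discarding because its black face is labelled, and it suffices to compare the two products of a
  central board with each test board.\<close>

definition open_cheburek :: "nat \<Rightarrow> 'f board \<Rightarrow> nat \<Rightarrow> bool" where
  "open_cheburek n A j \<longleftrightarrow> (\<exists>w. cheburek n A (blab A j) w \<and> w \<notin> range (wlab A))"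

lemma open_cheburek_discard_empty:
  assumes "pre_board n \<infinity> \<infinity> A" "n \<ge> 1"
  shows "open_cheburek n (discard_empty n \<infinity> \<infinity> A) j \<longleftrightarrow> open_cheburek n A j"
  unfolding open_cheburek_def discard_empty_simps cheburek_discard_empty[OF assms]
  by (auto simp: empty_cheburek_def)

lemma iso_by_open_cheburek:
  assumes A: "pre_board n \<infinity> \<infinity> A" and iso: "iso_by n \<infinity> \<infinity> \<phi> \<psi> A B" and "open_cheburek n A j"
  shows "open_cheburek n B j"
proof -
  note D = pre_boardD[OF A] and I = iso_byD[OF iso]
  obtain w where w: "cheburek n A (blab A j) w" "w \<notin> range (wlab A)"
    using assms(3) unfolding open_cheburek_def by blast
  have ww: "w \<in> white A" using w(1) by (simp add: cheburek_def)
  have "cheburek n B (blab B j) (\<psi> w)"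
    using iso_by_cheburek(1)[OF A iso D(5) ww, of j] w(1) I(4)[of j] by simp
  moreover have "\<psi> w \<notin> range (wlab B)"
  proof
    assume "\<psi> w \<in> range (wlab B)"
    then obtain k where "\<psi> w = \<psi> (wlab A k)" using I(5) by auto
    then have "w = wlab A k" using I(9)[OF ww D(6)[of k]] by simp
    then show False using w(2) by blast
  qed
  ultimately show ?thesis unfolding open_cheburek_def by blast
qed

lemma board_class_eqD:
  fixes X :: "'f::countable board" and Y :: "'g::countable board"
  assumes "is_board n \<beta> \<alpha> X" "is_board n \<beta> \<alpha> Y" "n \<ge> 1"
    and "board_class n \<beta> \<alpha> X = board_class n \<beta> \<alpha> Y"
  obtains \<phi> \<psi> where "iso_by n \<beta> \<alpha> \<phi> \<psi> X Y"
proof -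
  obtain Z \<phi> \<psi> where Z: "Z \<in> board_class n \<beta> \<alpha> X" "iso_by n \<beta> \<alpha> \<phi> \<psi> X Z"
    by (rule board_class_nonempty[OF assms(1,3)])
  then have "Z \<in> board_class n \<beta> \<alpha> Y" using assms(4) by simp
  then obtain \<phi>' \<psi>' where "iso_by n \<beta> \<alpha> \<phi>' \<psi>' Y Z" by (rule board_classE)
  from iso_by_trans[OF Z(2) iso_by_sym[OF is_boardD(1)[OF assms(2)] this]] show ?thesis by (rule that)
qed

lemma commuting_boards_open_cheburek:
  fixes Y :: "'f::countable board" and D :: "'g::countable board"
  assumes n: "n \<ge> 1" and Y: "is_board n \<infinity> \<infinity> Y" and D: "is_board n \<infinity> \<infinity> D"
    and c: "board_class n \<infinity> \<infinity> Y \<in> center (EndB n \<infinity>)"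
  shows "open_cheburek n (cut_and_glue \<infinity> Y D) j \<longleftrightarrow> open_cheburek n (cut_and_glue \<infinity> D Y) j"
proof -
  let ?A = "cut_and_glue \<infinity> Y D" and ?B = "cut_and_glue \<infinity> D Y"
  note PY = is_boardD(1)[OF Y] and PD = is_boardD(1)[OF D]
  note A = pre_board_cut_and_glue[OF PY PD] and B = pre_board_cut_and_glue[OF PD PY]
  note bA = is_board_cut_and_glue[OF PY PD n Y D] and bB = is_board_cut_and_glue[OF PD PY n D Y]
  have "board_comp n \<infinity> \<infinity> \<infinity> (board_class n \<infinity> \<infinity> Y) (board_class n \<infinity> \<infinity> D)
      = board_comp n \<infinity> \<infinity> \<infinity> (board_class n \<infinity> \<infinity> D) (board_class n \<infinity> \<infinity> Y)"
    using c board_class_in_Mor[OF D n] unfolding center_def by simp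
  then have eq: "board_class n \<infinity> \<infinity> (discard_empty n \<infinity> \<infinity> ?A) = board_class n \<infinity> \<infinity> (discard_empty n \<infinity> \<infinity> ?B)"
    by (simp only: board_comp_board_class[OF n Y D] board_comp_board_class[OF n D Y])
  obtain \<phi> \<psi> where "iso_by n \<infinity> \<infinity> \<phi> \<psi> (discard_empty n \<infinity> \<infinity> ?A) (discard_empty n \<infinity> \<infinity> ?B)"
    by (rule board_class_eqD[OF bA bB n eq])
  moreover obtain \<phi>' \<psi>' where "iso_by n \<infinity> \<infinity> \<phi>' \<psi>' (discard_empty n \<infinity> \<infinity> ?B) (discard_empty n \<infinity> \<infinity> ?A)"
    by (rule board_class_eqD[OF bB bA n eq[symmetric]])
  ultimately show ?thesis
    using iso_by_open_cheburek[OF is_boardD(1)[OF bA]] iso_by_open_cheburek[OF is_boardD(1)[OF bB]]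
      open_cheburek_discard_empty[OF A n] open_cheburek_discard_empty[OF B n] by metis
qed

text \<open>The chebureks \<open>(k/k)\<close> for \<open>k \<noteq> j\<close> and the two half labelled ones \<open>(j/-)\<close>, \<open>(-/j)\<close>.\<close>

definition cutting_board :: "nat \<Rightarrow> nat option board" where
  "cutting_board j = \<lparr>black = UNIV, white = UNIV, glue = (\<lambda>_ b. b),
     blab = Some, wlab = (\<lambda>k. if k = j then None else Some k)\<rparr>"

lemma is_board_cutting_board:
  assumes "n \<ge> 1"
  shows "is_board n \<infinity> \<infinity> (cutting_board j)"
  unfolding is_board_iff[OF assms]
proof (intro conjI)
  show "pre_board n \<infinity> \<infinity> (cutting_board j)"
    by (auto simp: pre_board_def cutting_board_def inj_on_def bij_id[unfolded id_def])
  have "nontrivial_faces n (cutting_board j) = {}"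
    by (auto simp: nontrivial_faces_def cheburek_def cutting_board_def)
  then show "finite (nontrivial_faces n (cutting_board j))" by simp
  show "\<nexists>b w. empty_cheburek n \<infinity> \<infinity> (cutting_board j) b w"
  proof (intro notI, elim exE)
    fix b w assume *: "empty_cheburek n \<infinity> \<infinity> (cutting_board j) b w"
    then have "b \<notin> range Some" "w \<notin> range (\<lambda>k. if k = j then None else Some k)" "b = w"
      using assms by (auto simp: empty_cheburek_def cheburek_def cutting_board_def)
    then show False by (cases b) (auto simp: image_iff)
  qed
qed

text \<open>For n >= 2 and j \<noteq> k this is the board of an invertible element outside the
  diagonal: the colours disagree at j and k. Every face is labelled, so nothing is ever
  discarded.\<close>

definition swap_board :: "nat \<Rightarrow> nat \<Rightarrow> nat board" where
  "swap_board j k = \<lparr>black = UNIV, white = UNIV,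
     glue = (\<lambda>i. if i = 1 then Transposition.transpose j k else id), blab = (\<lambda>m. m), wlab = (\<lambda>m. m)\<rparr>"

lemma is_board_swap_board:
  assumes "n \<ge> 1"
  shows "is_board n \<infinity> \<infinity> (swap_board j k)"
  unfolding is_board_iff[OF assms]
proof (intro conjI)
  show "pre_board n \<infinity> \<infinity> (swap_board j k)"
    by (auto simp: pre_board_def swap_board_def inj_on_def)
  have "m \<in> {j, k}" if "m \<in> nontrivial_faces n (swap_board j k)" for m
  proof (rule ccontr)
    assume "m \<notin> {j, k}"
    then have "cheburek n (swap_board j k) m m" by (simp add: cheburek_def swap_board_def)
    then show False using that by (auto simp: nontrivial_faces_def)
  qed
  then have "nontrivial_faces n (swap_board j k) \<subseteq> {j, k}" by blast
  then show "finite (nontrivial_faces n (swap_board j k))" by (rule finite_subset) simp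
  show "\<nexists>b w. empty_cheburek n \<infinity> \<infinity> (swap_board j k) b w"
    by (simp add: empty_cheburek_def swap_board_def)
qed

context
  fixes n and Y :: "'f::countable board"
  assumes n: "n \<ge> 2" and Y: "is_board n \<infinity> \<infinity> Y"
    and center: "board_class n \<infinity> \<infinity> Y \<in> center (EndB n \<infinity>)"
begin

text \<open>In the product Y D the cheburek (j/-) of the cutting board D survives. In D Y the black
  face j of Y must then lie in a cheburek whose white face has no label. If this white face comes
  from Y, then Y has an open cheburek at j. If it comes from D, it is the unlabelled white face of D
  opposite to the black face j, so all sides of the black face j of Y met the white face j.\<close>

lemma central_board_cheburek_or_open:
  "cheburek n Y (blab Y j) (wlab Y j) \<or> open_cheburek n Y j"
proof -
  let ?D = "cutting_board j"
  have n1: "n \<ge> 1" using n by simp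
  have one: "(1::nat) \<in> {1..n}" using n by simp
  note D = is_board_cutting_board[OF n1, of j]
  note PY = is_boardD(1)[OF Y] and PD = is_boardD(1)[OF D]
  have "open_cheburek n (cut_and_glue \<infinity> Y ?D) j"
  proof -
    have "cheburek n ?D (Some j) (Some j)" "Some j \<notin> range (wlab ?D)"
      by (auto simp: cheburek_def cutting_board_def)
    then have "cheburek n (cut_and_glue \<infinity> Y ?D) (Inr (Some j)) (Inr (Some j))"
      using cheburek_cut_and_glueI(2)[OF PY PD, of "Some j" "Some j"] by simp
    then show ?thesis unfolding open_cheburek_def by (auto simp: cutting_board_def)
  qed
  then have "open_cheburek n (cut_and_glue \<infinity> ?D Y) j"
    using commuting_boards_open_cheburek[OF n1 Y D center] by simp
  then obtain x where x: "cheburek n (cut_and_glue \<infinity> ?D Y) (Inr (blab Y j)) x"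
    "x \<notin> range (\<lambda>k. Inl (wlab ?D k))"
    unfolding open_cheburek_def by auto
  have b: "blab Y j \<in> black Y" using pre_boardD(5)[OF PY] by simp
  have gl: "glue (cut_and_glue \<infinity> ?D Y) i (Inr (blab Y j)) = x" if "i \<in> {1..n}" for i
    using x(1) that by (simp add: cheburek_def)
  show ?thesis
  proof (cases x)
    case (Inl y)
    have "glue Y i (blab Y j) = wlab Y j" if "i \<in> {1..n}" for i
    proof -
      have "\<exists>k. glue Y i (blab Y j) = wlab Y k \<and> y = glue ?D i (blab ?D k)"
        using gl[OF that] glue_cut_and_glue_Inr_iff(1)[OF PD PY, of i "blab Y j" y] Inl by simp
      then obtain k where k: "glue Y i (blab Y j) = wlab Y k" "y = Some k" by (auto simp: cutting_board_def)
      have "k = j"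
      proof (rule ccontr)
        assume "k \<noteq> j"
        then have "x = Inl (wlab ?D k)" using Inl k by (simp add: cutting_board_def)
        then show False using x(2) by blast
      qed
      then show ?thesis using k by simp
    qed
    then show ?thesis using b pre_boardD(6)[OF PY, of j] by (simp add: cheburek_def)
  next
    case (Inr u)
    have u: "glue Y i (blab Y j) \<notin> range (wlab Y) \<and> u = glue Y i (blab Y j)" if "i \<in> {1..n}" for i
      using gl[OF that] glue_cut_and_glue_Inr_iff(2)[OF PD PY, of i "blab Y j" u] Inr by simp
    have "cheburek n Y (blab Y j) u"
      using u b pre_boardD(2)[OF PY one b] one by (auto simp: cheburek_def)
    then show ?thesis using u[OF one] unfolding open_cheburek_def by blast
  qed
qed

text \<open>Let D be \<open>swap_board j k\<close>. An open cheburek of Y at j is not cut in D Y, so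
  Y D must have one as well. There side 1 of the black face j leads to the neighbor of face k of Y
  and side 2 to the neighbor of face j. Agreement of the two puts both k and j on the black face of
  one cheburek, contrary to injectivity of the labels. Two colours are essential, and k may be any
  label other than j.\<close>

lemma central_board_not_open: "\<not> open_cheburek n Y j"
proof
  assume "open_cheburek n Y j"
  then obtain w where w: "cheburek n Y (blab Y j) w" "w \<notin> range (wlab Y)"
    unfolding open_cheburek_def by blast
  define k where "k = Suc j"
  let ?D = "swap_board j k"
  have n1: "n \<ge> 1" using n by simp
  have one: "(1::nat) \<in> {1..n}" "(2::nat) \<in> {1..n}" using n by simp_all
  note D = is_board_swap_board[OF n1, of j k]
  note PY = is_boardD(1)[OF Y] and PD = is_boardD(1)[OF D]
  have "cheburek n (cut_and_glue \<infinity> ?D Y) (Inr (blab Y j)) (Inr w)"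
    using cheburek_cut_and_glueI(2)[OF PD PY w(1)] w(2) by simp
  then have "open_cheburek n (cut_and_glue \<infinity> ?D Y) j" unfolding open_cheburek_def by auto
  then have "open_cheburek n (cut_and_glue \<infinity> Y ?D) j"
    using commuting_boards_open_cheburek[OF n1 Y D center] by simp
  then obtain x where "cheburek n (cut_and_glue \<infinity> Y ?D) (Inr j) x"
    unfolding open_cheburek_def by (auto simp: swap_board_def)
  then have x: "glue (cut_and_glue \<infinity> Y ?D) i (Inr j) = x" if "i \<in> {1..n}" for i
    using that by (simp add: cheburek_def)
  have "x = Inl (glue Y 1 (blab Y k))"
    using x[OF one(1)] glue_cut_and_glue_Inr(1)[OF PY PD, of k 1 j] by (simp add: swap_board_def)
  moreover have "x = Inl (glue Y 2 (blab Y j))"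
    using x[OF one(2)] glue_cut_and_glue_Inr(1)[OF PY PD, of j 2 j] by (simp add: swap_board_def)
  ultimately have "glue Y 1 (blab Y k) = w" using w(1) one by (simp add: cheburek_def)
  then have "blab Y k = blab Y j"
    using cheburek_unique(1)[OF PY n1 w(1) one(1)] pre_boardD(5)[OF PY, of k] by simp
  then have "k = j" using pre_boardD(7)[OF PY, of k j] by simp
  then show False by (simp add: k_def)
qed

lemma central_board_cheburek: "cheburek n Y (blab Y j) (wlab Y j)"
  using central_board_cheburek_or_open central_board_not_open by blast

text \<open>Once each j sits on a cheburek (j/j), labelled faces are glued only to labelled faces.
  The remaining faces form a board of their own, and it has no labels.\<close>

lemma central_board_decomposition:
  defines "X \<equiv> Y\<lparr>black := black Y - range (blab Y), white := white Y - range (wlab Y)\<rparr>"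
  shows "is_board n 0 0 X" and "iso_by n \<infinity> \<infinity> (case_sum id (blab Y)) (case_sum id (wlab Y)) (add_chebureks X) Y"
proof -
  have n1: "n \<ge> 1" using n by simp
  have one: "(1::nat) \<in> {1..n}" using n by simp
  note PY = is_boardD(1)[OF Y]
  have Xs: "black X = black Y - range (blab Y)" "white X = white Y - range (wlab Y)" "glue X = glue Y"
    by (simp_all add: X_def)
  have gl: "glue Y i (blab Y j) = wlab Y j" if "i \<in> {1..n}" for i j
    using central_board_cheburek[of j] that by (simp add: cheburek_def)
  have ranges: "range (blab Y) \<subseteq> black Y" "range (wlab Y) \<subseteq> white Y" "inj (blab Y)" "inj (wlab Y)"
    using PY by (auto simp: pre_board_def)
  have PX: "pre_board n 0 0 X"
    unfolding pre_board_def
  proof (intro conjI ballI)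
    fix i assume i: "i \<in> {1..n}"
    have bij: "bij_betw (glue Y i) (black Y) (white Y)" by (rule pre_boardD(1)[OF PY i])
    have "glue Y i ` range (blab Y) = range (wlab Y)" using gl[OF i] by (simp add: image_image)
    then have "glue Y i ` (black Y - range (blab Y)) = white Y - range (wlab Y)"
      using bij ranges(1) by (simp add: bij_betw_def inj_on_image_set_diff[of _ "black Y"])
    then show "bij_betw (glue X i) (black X) (white X)"
      unfolding Xs by (intro bij_betw_subset[OF bij]) auto
  qed simp_all
  have ch: "cheburek n X b w \<longleftrightarrow> cheburek n Y b w \<and> b \<notin> range (blab Y) \<and> w \<notin> range (wlab Y)" for b w
    by (auto simp: cheburek_def Xs)
  have "nontrivial_faces n X \<subseteq> nontrivial_faces n Y"
  proof
    fix b assume b: "b \<in> nontrivial_faces n X"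
    then have bX: "b \<in> black Y" "b \<notin> range (blab Y)" by (auto simp: nontrivial_faces_def Xs)
    have "\<not> cheburek n Y b w" for w
    proof
      assume w: "cheburek n Y b w"
      have "w \<notin> range (wlab Y)"
      proof
        assume "w \<in> range (wlab Y)"
        then obtain j where "w = wlab Y j" by blast
        then have "b = blab Y j" using cheburek_unique(3)[OF PY n1 central_board_cheburek[of j], of b] w by simp
        then show False using bX(2) by blast
      qed
      then have "cheburek n X b w" using w bX ch by blast
      then show False using b by (auto simp: nontrivial_faces_def)
    qed
    then show "b \<in> nontrivial_faces n Y" using bX(1) by (simp add: nontrivial_faces_def)
  qed
  moreover have "finite (nontrivial_faces n Y)" using Y by (simp add: is_board_iff[OF n1])
  ultimately have fin: "finite (nontrivial_faces n X)" by (rule finite_subset)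
  have ne: "\<not> empty_cheburek n 0 0 X b w" for b w
    using is_boardD(2)[OF Y, of b w] ch[of b w] by (auto simp: empty_cheburek_def)
  show "is_board n 0 0 X" unfolding is_board_iff[OF n1] using PX fin ne by blast
  show "iso_by n \<infinity> \<infinity> (case_sum id (blab Y)) (case_sum id (wlab Y)) (add_chebureks X) Y"
    unfolding iso_by_def
  proof (intro conjI ballI)
    show "bij_betw (case_sum id (blab Y)) (black (add_chebureks X)) (black Y)"
      using ranges by (intro bij_betw_byWitness[where
            f' = "\<lambda>b. if b \<in> range (blab Y) then Inr (inv_into UNIV (blab Y) b) else Inl b"]) (auto simp: Xs dest: injD)
    show "bij_betw (case_sum id (wlab Y)) (white (add_chebureks X)) (white Y)"
      using ranges by (intro bij_betw_byWitness[where
            f' = "\<lambda>b. if b \<in> range (wlab Y) then Inr (inv_into UNIV (wlab Y) b) else Inl b"]) (auto simp: Xs dest: injD)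
    fix i x assume i: "i \<in> {1..n}" and "x \<in> black (add_chebureks X)"
    then show "case_sum id (wlab Y) (glue (add_chebureks X) i x) = glue Y i (case_sum id (blab Y) x)"
      using gl[OF i] by (cases x) (auto simp: Xs)
  qed simp_all
qed

end

lemma center_EndB:
  assumes "n \<ge> 2" "c \<in> center (EndB n \<infinity>)"
  obtains d where "d \<in> carrier (Delta n)" "c = z_elem n d"
proof -
  have n1: "n \<ge> 1" using assms(1) by simp
  have "c \<in> Mor n \<infinity> \<infinity>" using assms(2) by (simp add: center_def)
  then obtain Y :: "nat board" where Y: "is_board n \<infinity> \<infinity> Y" "c = board_class n \<infinity> \<infinity> Y" by (rule MorE)
  define X where "X = Y\<lparr>black := black Y - range (blab Y), white := white Y - range (wlab Y)\<rparr>"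
  note X = central_board_decomposition[OF assms(1) Y(1) assms(2)[unfolded Y(2)], folded X_def]
  have "c = board_class n \<infinity> \<infinity> (add_chebureks X)"
    using board_class_eq[OF pre_board_add_chebureks[OF is_boardD(1)[OF X(1)]] X(2)] Y(2) by simp
  also have "\<dots> = z_elem n (board_class n 0 0 X)" by (rule z_elem_board_class[OF X(1) n1, symmetric])
  finally show ?thesis using that board_class_in_Mor[OF X(1) n1] by simp
qed

section \<open>Permutation tuples and the boards they realize\<close>

lemma carrier_Sinf: "s \<in> carrier Sinf \<longleftrightarrow> bij s"
  by (simp add: BijGroup_def Bij_def)

lemma inv_Sinf:
  assumes "bij s"
  shows "inv\<^bsub>Sinf\<^esub> s = inv_into UNIV s"
  using assms inv_BijGroup[of s UNIV] by (simp add: Bij_def restrict_def)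

lemma Sinf_stab_iff: "s \<in> Sinf_stab \<beta> \<longleftrightarrow> bij s \<and> (\<forall>j\<in>labels \<beta>. s j = j)"
  by (simp add: Sinf_stab_def carrier_Sinf)

text \<open>The set of points moved by g_i g_j^(-1) is the image under g_j of the set where g_i and
  g_j differ. The second set is easier to handle, since no inverse occurs in it.\<close>

lemma carrier_GG_iff:
  "g \<in> carrier (GG n) \<longleftrightarrow> g \<in> extensional {1..n} \<and> (\<forall>i\<in>{1..n}. bij (g i)) \<and>
     (\<forall>i\<in>{1..n}. \<forall>j\<in>{1..n}. finite {m. g i m \<noteq> g j m})" (is "_ \<longleftrightarrow> ?R")
proof -
  interpret S: group Sinf by (rule group_BijGroup)
  have fin: "g i \<otimes>\<^bsub>Sinf\<^esub> inv\<^bsub>Sinf\<^esub> g j \<in> Sinf_fin \<longleftrightarrow> finite {m. g i m \<noteq> g j m}"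
    if "bij (g i)" "bij (g j)" for i j
  proof -
    have c: "g i \<in> carrier Sinf" "g j \<in> carrier Sinf" using that by (simp_all add: carrier_Sinf)
    have "g i \<otimes>\<^bsub>Sinf\<^esub> inv\<^bsub>Sinf\<^esub> g j = g i \<circ> inv_into UNIV (g j)"
      using mult_Sinf[OF c(1) S.inv_closed[OF c(2)]] inv_Sinf[OF that(2)] by simp
    moreover have "g i \<otimes>\<^bsub>Sinf\<^esub> inv\<^bsub>Sinf\<^esub> g j \<in> carrier Sinf" using c by simp
    moreover have "{m. (g i \<circ> inv_into UNIV (g j)) m \<noteq> m} = g j ` {m. g i m \<noteq> g j m}"
    proof (intro equalityI subsetI)
      fix m assume "m \<in> {m. (g i \<circ> inv_into UNIV (g j)) m \<noteq> m}"
      moreover have "g j (inv_into UNIV (g j) m) = m" using that(2) by (simp add: bij_is_surj surj_f_inv_f)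
      ultimately show "m \<in> g j ` {m. g i m \<noteq> g j m}"
        by (intro image_eqI[of _ _ "inv_into UNIV (g j) m"]) auto
    next
      fix m assume "m \<in> g j ` {m. g i m \<noteq> g j m}"
      then show "m \<in> {m. (g i \<circ> inv_into UNIV (g j)) m \<noteq> m}"
        using that(2) by (auto simp: bij_is_inj inv_f_f)
    qed
    ultimately show ?thesis
      using that(2) by (simp add: Sinf_fin_def finite_image_iff bij_is_inj inj_on_subset[OF bij_is_inj])
  qed
  have "g \<in> carrier (GG n) \<longleftrightarrow> g \<in> (\<Pi>\<^sub>E i\<in>{1..n}. carrier Sinf) \<and>
      (\<forall>i\<in>{1..n}. \<forall>j\<in>{1..n}. g i \<otimes>\<^bsub>Sinf\<^esub> inv\<^bsub>Sinf\<^esub> g j \<in> Sinf_fin)"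
    by (simp add: GG_def)
  also have "\<dots> \<longleftrightarrow> ?R"
    using fin by (auto simp: PiE_iff carrier_Sinf)
  finally show ?thesis .
qed

lemma GG_D:
  assumes "g \<in> carrier (GG n)"
  shows "i \<in> {1..n} \<Longrightarrow> bij (g i)" "g \<in> extensional {1..n}"
    and "i \<in> {1..n} \<Longrightarrow> j \<in> {1..n} \<Longrightarrow> finite {m. g i m \<noteq> g j m}"
    and "i \<in> {1..n} \<Longrightarrow> g i m = g i m' \<longleftrightarrow> m = m'"
    and "i \<in> {1..n} \<Longrightarrow> \<exists>m. g i m = m'"
proof -
  show *: "i \<in> {1..n} \<Longrightarrow> bij (g i)" "g \<in> extensional {1..n}"
    "i \<in> {1..n} \<Longrightarrow> j \<in> {1..n} \<Longrightarrow> finite {m. g i m \<noteq> g j m}"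
    using assms by (auto simp: carrier_GG_iff)
  show "i \<in> {1..n} \<Longrightarrow> g i m = g i m' \<longleftrightarrow> m = m'" "i \<in> {1..n} \<Longrightarrow> \<exists>m. g i m = m'"
    using *(1) by (metis bij_pointE)+
qed

lemma mult_GG:
  assumes "g \<in> carrier (GG n)" "h \<in> carrier (GG n)"
  shows "g \<otimes>\<^bsub>GG n\<^esub> h = (\<lambda>i\<in>{1..n}. g i \<circ> h i)"
proof -
  have "g \<otimes>\<^bsub>GG n\<^esub> h = (\<lambda>i\<in>{1..n}. g i \<otimes>\<^bsub>Sinf\<^esub> h i)" by (simp add: GG_def)
  also have "\<dots> = (\<lambda>i\<in>{1..n}. g i \<circ> h i)"
    using GG_D(1)[OF assms(1)] GG_D(1)[OF assms(2)]
    by (intro restrict_ext) (simp add: mult_Sinf carrier_Sinf)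
  finally show ?thesis .
qed

lemma KK_subset: "KK n \<beta> \<subseteq> carrier (GG n)"
  by (auto simp: KK_def carrier_GG_iff Sinf_stab_iff)

section \<open>Boards of permutation tuples and double cosets\<close>

definition perm_board :: "(nat \<Rightarrow> nat \<Rightarrow> nat) \<Rightarrow> nat board" where
  "perm_board g = \<lparr>black = UNIV, white = UNIV, glue = g, blab = (\<lambda>j. j), wlab = (\<lambda>j. j)\<rparr>"

lemma board_of_perm_board: "board_of n \<beta> \<alpha> g = board_class n \<beta> \<alpha> (discard_empty n \<beta> \<alpha> (perm_board g))"
  by (simp add: board_of_def perm_board_def)

lemma perm_board_simps [simp]:
  "black (perm_board g) = UNIV" "white (perm_board g) = UNIV" "glue (perm_board g) = g"
  "blab (perm_board g) j = j" "wlab (perm_board g) j = j"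
  by (simp_all add: perm_board_def)

lemma pre_board_perm_board: "g \<in> carrier (GG n) \<Longrightarrow> pre_board n \<beta> \<alpha> (perm_board g)"
  using GG_D(1) by (auto simp: pre_board_def inj_on_def)

lemma finite_nontrivial_faces_perm_board:
  assumes "g \<in> carrier (GG n)" "n \<ge> 1"
  shows "finite (nontrivial_faces n (perm_board g))"
proof (rule finite_subset)
  show "nontrivial_faces n (perm_board g) \<subseteq> (\<Union>i\<in>{1..n}. {m. g i m \<noteq> g 1 m})"
    by (auto simp: nontrivial_faces_def cheburek_def)
  show "finite (\<Union>i\<in>{1..n}. {m. g i m \<noteq> g 1 m})"
    using GG_D(3)[OF assms(1)] assms(2) by simp
qed

lemma is_board_discard_perm_board:
  assumes "g \<in> carrier (GG n)" "n \<ge> 1"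
  shows "is_board n \<beta> \<alpha> (discard_empty n \<beta> \<alpha> (perm_board g))"
  by (intro is_board_discard_empty pre_board_perm_board finite_nontrivial_faces_perm_board assms)

text \<open>A black face is kept only if it lies outside chebureks, has a number below k, or is
  paired with a white number below k. Finiteness leaves infinitely many discarded numbers for the
  extension in \<open>double_coset\<close>.\<close>

lemma finite_black_discard_perm_board:
  assumes "g \<in> carrier (GG n)" "n \<ge> 1"
  shows "finite (black (discard_empty n (enat k) (enat k) (perm_board g)))"
proof (rule finite_subset)
  have one: "(1::nat) \<in> {1..n}" using assms(2) by simp
  show "black (discard_empty n (enat k) (enat k) (perm_board g))
      \<subseteq> nontrivial_faces n (perm_board g) \<union> {..<k} \<union> g 1 -` {..<k}"
  proof
    fix b assume b: "b \<in> black (discard_empty n (enat k) (enat k) (perm_board g))"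
    show "b \<in> nontrivial_faces n (perm_board g) \<union> {..<k} \<union> g 1 -` {..<k}"
    proof (cases "b \<in> nontrivial_faces n (perm_board g)")
      case False
      then obtain w where w: "cheburek n (perm_board g) b w" by (auto simp: nontrivial_faces_def)
      then have "w = g 1 b" using one by (auto simp: cheburek_def)
      moreover have "\<not> empty_cheburek n (enat k) (enat k) (perm_board g) b w" using b by simp
      ultimately show ?thesis using w by (auto simp: empty_cheburek_def labels_enat)
    qed simp
  qed
  have "finite (g 1 -` {..<k})"
    by (rule finite_vimageI) (use GG_D(1)[OF assms(1) one] in \<open>auto simp: bij_is_inj\<close>)
  then show "finite (nontrivial_faces n (perm_board g) \<union> {..<k} \<union> g 1 -` {..<k})"
    using finite_nontrivial_faces_perm_board[OF assms] by simp
qed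

text \<open>Almost all faces are discarded, so an isomorphism between the remaining boards extends to a pair
  of permutations.\<close>

lemma double_coset:
  assumes n: "n \<ge> 1" and g: "g \<in> carrier (GG n)" and g': "g' \<in> carrier (GG n)"
    and eq: "board_of n (enat k) (enat k) g = board_of n (enat k) (enat k) g'"
  obtains s t where "s \<in> Sinf_stab (enat k)" "t \<in> Sinf_stab (enat k)"
    "\<And>i m. i \<in> {1..n} \<Longrightarrow> g' i (s m) = t (g i m)"
proof -
  let ?D = "discard_empty n (enat k) (enat k) (perm_board g)"
  let ?D' = "discard_empty n (enat k) (enat k) (perm_board g')"
  have one: "(1::nat) \<in> {1..n}" using n by simp
  obtain \<phi> \<psi> where iso: "iso_by n (enat k) (enat k) \<phi> \<psi> ?D ?D'"
    by (rule board_class_eqD[OF is_board_discard_perm_board[OF g n] is_board_discard_perm_board[OF g' n] n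
          eq[unfolded board_of_perm_board]])
  note I = iso_byD[OF iso]
  note P = is_boardD(1)[OF is_board_discard_perm_board[OF g n]] and P' = is_boardD(1)[OF is_board_discard_perm_board[OF g' n]]
  note D = pre_boardD[OF P] and D' = pre_boardD[OF P']
  define B where "B = black ?D"
  define B' where "B' = black ?D'"
  have finB: "finite B" "finite B'"
    unfolding B_def B'_def using finite_black_discard_perm_board g g' n by blast+
  have outside: "h i b = h 1 b" if "b \<notin> black (discard_empty n (enat k) (enat k) (perm_board h))" "i \<in> {1..n}" for h i b
  proof -
    from that(1) obtain w where "cheburek n (perm_board h) b w" by (auto simp: empty_cheburek_def)
    then show ?thesis using that(2) one by (simp add: cheburek_def)
  qed
  have inB: "b \<in> B" if "g 1 b \<in> white ?D" for b
  proof -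
    from D(4)[OF one that] obtain b' where "b' \<in> B" "g 1 b = g 1 b'" unfolding B_def by auto
    then show ?thesis using GG_D(4)[OF g one] by simp
  qed
  have inf: "infinite (- B)" "infinite (- B')"
    using finB infinite_UNIV_nat by (simp_all add: finite_compl)
  \<comment> \<open>Any bijection between the two infinite complements would do; enumerating them in
    increasing order supplies one.\<close>
  define \<sigma> where "\<sigma> = enumerate (- B') \<circ> inv_into UNIV (enumerate (- B))"
  have \<sigma>: "bij_betw \<sigma> (- B) (- B')"
    unfolding \<sigma>_def using bij_betw_trans[OF bij_betw_inv_into[OF bij_enumerate[OF inf(1)]] bij_enumerate[OF inf(2)]] .
  define s where "s = (\<lambda>b. if b \<in> B then \<phi> b else \<sigma> b)"
  have "bij_betw s (B \<union> - B) (B' \<union> - B')"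
    unfolding s_def using I(1) \<sigma> unfolding B_def B'_def by (intro bij_betw_disjoint_Un) auto
  then have s: "bij s" by simp
  \<comment> \<open>Colour 1 dictates t. On the kept faces t agrees with \<open>\<psi>\<close>,
    which is compatible with all colours, and a discarded black face lies in a cheburek, where all
    colours have the same value.\<close>
  define t where "t = g' 1 \<circ> s \<circ> inv_into UNIV (g 1)"
  have t: "bij t" unfolding t_def
    using GG_D(1)[OF g one] GG_D(1)[OF g' one] s by (intro bij_comp bij_imp_bij_inv)
  have inv: "g 1 (inv_into UNIV (g 1) w) = w" for w
    using GG_D(1)[OF g one] by (simp add: bij_is_surj surj_f_inv_f)
  have tW: "t w = \<psi> w" if "w \<in> white ?D" for w
  proof -
    define b where "b = inv_into UNIV (g 1) w"
    have b: "g 1 b = w" unfolding b_def by (rule inv)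
    then have "b \<in> B" using inB that by simp
    then have "s b = \<phi> b" "g' 1 (\<phi> b) = \<psi> w" using I(3)[OF one, of b] b by (simp_all add: s_def B_def)
    then show ?thesis by (simp add: t_def b_def)
  qed
  have lab: "labels (enat k) \<subseteq> B" "labels (enat k) \<subseteq> white ?D"
    using D(5,6) by (auto simp: B_def)
  have "s \<in> Sinf_stab (enat k)"
    using s lab(1) I(4) by (auto simp: Sinf_stab_iff s_def)
  moreover have "t \<in> Sinf_stab (enat k)"
    using t lab(2) I(5) by (auto simp: Sinf_stab_iff tW)
  moreover have "g' i (s m) = t (g i m)" if i: "i \<in> {1..n}" for i m
  proof (cases "m \<in> B")
    case True
    then show ?thesis using D(2)[OF i, of m] I(3)[OF i, of m] tW[of "g i m"] by (simp add: s_def B_def)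
  next
    case False
    have "s m \<notin> B'" using False \<sigma> by (auto simp: s_def bij_betw_def)
    then have "g' i (s m) = g' 1 (s m)" using outside i unfolding B'_def by blast
    moreover have "g i m = g 1 m" using outside False i unfolding B_def by blast
    moreover have "inv_into UNIV (g 1) (g 1 m) = m"
      using GG_D(1)[OF g one] by (simp add: bij_is_inj inv_f_f)
    ultimately show ?thesis by (simp add: t_def)
  qed
  ultimately show ?thesis by (rule that)
qed

subsection \<open>Realizing unlabelled boards\<close>

text \<open>Black and white faces are numbered by the same set F. Hence every component of g maps F
  to itself, and realizations on disjoint sets do not interfere when multiplied.\<close>

definition realizes_on :: "nat \<Rightarrow> 'f board \<Rightarrow> nat set \<Rightarrow> (nat \<Rightarrow> nat \<Rightarrow> nat) \<Rightarrow> bool" where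
  "realizes_on n X F g \<longleftrightarrow> g \<in> carrier (GG n) \<and> finite F \<and>
     (\<exists>e e'. bij_betw e (black X) F \<and> bij_betw e' (white X) F \<and>
        (\<forall>i\<in>{1..n}. \<forall>b\<in>black X. g i (e b) = e' (glue X i b))) \<and>
     (\<forall>i\<in>{1..n}. \<forall>m. m \<notin> F \<longrightarrow> g i m = m)"

definition realizations :: "nat \<Rightarrow> 'f board \<Rightarrow> nat \<Rightarrow> (nat \<Rightarrow> nat \<Rightarrow> nat) set" where
  "realizations n X k = {g. \<exists>F. realizes_on n X F g \<and> F \<inter> {..<k} = {}}"

lemma realizes_onE:
  assumes "realizes_on n X F g"
  obtains e e' where "g \<in> carrier (GG n)" "finite F" "bij_betw e (black X) F" "bij_betw e' (white X) F"
    "\<And>i b. i \<in> {1..n} \<Longrightarrow> b \<in> black X \<Longrightarrow> g i (e b) = e' (glue X i b)"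
    "\<And>i m. i \<in> {1..n} \<Longrightarrow> m \<notin> F \<Longrightarrow> g i m = m"
  using assms unfolding realizes_on_def by blast

lemma realizes_on_stable:
  assumes "realizes_on n X F g" "i \<in> {1..n}" "m \<in> F"
  shows "g i m \<in> F"
proof (rule ccontr)
  assume *: "g i m \<notin> F"
  then have "g i (g i m) = g i m" using assms(1,2) unfolding realizes_on_def by blast
  moreover have "g \<in> carrier (GG n)" using assms(1) unfolding realizes_on_def by blast
  ultimately have "g i m = m" using GG_D(4)[of g n i "g i m" m] assms(2) by simp
  then show False using * assms(3) by simp
qed

lemma realizations_carrier: "g \<in> realizations n X k \<Longrightarrow> g \<in> carrier (GG n)"
  unfolding realizations_def realizes_on_def by blast

lemma realizations_antimono: "k \<le> l \<Longrightarrow> realizations n X l \<subseteq> realizations n X k"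
  unfolding realizations_def by fastforce

lemma unlabelled_board_no_cheburek:
  assumes "is_board n 0 0 X"
  shows "\<not> cheburek n X b w"
  using is_boardD(2)[OF assms, of b w] by (simp add: empty_cheburek_def)

text \<open>In the absence of labels every cheburek is empty and thus excluded, so all black faces
  belong to the finite set \<open>nontrivial_faces\<close>.\<close>

lemma unlabelled_board_finite:
  assumes "is_board n 0 0 X" "n \<ge> 1"
  shows "finite (black X)" "finite (white X)" "card (white X) = card (black X)"
proof -
  have one: "(1::nat) \<in> {1..n}" using assms(2) by simp
  have "nontrivial_faces n X = black X"
    using unlabelled_board_no_cheburek[OF assms(1)] by (simp add: nontrivial_faces_def)
  then show fin: "finite (black X)" using assms by (simp add: is_board_iff)
  have bij: "bij_betw (glue X 1) (black X) (white X)" by (rule pre_boardD(1)[OF is_boardD(1)[OF assms(1)] one])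
  show "finite (white X)" "card (white X) = card (black X)"
    using bij_betw_finite[OF bij] bij_betw_same_card[OF bij] fin by simp_all
qed

lemma realizations_nonempty:
  assumes X: "is_board n 0 0 X" and n: "n \<ge> 1"
  shows "realizations n X k \<noteq> {}"
proof -
  note fin = unlabelled_board_finite[OF X n] and P = is_boardD(1)[OF X]
  define F where "F = {k..<k + card (black X)}"
  have F: "finite F" "card F = card (black X)" by (simp_all add: F_def)
  obtain e where e: "bij_betw e (black X) F"
    using finite_same_card_bij[OF fin(1) F(1)] F(2) by auto
  obtain e' where e': "bij_betw e' (white X) F"
    using finite_same_card_bij[OF fin(2) F(1)] F(2) fin(3) by auto
  define f where "f = (\<lambda>i. e' \<circ> (glue X i \<circ> inv_into (black X) e))"
  define g where "g = (\<lambda>i\<in>{1..n}. \<lambda>m. if m \<in> F then f i m else m)"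
  have bij: "bij (g i)" if "i \<in> {1..n}" for i
  proof -
    have "bij_betw (f i) F F"
      unfolding f_def using bij_betw_trans[OF bij_betw_trans[OF bij_betw_inv_into[OF e] pre_boardD(1)[OF P that]] e'] .
    then have "bij_betw (\<lambda>m. if m \<in> F then f i m else m) (F \<union> - F) (F \<union> - F)"
      by (rule bij_betw_disjoint_Un) (auto simp: bij_betw_def)
    then show ?thesis using that by (simp add: g_def)
  qed
  have "finite {m. g i m \<noteq> g j m}" if "i \<in> {1..n}" "j \<in> {1..n}" for i j
    by (rule finite_subset[OF _ F(1)]) (use that in \<open>auto simp: g_def\<close>)
  then have "g \<in> carrier (GG n)" using bij by (simp add: carrier_GG_iff g_def)
  moreover have "g i (e b) = e' (glue X i b)" if "i \<in> {1..n}" "b \<in> black X" for i b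
  proof -
    have "e b \<in> F" "inv_into (black X) e (e b) = b"
      using e that(2) by (auto simp: bij_betw_def)
    then show ?thesis using that(1) by (simp add: g_def f_def)
  qed
  moreover have "g i m = m" if "i \<in> {1..n}" "m \<notin> F" for i m
    using that by (simp add: g_def)
  ultimately have "realizes_on n X F g"
    unfolding realizes_on_def using F(1) e e' by blast
  moreover have "F \<inter> {..<k} = {}" by (auto simp: F_def)
  ultimately show ?thesis unfolding realizations_def by blast
qed

lemma bij_betw_case_sum:
  assumes "bij_betw u A F" "bij_betw v B G" "F \<inter> G = {}"
  shows "bij_betw (case_sum u v) (Sum_Type.Plus A B) (F \<union> G)"
  unfolding Sum_Type.Plus_def
proof (rule bij_betw_combine)
  show "bij_betw (case_sum u v) (Inl ` A) F" "bij_betw (case_sum u v) (Inr ` B) G"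
    using assms(1,2) by (auto simp: bij_betw_def inj_on_def image_image)
qed (rule assms(3))

lemma realizes_on_disjoint_board:
  assumes "realizes_on n X F g" "realizes_on n Y F' h" "F \<inter> F' = {}"
  shows "realizes_on n (disjoint_board X Y) (F \<union> F') (g \<otimes>\<^bsub>GG n\<^esub> h)"
proof -
  interpret G: group "GG n" by (rule group_GG)
  from assms(1) obtain e e' where g: "g \<in> carrier (GG n)" "finite F" "bij_betw e (black X) F" "bij_betw e' (white X) F"
    "\<And>i b. i \<in> {1..n} \<Longrightarrow> b \<in> black X \<Longrightarrow> g i (e b) = e' (glue X i b)"
    "\<And>i m. i \<in> {1..n} \<Longrightarrow> m \<notin> F \<Longrightarrow> g i m = m" by (rule realizes_onE) blast
  from assms(2) obtain d d' where h: "h \<in> carrier (GG n)" "finite F'" "bij_betw d (black Y) F'" "bij_betw d' (white Y) F'"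
    "\<And>i b. i \<in> {1..n} \<Longrightarrow> b \<in> black Y \<Longrightarrow> h i (d b) = d' (glue Y i b)"
    "\<And>i m. i \<in> {1..n} \<Longrightarrow> m \<notin> F' \<Longrightarrow> h i m = m" by (rule realizes_onE) blast

  have gh: "(g \<otimes>\<^bsub>GG n\<^esub> h) i m = g i (h i m)" if "i \<in> {1..n}" for i m
    using that by (simp add: mult_GG[OF g(1) h(1)])
  show ?thesis unfolding realizes_on_def
  proof (intro conjI exI ballI allI impI)
    show "g \<otimes>\<^bsub>GG n\<^esub> h \<in> carrier (GG n)" using g(1) h(1) by simp
    show "finite (F \<union> F')" using g(2) h(2) by simp
    show "bij_betw (case_sum e d) (black (disjoint_board X Y)) (F \<union> F')"
      using bij_betw_case_sum[OF g(3) h(3) assms(3)] by (simp add: disjoint_board_def)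
    show "bij_betw (case_sum e' d') (white (disjoint_board X Y)) (F \<union> F')"
      using bij_betw_case_sum[OF g(4) h(4) assms(3)] by (simp add: disjoint_board_def)
    show "(g \<otimes>\<^bsub>GG n\<^esub> h) i m = m" if "i \<in> {1..n}" "m \<notin> F \<union> F'" for i m
      using that g(6) h(6) by (simp add: gh)
    fix i x assume i: "i \<in> {1..n}" and x: "x \<in> black (disjoint_board X Y)"
    show "(g \<otimes>\<^bsub>GG n\<^esub> h) i (case_sum e d x) = case_sum e' d' (glue (disjoint_board X Y) i x)"
    proof (cases x)
      case (Inl b)
      then have b: "b \<in> black X" using x by (auto simp: disjoint_board_def)
      then have "e b \<in> F" using g(3) by (auto simp: bij_betw_def)
      then have "e b \<notin> F'" using assms(3) by blast
      then show ?thesis using Inl g(5)[OF i b] h(6)[OF i] by (simp add: gh[OF i] disjoint_board_def)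
    next
      case (Inr c)
      then have c: "c \<in> black Y" using x by (auto simp: disjoint_board_def)
      have "d c \<in> F'" using h(3) c by (auto simp: bij_betw_def)
      then have "h i (d c) \<in> F'" by (rule realizes_on_stable[OF assms(2) i])
      then have "h i (d c) \<notin> F" using assms(3) by blast
      then show ?thesis using Inr h(5)[OF i c] g(6)[OF i, of "h i (d c)"] by (simp add: gh[OF i] disjoint_board_def)
    qed
  qed
qed

text \<open>Beyond a suitable l all components of h agree with h_1. Conjugation by h then relocates
  a realization from F to the image of F under h_1 without changing its board; l is also taken so
  large that h_1 sends no point of F below k.\<close>

lemma conj_realizations:
  assumes n: "n \<ge> 1" and h: "h \<in> carrier (GG n)"
  obtains l where "\<And>g. g \<in> realizations n X l \<Longrightarrow>
    h \<otimes>\<^bsub>GG n\<^esub> g \<otimes>\<^bsub>GG n\<^esub> inv\<^bsub>GG n\<^esub> h \<in> realizations n X k"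
proof -
  interpret G: group "GG n" by (rule group_GG)
  have one: "(1::nat) \<in> {1..n}" using n by simp
  let ?S = "(\<Union>i\<in>{1..n}. {m. h i m \<noteq> h 1 m}) \<union> h 1 -` {..<k}"
  have "finite (h 1 -` {..<k})"
    by (rule finite_vimageI) (use GG_D(1)[OF h one] in \<open>auto simp: bij_is_inj\<close>)
  then have "finite ?S" using GG_D(3)[OF h] one by simp
  then obtain l where l: "?S \<subseteq> {..<l}" using finite_nat_iff_bounded by blast
  have "h \<otimes>\<^bsub>GG n\<^esub> g \<otimes>\<^bsub>GG n\<^esub> inv\<^bsub>GG n\<^esub> h \<in> realizations n X k" if "g \<in> realizations n X l" for g
  proof -
    from that obtain F where F: "realizes_on n X F g" "F \<inter> {..<l} = {}" unfolding realizations_def by blast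
    from F(1) obtain e e' where g: "g \<in> carrier (GG n)" "finite F" "bij_betw e (black X) F" "bij_betw e' (white X) F"
      "\<And>i b. i \<in> {1..n} \<Longrightarrow> b \<in> black X \<Longrightarrow> g i (e b) = e' (glue X i b)"
      "\<And>i m. i \<in> {1..n} \<Longrightarrow> m \<notin> F \<Longrightarrow> g i m = m" by (rule realizes_onE) blast
    define g' where "g' = h \<otimes>\<^bsub>GG n\<^esub> g \<otimes>\<^bsub>GG n\<^esub> inv\<^bsub>GG n\<^esub> h"
    have g'c: "g' \<in> carrier (GG n)" using g(1) h by (simp add: g'_def)
    \<comment> \<open>Without the inverse the conjugation can be used pointwise: g'_i sends h_i(m)
      to h_i(g_i(m)).\<close>
    have "g' \<otimes>\<^bsub>GG n\<^esub> h = h \<otimes>\<^bsub>GG n\<^esub> g" using g(1) h by (simp add: g'_def G.m_assoc)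
    then have eq: "(\<lambda>i\<in>{1..n}. g' i \<circ> h i) = (\<lambda>i\<in>{1..n}. h i \<circ> g i)"
      by (simp only: mult_GG[OF g'c h] mult_GG[OF h g(1)])
    have conj: "g' i (h i m) = h i (g i m)" if "i \<in> {1..n}" for i m
      using that fun_cong[OF fun_cong[OF eq, of i], of m] by simp
    have Fl: "m \<notin> ?S" if "m \<in> F" for m
    proof
      assume "m \<in> ?S"
      then have "m \<in> F \<inter> {..<l}" using l that by (meson IntI subsetD)
      then show False by (simp only: F(2) empty_iff)
    qed
    have hF: "h i m = h 1 m" if "i \<in> {1..n}" "m \<in> F" for i m
    proof (rule ccontr)
      assume "h i m \<noteq> h 1 m"
      then have "m \<in> ?S" using that(1) by blast
      then show False using Fl[OF that(2)] by contradiction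
    qed
    have F1: "h 1 ` F \<inter> {..<k} = {}" using Fl by auto
    have bij: "bij_betw (h 1) F (h 1 ` F)"
      using GG_D(1)[OF h one] by (auto simp: bij_betw_def intro: inj_on_subset)
    have "realizes_on n X (h 1 ` F) g'"
      unfolding realizes_on_def
    proof (intro conjI exI ballI allI impI)
      show "bij_betw (h 1 \<circ> e) (black X) (h 1 ` F)" "bij_betw (h 1 \<circ> e') (white X) (h 1 ` F)"
        using bij_betw_trans g(3,4) bij by blast+
      show "finite (h 1 ` F)" using g(2) by simp
      show "g' \<in> carrier (GG n)" by (rule g'c)
      fix i assume i: "i \<in> {1..n}"
      show "g' i m = m" if "m \<notin> h 1 ` F" for m
      proof -
        from GG_D(5)[OF h i, of m] obtain m0 where m0: "h i m0 = m" by blast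
        have "m0 \<notin> F"
        proof
          assume "m0 \<in> F"
          then have "m \<in> h 1 ` F" using hF[OF i, of m0] m0 by (intro image_eqI[of _ _ m0]) simp_all
          then show False using that by simp
        qed
        then show ?thesis using conj[OF i, of m0] g(6)[OF i] m0 by simp
      qed
      fix b assume b: "b \<in> black X"
      have eF: "e b \<in> F" using g(3) b by (auto simp: bij_betw_def)
      have gF: "g i (e b) \<in> F" by (rule realizes_on_stable[OF F(1) i eF])
      show "g' i ((h 1 \<circ> e) b) = (h 1 \<circ> e') (glue X i b)"
        using conj[OF i, of "e b"] hF[OF i eF] hF[OF i gF] g(5)[OF i b] by simp
    qed
    then show ?thesis using F1 unfolding realizations_def g'_def by blast
  qed
  then show ?thesis by (rule that)
qed

lemma remove_labels_z_elem:
  fixes X :: "'f::countable board"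
  assumes X: "is_board n 0 0 X" and n: "n \<ge> 1"
  shows "remove_labels n (enat k) (z_elem n (board_class n 0 0 X))
    = board_class n (enat k) (enat k) (discard_empty n (enat k) (enat k) (add_chebureks X))" (is "?L = ?R")
proof -
  note A = is_board_add_chebureks[OF X n]
  note P = pre_board_mono[OF is_boardD(1)[OF A], of "enat k" "enat k"]
  have eq: "board_class n (enat k) (enat k) (discard_empty n (enat k) (enat k) Z) = ?R"
    if "Z \<in> board_class n \<infinity> \<infinity> (add_chebureks X)" for Z
  proof -
    from that obtain \<phi> \<psi> where "iso_by n \<infinity> \<infinity> \<phi> \<psi> (add_chebureks X) Z" by (rule board_classE)
    then have "iso_by n (enat k) (enat k) \<phi> \<psi> (add_chebureks X) Z" by (rule iso_by_mono) simp_all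
    from board_class_eq[OF pre_board_discard_empty[OF P n] iso_by_discard_empty[OF P n this]]
    show ?thesis by simp
  qed
  obtain Z where "Z \<in> board_class n \<infinity> \<infinity> (add_chebureks X)" by (rule board_class_nonempty[OF A n])
  then show ?thesis unfolding remove_labels_def z_elem_board_class[OF X n] using eq by auto
qed

text \<open>In the board of g the faces numbered in F form a copy of X, the numbers below k form
  chebureks (m/m), and each remaining number forms an empty cheburek that is discarded. So all
  realizations beyond k lie in one double coset, namely that of z_c with the labels from k on
  removed.\<close>

lemma board_of_realization:
  fixes X :: "'f::countable board"
  assumes X: "is_board n 0 0 X" and n: "n \<ge> 1" and "g \<in> realizations n X k"
  shows "board_of n (enat k) (enat k) g = remove_labels n (enat k) (z_elem n (board_class n 0 0 X))"
proof -
  have one: "(1::nat) \<in> {1..n}" using n by simp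
  from assms(3) obtain F where F: "realizes_on n X F g" "F \<inter> {..<k} = {}" unfolding realizations_def by blast
  from F(1) obtain e e' where g: "g \<in> carrier (GG n)" "finite F" "bij_betw e (black X) F" "bij_betw e' (white X) F"
    "\<And>i b. i \<in> {1..n} \<Longrightarrow> b \<in> black X \<Longrightarrow> g i (e b) = e' (glue X i b)"
    "\<And>i m. i \<in> {1..n} \<Longrightarrow> m \<notin> F \<Longrightarrow> g i m = m" by (rule realizes_onE) blast
  note PX = is_boardD(1)[OF X] and noch = unlabelled_board_no_cheburek[OF X]
  let ?Z = "add_chebureks X" and ?k = "enat k"
  have gF: "g i m \<in> F \<longleftrightarrow> m \<in> F" if "i \<in> {1..n}" for i m
    using realizes_on_stable[OF F(1) that, of m] g(6)[OF that, of m] by metis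
  have notF: "\<not> cheburek n (perm_board g) m w" if "m \<in> F" for m w
  proof
    assume ch: "cheburek n (perm_board g) m w"
    have "m \<in> e ` black X" using g(3) that by (simp add: bij_betw_def)
    then obtain b where b: "b \<in> black X" "m = e b" by blast
    have "cheburek n X b (glue X 1 b)"
      unfolding cheburek_def
    proof (intro conjI ballI)
      show "glue X i b = glue X 1 b" if i: "i \<in> {1..n}" for i
      proof -
        have "g i m = g 1 m" using ch i one by (simp add: cheburek_def)
        then have "e' (glue X i b) = e' (glue X 1 b)" using g(5) b i one by simp
        then show ?thesis
          using g(4) pre_boardD(2)[OF PX i b(1)] pre_boardD(2)[OF PX one b(1)] by (auto simp: bij_betw_def inj_on_eq_iff)
      qed
    qed (use b pre_boardD(2)[OF PX one] in auto)
    then show False using noch by blast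
  qed
  have outF: "cheburek n (perm_board g) m m" if "m \<notin> F" for m
    using g(6) that by (simp add: cheburek_def)
  have P: "pre_board n ?k ?k (perm_board g)" by (rule pre_board_perm_board[OF g(1)])
  have out_iff: "cheburek n (perm_board g) m w \<longleftrightarrow> m \<notin> F \<and> w = m" for m w
    using notF outF cheburek_unique(2)[OF P n outF] by blast
  have kept: "black (discard_empty n ?k ?k (perm_board g)) = F \<union> {..<k}"
    "white (discard_empty n ?k ?k (perm_board g)) = F \<union> {..<k}"
    by (auto simp: empty_cheburek_def out_iff labels_enat)
  have PZ: "pre_board n ?k ?k ?Z" using pre_board_mono[OF pre_board_add_chebureks[OF PX]] by simp
  have chZ: "cheburek n ?Z x y \<longleftrightarrow> (\<exists>j. x = Inr j \<and> y = Inr j)" for x y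
  proof
    assume *: "cheburek n ?Z x y"
    have gy: "glue ?Z i x = y" if "i \<in> {1..n}" for i
      using * that unfolding cheburek_def by blast
    show "\<exists>j. x = Inr j \<and> y = Inr j"
    proof (cases x)
      case (Inl b)

      have "cheburek n X b (glue X 1 b)"
        unfolding cheburek_def
      proof (intro conjI ballI)
        show b: "b \<in> black X" using * Inl by (auto simp: cheburek_def)
        show "glue X 1 b \<in> white X" by (rule pre_boardD(2)[OF PX one b])
        show "glue X i b = glue X 1 b" if "i \<in> {1..n}" for i
          using gy[OF that] gy[OF one] Inl by auto
      qed
      then show ?thesis using noch by blast
    next
      case (Inr j)
      then show ?thesis using gy[OF one] by auto
    qed
  qed (auto simp: cheburek_def)
  have keptZ: "black (discard_empty n ?k ?k ?Z) = Inl ` black X \<union> Inr ` {..<k}"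
    "white (discard_empty n ?k ?k ?Z) = Inl ` white X \<union> Inr ` {..<k}"
    by (auto simp: empty_cheburek_def chZ labels_enat image_iff)
  have bij: "bij_betw (case_sum u id) (Inl ` A \<union> Inr ` {..<k}) (F \<union> {..<k})" if "bij_betw u A F" for u :: "'f \<Rightarrow> nat" and A
    using bij_betw_case_sum[OF that bij_betw_id F(2)] by (simp add: Sum_Type.Plus_def)
  have "iso_by n ?k ?k (case_sum e id) (case_sum e' id) (discard_empty n ?k ?k ?Z) (discard_empty n ?k ?k (perm_board g))"
    unfolding iso_by_def keptZ kept
  proof (intro conjI ballI bij g(3,4))
    fix i x assume i: "i \<in> {1..n}" and x: "x \<in> Inl ` black X \<union> Inr ` {..<k}"
    show "case_sum e' id (glue (discard_empty n ?k ?k ?Z) i x)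
        = glue (discard_empty n ?k ?k (perm_board g)) i (case_sum e id x)"
    proof (cases x)
      case (Inl b)
      then show ?thesis using x g(5)[OF i] by auto
    next
      case (Inr j)
      then have "j \<notin> F" using x F(2) by auto
      then show ?thesis using Inr g(6)[OF i] by simp
    qed
  qed simp_all
  from board_class_eq[OF pre_board_discard_empty[OF PZ n] this] show ?thesis
    unfolding remove_labels_z_elem[OF X n] board_of_perm_board by simp
qed

lemma is_board_disjoint_board:
  assumes X: "is_board n 0 0 X" and Y: "is_board n 0 0 Y" and n: "n \<ge> 1"
  shows "is_board n 0 0 (disjoint_board X Y)"
  unfolding is_board_iff[OF n]
proof (intro conjI)
  have one: "(1::nat) \<in> {1..n}" using n by simp
  show "pre_board n 0 0 (disjoint_board X Y)"
    unfolding pre_board_def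
  proof (intro conjI ballI)
    fix i assume "i \<in> {1..n}"
    then show "bij_betw (glue (disjoint_board X Y) i) (black (disjoint_board X Y)) (white (disjoint_board X Y))"
      using bij_betw_map_sum[OF pre_boardD(1)[OF is_boardD(1)[OF X]] pre_boardD(1)[OF is_boardD(1)[OF Y]]]
      by (simp add: disjoint_board_def)
  qed simp_all
  have "nontrivial_faces n (disjoint_board X Y) \<subseteq> Sum_Type.Plus (black X) (black Y)"
    by (auto simp: nontrivial_faces_def disjoint_board_def)
  then show "finite (nontrivial_faces n (disjoint_board X Y))"
    using unlabelled_board_finite(1)[OF X n] unlabelled_board_finite(1)[OF Y n] by (simp add: finite_subset)
  have "\<not> cheburek n (disjoint_board X Y) x y" for x y
  proof
    assume *: "cheburek n (disjoint_board X Y) x y"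
    have gy: "glue (disjoint_board X Y) i x = y" if "i \<in> {1..n}" for i
      using * that unfolding cheburek_def by blast
    show False
    proof (cases x)
      case (Inl b)
      then have b: "b \<in> black X" using * by (auto simp: cheburek_def disjoint_board_def)
      have "glue X i b = glue X 1 b" if "i \<in> {1..n}" for i
        using gy[OF that] gy[OF one] Inl by (auto simp: disjoint_board_def)
      then have "cheburek n X b (glue X 1 b)"
        using b pre_boardD(2)[OF is_boardD(1)[OF X] one b] unfolding cheburek_def by blast
      then show ?thesis using unlabelled_board_no_cheburek[OF X] by blast
    next
      case (Inr b)
      then have b: "b \<in> black Y" using * by (auto simp: cheburek_def disjoint_board_def)
      have "glue Y i b = glue Y 1 b" if "i \<in> {1..n}" for i
        using gy[OF that] gy[OF one] Inr by (auto simp: disjoint_board_def)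
      then have "cheburek n Y b (glue Y 1 b)"
        using b pre_boardD(2)[OF is_boardD(1)[OF Y] one b] unfolding cheburek_def by blast
      then show ?thesis using unlabelled_board_no_cheburek[OF Y] by blast
    qed
  qed
  then show "\<nexists>b w. empty_cheburek n 0 0 (disjoint_board X Y) b w" by (simp add: empty_cheburek_def)
qed

text \<open>With an empty label set nothing is cut, and a disjoint union of boards without chebureks
  has none to discard.\<close>

lemma Delta_mult:
  fixes X :: "'f::countable board" and Y :: "'g::countable board"
  assumes X: "is_board n 0 0 X" and Y: "is_board n 0 0 Y" and n: "n \<ge> 1"
  shows "board_class n 0 0 X \<otimes>\<^bsub>Delta n\<^esub> board_class n 0 0 Y = board_class n 0 0 (disjoint_board X Y)"
proof -
  note D = is_board_disjoint_board[OF X Y n]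
  have "glue (disjoint_board X Y) i x = glue (cut_and_glue 0 X Y) i x" for i x
    by (cases x) (simp_all add: disjoint_board_def cut_and_glue_def)
  then have iso: "iso_by n 0 0 id id (disjoint_board X Y) (cut_and_glue 0 X Y)"
    by (simp add: iso_by_def disjoint_board_def[of X Y, THEN arg_cong[of _ _ black]]
        disjoint_board_def[of X Y, THEN arg_cong[of _ _ white]])
  have "discard_empty n 0 0 (cut_and_glue 0 X Y) = cut_and_glue 0 X Y"
    by (rule discard_empty_id) (rule is_boardD(2)[OF iso_by_is_board[OF D iso n]])
  then show ?thesis
    using board_comp_board_class[OF n X Y] board_class_eq[OF is_boardD(1)[OF D] iso] by simp
qed

section \<open>The scalars by which central elements act\<close>

text \<open>A filter in place of a sequence: conjugation by a fixed group element maps it into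
  itself in the sense of \<open>filterlim\<close>, with no subsequences to choose.\<close>

definition escaping :: "nat \<Rightarrow> 'f board \<Rightarrow> (nat \<Rightarrow> nat \<Rightarrow> nat) filter" where
  "escaping n X = (INF k. principal (realizations n X k))"

lemma eventually_escaping: "eventually P (escaping n X) \<longleftrightarrow> (\<exists>k. \<forall>g\<in>realizations n X k. P g)"
  unfolding escaping_def
proof (subst eventually_INF_base)
  show "\<exists>x\<in>UNIV. principal (realizations n X x) \<le> inf (principal (realizations n X a)) (principal (realizations n X b))"
    for a b
    using realizations_antimono[of a "max a b" n X] realizations_antimono[of b "max a b" n X]
    by (intro bexI[of _ "max a b"]) auto
qed (auto simp: eventually_principal)

lemma escaping_neq_bot:
  assumes "is_board n 0 0 X" "n \<ge> 1"
  shows "escaping n X \<noteq> bot"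
  using realizations_nonempty[OF assms] unfolding trivial_limit_def eventually_escaping by blast

section \<open>Unitary representations and their matrix coefficients\<close>

lemma unitaryD:
  assumes "unitary U"
  shows "bounded_linear U" "U (a *\<^sub>C x) = a *\<^sub>C U x" "cinner (U x) (U y) = cinner x y" "norm (U x) = norm x"
proof -
  note U = assms[unfolded unitary_def]
  show c: "cinner (U x) (U y) = cinner x y" "U (a *\<^sub>C x) = a *\<^sub>C U x" for x y a using U by blast+
  have "complex_of_real ((norm (U x))\<^sup>2) = complex_of_real ((norm x)\<^sup>2)" for x
    unfolding cinner_self[symmetric] by (rule c(1))
  then have "(norm (U x))\<^sup>2 = (norm x)\<^sup>2" for x by (simp only: of_real_eq_iff)
  then show norm: "norm (U x) = norm x" for x by (simp add: power2_eq_iff_nonneg)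
  show "bounded_linear U"
  proof
    show "U (x + y) = U x + U y" for x y using U by blast
    show "U (r *\<^sub>R x) = r *\<^sub>R U x" for r x by (simp add: scaleR_scaleC c(2))
    show "\<exists>K. \<forall>x. norm (U x) \<le> norm x * K" by (intro exI[of _ 1]) (simp add: norm)
  qed
qed

locale unitary_representation =
  fixes n :: nat and \<rho> :: "(nat \<Rightarrow> nat \<Rightarrow> nat) \<Rightarrow> 'h::chilbert_space \<Rightarrow> 'h"
  assumes n: "n \<ge> 1" and rep: "unitary_rep n \<rho>"
begin

sublocale G: group "GG n" by (rule group_GG)

lemma rho_unitary: "g \<in> carrier (GG n) \<Longrightarrow> unitary (\<rho> g)"
  using rep unfolding unitary_rep_def hom_def unitary_group_def by auto

lemma rho_mult: "g \<in> carrier (GG n) \<Longrightarrow> h \<in> carrier (GG n) \<Longrightarrow> \<rho> (g \<otimes>\<^bsub>GG n\<^esub> h) v = \<rho> g (\<rho> h v)"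
  using rep unfolding unitary_rep_def hom_def unitary_group_def by auto

lemmas rho = unitaryD[OF rho_unitary]

text \<open>Membership in \<open>hom\<close> gives multiplicativity only. The image of the unit is
  idempotent and surjective, hence the identity.\<close>

lemma rho_one: "\<rho> \<one>\<^bsub>GG n\<^esub> v = v"
proof -
  have "surj (\<rho> \<one>\<^bsub>GG n\<^esub>)" using rho_unitary[OF G.one_closed] by (simp add: unitary_def)
  then obtain u where u: "v = \<rho> \<one>\<^bsub>GG n\<^esub> u" by (metis surj_def)
  then show ?thesis using rho_mult[OF G.one_closed G.one_closed, of u] by simp
qed

lemma rho_inv:
  assumes "g \<in> carrier (GG n)"
  shows "\<rho> (inv\<^bsub>GG n\<^esub> g) (\<rho> g v) = v" "\<rho> g (\<rho> (inv\<^bsub>GG n\<^esub> g) v) = v"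
  using assms rho_mult[of "inv\<^bsub>GG n\<^esub> g" g v] rho_mult[of g "inv\<^bsub>GG n\<^esub> g" v] by (simp_all add: rho_one)

lemma cinner_rho_inv:
  assumes "g \<in> carrier (GG n)"
  shows "cinner (\<rho> (inv\<^bsub>GG n\<^esub> g) v) w = cinner v (\<rho> g w)" "cinner (\<rho> g v) w = cinner v (\<rho> (inv\<^bsub>GG n\<^esub> g) w)"
  using rho(3)[OF assms, of "\<rho> (inv\<^bsub>GG n\<^esub> g) v" w] rho(3)[OF assms, of v "\<rho> (inv\<^bsub>GG n\<^esub> g) w"]
  by (simp_all add: rho_inv[OF assms])

subsection \<open>Fixed vectors\<close>

abbreviation H :: "nat \<Rightarrow> 'h set" where "H k \<equiv> fixed_space n \<rho> (enat k)"
abbreviation P :: "nat \<Rightarrow> 'h \<Rightarrow> 'h" where "P k \<equiv> fixed_proj n \<rho> (enat k)"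

lemma KK_carrier: "k \<in> KK n \<beta> \<Longrightarrow> k \<in> carrier (GG n)"
  using KK_subset by blast

lemma KK_mult: "k \<in> KK n \<beta> \<Longrightarrow> k' \<in> KK n \<beta> \<Longrightarrow> k \<otimes>\<^bsub>GG n\<^esub> k' \<in> KK n \<beta>"
proof -
  assume k: "k \<in> KK n \<beta>" "k' \<in> KK n \<beta>"
  then obtain s t where st: "k = (\<lambda>i\<in>{1..n}. s)" "k' = (\<lambda>i\<in>{1..n}. t)" "s \<in> Sinf_stab \<beta>" "t \<in> Sinf_stab \<beta>"
    unfolding KK_def by blast
  have "s \<circ> t \<in> Sinf_stab \<beta>" using st(3,4) by (auto simp: Sinf_stab_iff intro: bij_comp)
  moreover have "(\<lambda>i\<in>{1..n}. k i \<circ> k' i) = (\<lambda>i\<in>{1..n}. s \<circ> t)"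
    by (rule restrict_ext) (simp add: st(1,2))
  then have "k \<otimes>\<^bsub>GG n\<^esub> k' = (\<lambda>i\<in>{1..n}. s \<circ> t)"
    by (simp only: mult_GG[OF KK_carrier[OF k(1)] KK_carrier[OF k(2)]])
  ultimately show ?thesis unfolding KK_def by blast
qed

lemma H_csubspace: "csubspace (H k)" and H_closed: "closed (H k)"
proof -
  have lin: "linear (\<rho> g)" if "g \<in> KK n (enat k)" for g
    using rho(1)[OF KK_carrier[OF that]] by (rule bounded_linear.linear)
  show "csubspace (H k)"
    unfolding csubspace_def subspace_def fixed_space_def
    using lin rho(2)[OF KK_carrier] by (auto simp: linear_0 linear_add linear_scale)
  have "closed {v. \<rho> g v = v}" if "g \<in> KK n (enat k)" for g
    using linear_continuous_on[OF rho(1)[OF KK_carrier[OF that]]]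
    by (intro closed_Collect_eq continuous_intros)
  moreover have "H k = (\<Inter>g\<in>KK n (enat k). {v. \<rho> g v = v})" by (auto simp: fixed_space_def)
  ultimately show "closed (H k)" by auto
qed

lemma H_mono: "k \<le> l \<Longrightarrow> H k \<subseteq> H l"
  using KK_antimono[of "enat k" "enat l" n] unfolding fixed_space_def by auto

lemma P_in_H: "P k v \<in> H k"
  unfolding fixed_proj_def by (rule ortho_proj_in[OF H_csubspace H_closed])

lemma cinner_P: "u \<in> H k \<Longrightarrow> cinner (P k v) u = cinner v u" "u \<in> H k \<Longrightarrow> cinner u (P k v) = cinner u v"
  unfolding fixed_proj_def by (rule cinner_ortho_proj[OF H_csubspace H_closed], assumption)+

lemma P_id: "u \<in> H k \<Longrightarrow> P k u = u"
  unfolding fixed_proj_def by (rule ortho_proj_id[OF H_csubspace H_closed])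

lemma rho_small:
  assumes "e > 0"
  obtains k where "\<And>g. g \<in> KK n (enat k) \<Longrightarrow> norm (\<rho> g v - v) < e"
proof -
  have "continuous_map (GG_top n) euclidean (\<lambda>g. \<rho> g v)" using rep by (simp add: unitary_rep_def)
  moreover have "topspace (GG_top n) = carrier (GG n)"
  proof
    show "topspace (GG_top n) \<subseteq> carrier (GG n)"
      using openin_topspace[of "GG_top n"] unfolding openin_GG_top by blast
    have "openin (GG_top n) (carrier (GG n))"
      unfolding openin_GG_top using KK_carrier by blast
    then show "carrier (GG n) \<subseteq> topspace (GG_top n)" by (rule openin_subset)
  qed
  ultimately have "openin (GG_top n) {g \<in> carrier (GG n). \<rho> g v \<in> ball v e}"
    using openin_continuous_map_preimage[of "GG_top n" euclidean _ "ball v e"] by simp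
  moreover have "\<one>\<^bsub>GG n\<^esub> \<in> {g \<in> carrier (GG n). \<rho> g v \<in> ball v e}" using assms by (simp add: rho_one)
  ultimately obtain k where k: "(\<lambda>g. \<one>\<^bsub>GG n\<^esub> \<otimes>\<^bsub>GG n\<^esub> g) ` KK n (enat k) \<subseteq> {g \<in> carrier (GG n). \<rho> g v \<in> ball v e}"
    unfolding openin_GG_top by blast
  have "norm (\<rho> g v - v) < e" if "g \<in> KK n (enat k)" for g
  proof -
    have "\<one>\<^bsub>GG n\<^esub> \<otimes>\<^bsub>GG n\<^esub> g \<in> {g \<in> carrier (GG n). \<rho> g v \<in> ball v e}" using k that by blast
    then show ?thesis using KK_carrier[OF that] by (simp add: dist_norm norm_minus_commute)
  qed
  then show ?thesis by (rule that)
qed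

text \<open>The point of minimal norm in the closed convex hull of a small \<open>K(k)\<close>-orbit is fixed by \<open>K(k)\<close>.\<close>

lemma fixed_vector_near:
  assumes "e > 0"
  obtains k u where "u \<in> H k" "norm (v - u) \<le> e"
proof -
  obtain k where k: "\<And>g. g \<in> KK n (enat k) \<Longrightarrow> norm (\<rho> g v - v) < e"
    by (rule rho_small[OF assms, of v]) blast
  let ?O = "(\<lambda>g. \<rho> g v) ` KK n (enat k)"
  let ?C = "closure (convex hull ?O)"
  have "(\<lambda>i\<in>{1..n}. \<lambda>m. m) \<in> KK n (enat k)"
    unfolding KK_def by (auto simp: Sinf_stab_iff bij_id[unfolded id_def])
  then have ne: "?C \<noteq> {}" by auto
  have sub: "?C \<subseteq> cball v e"
    by (intro closure_minimal hull_minimal convex_cball closed_cball)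
      (auto simp: dist_norm norm_minus_commute[of v] intro!: less_imp_le[OF k])
  obtain c where c: "c \<in> ?C" "\<And>x. x \<in> ?C \<Longrightarrow> norm c \<le> norm x"
    using min_norm_point_exists[of ?C] ne convex_closure[OF convex_convex_hull] closed_closure by blast
  \<comment> \<open>\<open>\<rho> g\<close> permutes the orbit, maps the closed hull into itself and
    preserves norms. So it sends c to a point of minimal norm, and there is only one.\<close>
  have "\<rho> g c = c" if g: "g \<in> KK n (enat k)" for g
  proof (rule min_norm_point_unique[OF _ c(1) _ c(2)])
    have bl: "bounded_linear (\<rho> g)" by (rule rho(1)[OF KK_carrier[OF g]])
    have "\<rho> g ` ?O \<subseteq> ?O"
    proof
      fix x assume "x \<in> \<rho> g ` ?O"
      then obtain h where h: "h \<in> KK n (enat k)" "x = \<rho> g (\<rho> h v)" by blast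
      then have "x = \<rho> (g \<otimes>\<^bsub>GG n\<^esub> h) v" using rho_mult KK_carrier g by simp
      then show "x \<in> ?O" using KK_mult[OF g h(1)] by blast
    qed
    then have "\<rho> g ` (convex hull ?O) \<subseteq> convex hull ?O"
      unfolding convex_hull_linear_image[OF bounded_linear.linear[OF bl]] by (rule hull_mono)
    then have "\<rho> g ` (convex hull ?O) \<subseteq> ?C" using closure_subset by blast
    then have "\<rho> g ` ?C \<subseteq> ?C"
      by (intro image_closure_subset linear_continuous_on[OF bl] closed_closure)
    then show "\<rho> g c \<in> ?C" using c(1) by blast
    show "norm (\<rho> g c) = norm c" by (rule rho(4)[OF KK_carrier[OF g]])
    show "convex ?C" by (intro convex_closure convex_convex_hull)
  qed
  then have "c \<in> H k" by (simp add: fixed_space_def)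
  moreover have "norm (v - c) \<le> e" using sub c(1) by (auto simp: dist_norm)
  ultimately show ?thesis by (rule that)
qed

text \<open>The spaces \<open>H k\<close> increase with k, so for l \<ge> k the projection
  \<open>P l v\<close> is at least as near to v as any given vector of \<open>H k\<close>.\<close>

lemma P_tendsto: "(\<lambda>k. P k v) \<longlonglongrightarrow> v"
proof (rule metric_LIMSEQ_I)
  fix e :: real assume "e > 0"
  then have "e / 2 > 0" by simp
  then obtain k u where u: "u \<in> H k" "norm (v - u) \<le> e / 2" by (rule fixed_vector_near)
  have "dist (P l v) v < e" if "l \<ge> k" for l
  proof -
    have "norm (v - P l v) \<le> norm (v - u)"
      unfolding fixed_proj_def
      by (rule norm_diff_ortho_proj_le[OF H_csubspace H_closed]) (use u(1) H_mono[OF that] in blast)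
    then show ?thesis using u(2) \<open>e > 0\<close> by (simp add: dist_norm norm_minus_commute)
  qed
  then show "\<exists>k. \<forall>l\<ge>k. dist (P l v) v < e" by blast
qed

section \<open>Weak limits along escaping realizations\<close>

definition proj_error :: "'h \<Rightarrow> 'h \<Rightarrow> nat \<Rightarrow> real" where
  "proj_error v w k = norm (v - P k v) * norm w + norm (P k v) * norm (w - P k w)"

lemma proj_error_tendsto: "proj_error v w \<longlonglongrightarrow> 0"
proof -
  have "(\<lambda>k. norm (v - P k v) * norm w + norm (P k v) * norm (w - P k w))
      \<longlonglongrightarrow> norm (v - v) * norm w + norm v * norm (w - w)"
    by (intro tendsto_intros P_tendsto)
  then show ?thesis by (simp add: proj_error_def[abs_def])
qed

text \<open>The bound does not depend on g, because \<open>\<rho> g\<close> preserves norms. This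
  uniformity carries statements about fixed vectors over to all vectors in the limit.\<close>

lemma cinner_proj_error:
  assumes "g \<in> carrier (GG n)"
  shows "cmod (cinner (\<rho> g v) w - cinner (\<rho> g (P k v)) (P k w)) \<le> proj_error v w k"
proof -
  interpret R: bounded_linear "\<rho> g" by (rule rho(1)[OF assms])
  have "cinner (\<rho> g v) w - cinner (\<rho> g (P k v)) (P k w)
      = cinner (\<rho> g (v - P k v)) w + cinner (\<rho> g (P k v)) (w - P k w)"
    by (simp add: R.diff cinner.diff_left cinner.diff_right)
  also have "cmod \<dots> \<le> norm (\<rho> g (v - P k v)) * norm w + norm (\<rho> g (P k v)) * norm (w - P k w)"
    by (rule order_trans[OF norm_triangle_ineq add_mono[OF cmod_cinner_le cmod_cinner_le]])
  also have "\<dots> = proj_error v w k" by (simp add: proj_error_def rho(4)[OF assms])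
  finally show ?thesis .
qed

lemma cinner_double_coset:
  assumes g: "g \<in> carrier (GG n)" and g': "g' \<in> carrier (GG n)"
    and eq: "board_of n (enat k) (enat k) g = board_of n (enat k) (enat k) g'"
    and v: "v \<in> H k" and w: "w \<in> H k"
  shows "cinner (\<rho> g' v) w = cinner (\<rho> g v) w"
proof -
  obtain s t where st: "s \<in> Sinf_stab (enat k)" "t \<in> Sinf_stab (enat k)"
    "\<And>i m. i \<in> {1..n} \<Longrightarrow> g' i (s m) = t (g i m)" by (rule double_coset[OF n g g' eq]) blast
  define a b where "a = (\<lambda>i\<in>{1..n}. s)" and "b = (\<lambda>i\<in>{1..n}. t)"
  have ab: "a \<in> KK n (enat k)" "b \<in> KK n (enat k)" using st(1,2) by (auto simp: KK_def a_def b_def)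
  note c = KK_carrier[OF ab(1)] KK_carrier[OF ab(2)]
  have "g' \<otimes>\<^bsub>GG n\<^esub> a = b \<otimes>\<^bsub>GG n\<^esub> g"
    unfolding mult_GG[OF g' c(1)] mult_GG[OF c(2) g]
    by (rule restrict_ext) (simp add: a_def b_def fun_eq_iff st(3))
  then have "\<rho> g' (\<rho> a v) = \<rho> b (\<rho> g v)"
    using rho_mult[OF g' c(1)] rho_mult[OF c(2) g] by metis
  moreover have "\<rho> a v = v" "\<rho> b w = w" using v w ab by (auto simp: fixed_space_def)
  ultimately have "cinner (\<rho> g' v) w = cinner (\<rho> b (\<rho> g v)) (\<rho> b w)" by simp
  then show ?thesis using rho(3)[OF c(2)] by simp
qed

lemma cinner_realizations_eq:
  fixes X :: "'f::countable board"
  assumes X: "is_board n 0 0 X" and "g \<in> realizations n X k" "g' \<in> realizations n X k" "v \<in> H k" "w \<in> H k"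
  shows "cinner (\<rho> g v) w = cinner (\<rho> g' v) w"
  using cinner_double_coset[OF realizations_carrier[OF assms(3)] realizations_carrier[OF assms(2)] _ assms(4,5)]
    board_of_realization[OF X n assms(2)] board_of_realization[OF X n assms(3)] by simp

text \<open>After projection to \<open>H k\<close> the two coefficients coincide, so they differ by
  at most twice the projection error. This is the Cauchy condition for the filter
  \<open>escaping\<close>.\<close>

lemma cinner_realizations_close:
  fixes X :: "'f::countable board"
  assumes X: "is_board n 0 0 X" and e: "e > 0"
  obtains k where "\<And>g g'. g \<in> realizations n X k \<Longrightarrow> g' \<in> realizations n X k \<Longrightarrow>
    cmod (cinner (\<rho> g v) w - cinner (\<rho> g' v) w) < e"
proof -
  have "\<forall>\<^sub>F k in sequentially. proj_error v w k < e / 2"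
    using e by (intro order_tendstoD(2)[OF proj_error_tendsto]) simp
  then obtain k where k: "proj_error v w k < e / 2" by (auto simp: eventually_sequentially)
  have "cmod (cinner (\<rho> g v) w - cinner (\<rho> g' v) w) < e"
    if g: "g \<in> realizations n X k" "g' \<in> realizations n X k" for g g'
  proof -
    have "cinner (\<rho> g (P k v)) (P k w) = cinner (\<rho> g' (P k v)) (P k w)"
      by (rule cinner_realizations_eq[OF X g P_in_H P_in_H])
    then have "cinner (\<rho> g v) w - cinner (\<rho> g' v) w
      = (cinner (\<rho> g v) w - cinner (\<rho> g (P k v)) (P k w))
        - (cinner (\<rho> g' v) w - cinner (\<rho> g' (P k v)) (P k w))" by simp
    also have "cmod \<dots> \<le> proj_error v w k + proj_error v w k"
      by (rule order_trans[OF norm_triangle_ineq4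
            add_mono[OF cinner_proj_error[OF realizations_carrier[OF g(1)]] cinner_proj_error[OF realizations_carrier[OF g(2)]]]])
    finally show ?thesis using k by simp
  qed
  then show ?thesis by (rule that)
qed

text \<open>One realization beyond each k is chosen. The coefficients along this sequence form a
  Cauchy sequence, and closeness of all realizations beyond k makes its limit the limit along the
  whole filter.\<close>

lemma escaping_limit_exists:
  fixes X :: "'f::countable board"
  assumes X: "is_board n 0 0 X"
  shows "\<exists>L. ((\<lambda>g. cinner (\<rho> g v) w) \<longlongrightarrow> L) (escaping n X)"
proof -
  let ?f = "\<lambda>g. cinner (\<rho> g v) w"
  have "\<exists>g. g \<in> realizations n X k" for k using realizations_nonempty[OF X n] by blast
  then obtain g where g: "\<And>k. g k \<in> realizations n X k" by metis
  have g': "g l \<in> realizations n X k" if "k \<le> l" for k l using g realizations_antimono[OF that] by blast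
  have "Cauchy (\<lambda>k. ?f (g k))"
  proof (rule metric_CauchyI)
    fix e :: real assume "e > 0"
    then obtain k where "\<And>h h'. h \<in> realizations n X k \<Longrightarrow> h' \<in> realizations n X k \<Longrightarrow> cmod (?f h - ?f h') < e"
      by (rule cinner_realizations_close[OF X]) blast
    then show "\<exists>M. \<forall>m\<ge>M. \<forall>n\<ge>M. dist (?f (g m)) (?f (g n)) < e"
      using g' by (intro exI[of _ k]) (simp add: dist_norm)
  qed
  then obtain L where L: "(\<lambda>k. ?f (g k)) \<longlonglongrightarrow> L" by (auto simp: Cauchy_convergent_iff convergent_def)
  have "(?f \<longlongrightarrow> L) (escaping n X)"
  proof (rule tendstoI)
    fix e :: real assume "e > 0"
    then have e2: "e / 2 > 0" by simp
    then obtain k where k: "\<And>h h'. h \<in> realizations n X k \<Longrightarrow> h' \<in> realizations n X k \<Longrightarrow> cmod (?f h - ?f h') < e / 2"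
      by (rule cinner_realizations_close[OF X]) blast
    obtain m where m: "\<And>l. l \<ge> m \<Longrightarrow> dist (?f (g l)) L < e / 2" using metric_LIMSEQ_D[OF L e2] by blast
    have "dist (?f h) L < e" if "h \<in> realizations n X k" for h
    proof -
      have "dist (?f h) (?f (g (max k m))) < e / 2" unfolding dist_norm by (intro k that g') simp
      moreover have "dist (?f (g (max k m))) L < e / 2" by (rule m) simp
      ultimately show ?thesis using dist_triangle[of "?f h" L "?f (g (max k m))"] by linarith
    qed
    then show "\<forall>\<^sub>F h in escaping n X. dist (?f h) L < e" unfolding eventually_escaping by blast
  qed
  then show ?thesis by blast
qed

text \<open>The scalar expressed through limits alone. The descriptions hidden in
  \<open>rhobar\<close> and \<open>chi\<close> are evaluated only once this is known to hold for
  some s.\<close>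

definition acts_by :: "'f board \<Rightarrow> complex \<Rightarrow> bool" where
  "acts_by X s \<longleftrightarrow> (\<forall>v w. ((\<lambda>g. cinner (\<rho> g v) w) \<longlongrightarrow> s * cinner v w) (escaping n X))"

text \<open>For a fixed realization g of X, moving \<open>\<rho> g\<close> to the other side of the
  inner product turns the limit over h into t times the coefficient of g; letting g escape then
  produces s. Along the way g h realizes the union, so its coefficients stay within e of r times the
  squared norm of v.\<close>

lemma acts_by_disjoint_board:
  fixes X :: "'f::countable board" and Y :: "'g::countable board"
  assumes X: "is_board n 0 0 X" and Y: "is_board n 0 0 Y"
    and s: "acts_by X s" and t: "acts_by Y t" and r: "acts_by (disjoint_board X Y) r"
    and nz: "\<exists>v::'h. v \<noteq> 0"
  shows "r = s * t"
proof -
  obtain v :: 'h where v: "v \<noteq> 0" using nz by blast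
  note bot = escaping_neq_bot[OF X n] escaping_neq_bot[OF Y n]
  have "cmod (t * (s * cinner v v) - r * cinner v v) \<le> e" if e: "e > 0" for e
  proof -
    have "((\<lambda>f. cinner (\<rho> f v) v) \<longlongrightarrow> r * cinner v v) (escaping n (disjoint_board X Y))"
      using r unfolding acts_by_def by blast
    from tendstoD[OF this e]
    have "\<forall>\<^sub>F f in escaping n (disjoint_board X Y). dist (cinner (\<rho> f v) v) (r * cinner v v) < e" .
    then obtain k where k: "\<And>f. f \<in> realizations n (disjoint_board X Y) k \<Longrightarrow>
        cmod (cinner (\<rho> f v) v - r * cinner v v) < e"
      unfolding eventually_escaping dist_norm by blast
    have "cmod (t * cinner (\<rho> g v) v - r * cinner v v) \<le> e" if g: "g \<in> realizations n X k" for g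
    proof -
      note gc = realizations_carrier[OF g]
      from g obtain F where F: "realizes_on n X F g" "F \<inter> {..<k} = {}" unfolding realizations_def by blast
      then have "finite F" by (simp add: realizes_on_def)
      then obtain l where l: "F \<subseteq> {..<l}" using finite_nat_iff_bounded by blast
      \<comment> \<open>Beyond k the estimate for the union applies; beyond l the support of h is
        disjoint from F.\<close>
      have "cmod (cinner (\<rho> h v) (\<rho> (inv\<^bsub>GG n\<^esub> g) v) - r * cinner v v) < e"
        if h: "h \<in> realizations n Y (max k l)" for h
      proof -
        note hc = realizations_carrier[OF h]
        from h obtain F' where F': "realizes_on n Y F' h" "F' \<inter> {..<max k l} = {}" unfolding realizations_def by blast
        have "F \<subseteq> {..<max k l}" using l by auto
        then have "F \<inter> F' = {}" using F'(2) by blast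
        then have "realizes_on n (disjoint_board X Y) (F \<union> F') (g \<otimes>\<^bsub>GG n\<^esub> h)"
          by (rule realizes_on_disjoint_board[OF F(1) F'(1)])
        moreover have "(F \<union> F') \<inter> {..<k} = {}" using F(2) F'(2) by (auto simp: disjoint_iff)
        ultimately have "g \<otimes>\<^bsub>GG n\<^esub> h \<in> realizations n (disjoint_board X Y) k"
          unfolding realizations_def by blast
        from k[OF this] show ?thesis by (simp add: rho_mult[OF gc hc] cinner_rho_inv(2)[OF gc])
      qed
      then have ev: "\<forall>\<^sub>F h in escaping n Y. cmod (cinner (\<rho> h v) (\<rho> (inv\<^bsub>GG n\<^esub> g) v) - r * cinner v v) \<le> e"
        unfolding eventually_escaping by (blast intro: less_imp_le)
      have "((\<lambda>h. cmod (cinner (\<rho> h v) (\<rho> (inv\<^bsub>GG n\<^esub> g) v) - r * cinner v v))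
          \<longlongrightarrow> cmod (t * cinner v (\<rho> (inv\<^bsub>GG n\<^esub> g) v) - r * cinner v v)) (escaping n Y)"
        using t unfolding acts_by_def by (intro tendsto_intros) blast
      from tendsto_upperbound[OF this ev bot(2)] show ?thesis by (simp add: cinner_rho_inv(2)[OF gc])
    qed
    then have ev: "\<forall>\<^sub>F g in escaping n X. cmod (t * cinner (\<rho> g v) v - r * cinner v v) \<le> e"
      unfolding eventually_escaping by blast
    have "((\<lambda>g. cmod (t * cinner (\<rho> g v) v - r * cinner v v))
        \<longlongrightarrow> cmod (t * (s * cinner v v) - r * cinner v v)) (escaping n X)"
      using s unfolding acts_by_def by (intro tendsto_intros) blast
    from tendsto_upperbound[OF this ev bot(1)] show ?thesis .
  qed
  then have "cmod (t * (s * cinner v v) - r * cinner v v) \<le> 0" by (rule field_le_epsilon) simp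
  then have "(t * s - r) * cinner v v = 0" by (simp add: algebra_simps)
  then show ?thesis using v by (simp add: cinner_self mult.commute)
qed

text \<open>The representative picked by \<open>SOME\<close> may be replaced by a realization beyond
  k, since both lie in one double coset and only vectors of \<open>H k\<close> are involved. What
  remains differs from the coefficient of that realization by at most the projection error, so the
  limit is the scalar s.\<close>

lemma rhobar_z_elem:
  fixes X :: "'f::countable board"
  assumes X: "is_board n 0 0 X" and s: "acts_by X s"
  shows "rhobar n \<rho> (z_elem n (board_class n 0 0 X)) = (\<lambda>v. s *\<^sub>C v)"
proof -
  let ?z = "z_elem n (board_class n 0 0 X)"
  let ?f = "\<lambda>k v w. cinner (rhobar_fin n \<rho> k (remove_labels n (enat k) ?z) (P k v)) w"
  have "\<exists>g. g \<in> realizations n X k" for k using realizations_nonempty[OF X n] by blast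
  then obtain g where g: "\<And>k. g k \<in> realizations n X k" by metis
  have eq: "?f k v w = cinner (\<rho> (g k) (P k v)) (P k w)" for k v w
  proof -
    let ?Q = "\<lambda>h. h \<in> carrier (GG n) \<and> board_of n (enat k) (enat k) h = remove_labels n (enat k) ?z"
    define h where "h = (SOME h. ?Q h)"
    have gk: "?Q (g k)" using realizations_carrier[OF g] board_of_realization[OF X n g] by blast
    have h: "?Q h" unfolding h_def by (rule someI[where P = ?Q, OF gk])
    have "?f k v w = cinner (P k (\<rho> h (P k v))) w"
      by (simp add: rhobar_fin_def h_def P_id[OF P_in_H])
    also have "\<dots> = cinner (P k (\<rho> h (P k v))) (P k w)" by (rule cinner_P(2)[OF P_in_H, symmetric])
    also have "\<dots> = cinner (\<rho> h (P k v)) (P k w)" by (rule cinner_P(1)[OF P_in_H])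
    also have "\<dots> = cinner (\<rho> (g k) (P k v)) (P k w)"
      by (rule cinner_double_coset[OF _ _ _ P_in_H P_in_H]) (use gk h in auto)
    finally show ?thesis .
  qed
  have lim: "(\<lambda>k. ?f k v w) \<longlonglongrightarrow> s * cinner v w" for v w
  proof -
    have fl: "filterlim g (escaping n X) sequentially"
      unfolding filterlim_iff eventually_escaping eventually_sequentially
      using g realizations_antimono by (metis subsetD)
    have 1: "(\<lambda>k. cinner (\<rho> (g k) v) w) \<longlonglongrightarrow> s * cinner v w"
      using s unfolding acts_by_def by (intro filterlim_compose[OF _ fl]) blast
    have "(\<lambda>k. cinner (\<rho> (g k) v) w - ?f k v w) \<longlonglongrightarrow> 0"
      by (rule Lim_null_comparison[OF _ proj_error_tendsto[of v w]])
        (simp add: eq cinner_proj_error[OF realizations_carrier[OF g]])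
    from tendsto_diff[OF 1 this] show ?thesis by simp
  qed
  show ?thesis
    unfolding rhobar_def
  proof (rule the_equality)
    show "\<forall>v w. (\<lambda>k. ?f k v w) \<longlonglongrightarrow> cinner (s *\<^sub>C v) w" using lim by (simp add: cinner_scaleC_left)
    fix T assume T: "\<forall>v w. (\<lambda>k. ?f k v w) \<longlonglongrightarrow> cinner (T v) w"
    show "T = (\<lambda>v. s *\<^sub>C v)"
    proof (rule ext, rule cinner_ext)
      fix v w
      show "cinner (T v) w = cinner (s *\<^sub>C v) w"
        using LIMSEQ_unique[OF T[rule_format] lim] by (simp add: cinner_scaleC_left)
    qed
  qed
qed

end

section \<open>The irreducible case: limits are scalars and chi is multiplicative\<close>

locale irreducible_unitary_representation = unitary_representation n \<rho>
  for n and \<rho> :: "(nat \<Rightarrow> nat \<Rightarrow> nat) \<Rightarrow> 'h::chilbert_space \<Rightarrow> 'h" +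
  assumes irr: "irreducible_rep n \<rho>"
begin

lemma irreducible_operators_rho: "irreducible_operators (\<rho> ` carrier (GG n))"
proof (rule irreducible_operators.intro)
  show "U \<in> \<rho> ` carrier (GG n) \<Longrightarrow> bounded_linear U" for U using rho(1) by blast
  show "U \<in> \<rho> ` carrier (GG n) \<Longrightarrow> U (a *\<^sub>C x) = a *\<^sub>C U x" for U a x using rho(2) by blast
  show "V = {0} \<or> V = UNIV" if "csubspace V" "closed V" "\<forall>U\<in>\<rho> ` carrier (GG n). U ` V \<subseteq> V" for V
    using irr that unfolding irreducible_rep_def by blast
  show "\<exists>v::'h. v \<noteq> 0" using irr unfolding irreducible_rep_def by blast
qed

sublocale irreducible_operators "\<rho> ` carrier (GG n)"
  by (rule irreducible_operators_rho)

text \<open>For each v the Riesz theorem represents the functional S v by a vector T v. Linearity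
  and boundedness of T come from those of S, and invariance of S under a unitary
  \<open>\<rho> h\<close> is commutation of T with it.\<close>

lemma invariant_form_operator:
  fixes S :: "'h \<Rightarrow> 'h \<Rightarrow> complex"
  assumes add: "\<And>u v w. S (u + v) w = S u w + S v w" "\<And>u v w. S u (v + w) = S u v + S u w"
    and scale: "\<And>a v w. S (a *\<^sub>C v) w = a * S v w" "\<And>a v w. S v (a *\<^sub>C w) = cnj a * S v w"
    and bound: "\<And>v w. cmod (S v w) \<le> norm v * norm w"
    and inv: "\<And>h v w. h \<in> carrier (GG n) \<Longrightarrow> S (\<rho> h v) (\<rho> h w) = S v w"
  shows "\<exists>T\<in>commutant (\<rho> ` carrier (GG n)). \<forall>v w. cinner (T v) w = S v w"
proof -
  have "\<exists>t. \<forall>w. S v w = cinner t w" for v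
  proof -
    have "bounded_linear (S v)"
    proof
      show "S v (r *\<^sub>R w) = r *\<^sub>R S v w" for r w by (simp add: scaleR_scaleC[of r w] scale scaleR_conv_of_real)
      show "\<exists>K. \<forall>w. norm (S v w) \<le> norm w * K" by (intro exI[of _ "norm v"] allI) (metis bound mult.commute)
    qed (rule add)
    then show ?thesis by (rule riesz_cinner[OF _ scale(2)]) blast
  qed
  then obtain T where T: "\<And>v w. S v w = cinner (T v) w" by metis
  have Tc: "T (a *\<^sub>C v) = a *\<^sub>C T v" for a v
    by (rule cinner_ext) (simp add: T[symmetric] scale cinner_scaleC_left)
  have "bounded_linear T"
  proof
    show "T (u + v) = T u + T v" for u v
      by (rule cinner_ext) (simp add: T[symmetric] add cinner_add_left)
    show "T (r *\<^sub>R v) = r *\<^sub>R T v" for r v by (simp add: scaleR_scaleC Tc)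
    have "norm (T v) \<le> norm v" for v
    proof (cases "T v = 0")
      case False
      have "(norm (T v))\<^sup>2 = cmod (S v (T v))" by (simp add: T cinner_self norm_power)
      also have "\<dots> \<le> norm v * norm (T v)" by (rule bound)
      finally show ?thesis using False by (simp add: power2_eq_square)
    qed simp
    then show "\<exists>K. \<forall>v. norm (T v) \<le> norm v * K" by (intro exI[of _ 1]) simp
  qed
  moreover have "T (\<rho> h v) = \<rho> h (T v)" if "h \<in> carrier (GG n)" for h v
  proof (rule cinner_ext)
    fix w
    have "S (\<rho> h v) w = S (\<rho> h v) (\<rho> h (\<rho> (inv\<^bsub>GG n\<^esub> h) w))" by (simp add: rho_inv[OF that])
    also have "\<dots> = S v (\<rho> (inv\<^bsub>GG n\<^esub> h) w)" by (rule inv[OF that])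
    finally show "cinner (T (\<rho> h v)) w = cinner (\<rho> h (T v)) w"
      by (simp add: T cinner_rho_inv(2)[OF that])
  qed
  ultimately have "T \<in> commutant (\<rho> ` carrier (GG n))" unfolding commutant_def using Tc by blast
  then show ?thesis by (rule bexI[rotated]) (simp add: T)
qed

text \<open>The adjoint demanded by \<open>schur\<close> comes from the same construction applied to
  the conjugate transpose of S, which is again a bounded invariant form.\<close>

lemma invariant_form_scalar:
  fixes S :: "'h \<Rightarrow> 'h \<Rightarrow> complex"
  assumes add: "\<And>u v w. S (u + v) w = S u w + S v w" "\<And>u v w. S u (v + w) = S u v + S u w"
    and scale: "\<And>a v w. S (a *\<^sub>C v) w = a * S v w" "\<And>a v w. S v (a *\<^sub>C w) = cnj a * S v w"
    and bound: "\<And>v w. cmod (S v w) \<le> norm v * norm w"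
    and inv: "\<And>h v w. h \<in> carrier (GG n) \<Longrightarrow> S (\<rho> h v) (\<rho> h w) = S v w"
  obtains s where "\<And>v w. S v w = s * cinner v w"
proof -
  obtain T where T: "T \<in> commutant (\<rho> ` carrier (GG n))" "\<And>v w. cinner (T v) w = S v w"
    using invariant_form_operator[OF assms] by blast
  have "\<exists>T'\<in>commutant (\<rho> ` carrier (GG n)). \<forall>v w. cinner (T' v) w = cnj (S w v)"
  proof (rule invariant_form_operator[of "\<lambda>v w. cnj (S w v)"])
    show "cmod (cnj (S w v)) \<le> norm v * norm w" for v w using bound[of w v] by (simp add: mult.commute)
  qed (simp_all add: add scale inv)
  then obtain T' where T': "T' \<in> commutant (\<rho> ` carrier (GG n))" "\<And>v w. cinner (T' v) w = cnj (S w v)"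
    by blast
  have "cinner (T x) y = cinner x (T' y)" for x y
    using T(2)[of x y] T'(2)[of y x] cinner_commute[of x "T' y"] by simp
  then obtain s where "\<And>v. T v = s *\<^sub>C v" by (rule schur[OF T(1) T'(1)]) blast
  then have "S v w = s * cinner v w" for v w using T(2)[of v w] by (simp add: cinner_scaleC_left)
  then show ?thesis by (rule that)
qed

lemma acts_by_exists:
  fixes X :: "'f::countable board"
  assumes X: "is_board n 0 0 X"
  obtains s where "acts_by X s"
proof -
  let ?E = "escaping n X"
  note bot = escaping_neq_bot[OF X n]
  obtain S where S: "\<And>v w. ((\<lambda>g. cinner (\<rho> g v) w) \<longlongrightarrow> S v w) ?E"
    using escaping_limit_exists[OF X] by metis
  have car: "\<forall>\<^sub>F g in ?E. g \<in> carrier (GG n)"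
    unfolding eventually_escaping using realizations_carrier by blast
  have unique: "S v w = L" if "((\<lambda>g. cinner (\<rho> g v) w) \<longlongrightarrow> L) ?E" for v w L
    using tendsto_unique[OF bot S that] .
  have "\<exists>s. \<forall>v w. S v w = s * cinner v w"
  proof (rule invariant_form_scalar[of S])
    show "S (u + v) w = S u w + S v w" for u v w
    proof (rule unique, rule Lim_transform_eventually[OF tendsto_add[OF S S]])
      show "\<forall>\<^sub>F g in ?E. cinner (\<rho> g u) w + cinner (\<rho> g v) w = cinner (\<rho> g (u + v)) w"
        using car by eventually_elim (simp add: linear_add[OF bounded_linear.linear[OF rho(1)]] cinner_add_left)
    qed
    show "S u (v + w) = S u v + S u w" for u v w
      by (rule unique) (simp add: cinner_add_right tendsto_add[OF S S])
    show "S (a *\<^sub>C v) w = a * S v w" for a v w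
    proof (rule unique, rule Lim_transform_eventually[OF tendsto_mult_left[OF S]])
      show "\<forall>\<^sub>F g in ?E. a * cinner (\<rho> g v) w = cinner (\<rho> g (a *\<^sub>C v)) w"
        using car by eventually_elim (simp add: rho(2) cinner_scaleC_left)
    qed
    show "S v (a *\<^sub>C w) = cnj a * S v w" for a v w
      by (rule unique) (simp add: cinner_scaleC_right tendsto_mult_left[OF S])
    show "cmod (S v w) \<le> norm v * norm w" for v w
    proof (rule tendsto_upperbound[OF tendsto_norm[OF S] _ bot])
      show "\<forall>\<^sub>F g in ?E. cmod (cinner (\<rho> g v) w) \<le> norm v * norm w"
        using car by eventually_elim (metis cmod_cinner_le rho(4))
    qed
    show "S (\<rho> h v) (\<rho> h w) = S v w" if h: "h \<in> carrier (GG n)" for h v w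
    proof (rule unique)
      \<comment> \<open>Conjugation by the inverse of h, in the shape that
        \<open>conj_realizations\<close> produces. Its coefficient at v and w is that of g at
        \<open>\<rho> h v\<close> and \<open>\<rho> h w\<close>, so invariance of the limit follows
        from invariance of the filter.\<close>
      let ?c = "\<lambda>g. inv\<^bsub>GG n\<^esub> h \<otimes>\<^bsub>GG n\<^esub> g \<otimes>\<^bsub>GG n\<^esub> inv\<^bsub>GG n\<^esub> (inv\<^bsub>GG n\<^esub> h)"
      have ih: "inv\<^bsub>GG n\<^esub> h \<in> carrier (GG n)" using h by simp
      have "\<exists>l. \<forall>g\<in>realizations n X l. ?c g \<in> realizations n X k" for k
        by (rule conj_realizations[OF n ih, of X k]) blast
      then have "filterlim ?c ?E ?E"
        unfolding filterlim_iff eventually_escaping by meson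
      from filterlim_compose[OF S this]
      have "((\<lambda>g. cinner (\<rho> (?c g) v) w) \<longlongrightarrow> S v w) ?E" .
      moreover have "\<forall>\<^sub>F g in ?E. cinner (\<rho> (?c g) v) w = cinner (\<rho> g (\<rho> h v)) (\<rho> h w)"
        using car by eventually_elim (use h in \<open>simp add: rho_mult cinner_rho_inv(1)[OF h]\<close>)
      ultimately show "((\<lambda>g. cinner (\<rho> g (\<rho> h v)) (\<rho> h w)) \<longlongrightarrow> S v w) ?E"
        by (rule Lim_transform_eventually)
    qed
  qed blast
  then show ?thesis using that S unfolding acts_by_def by metis
qed

lemma chi_board_class:
  fixes X :: "'f::countable board"
  assumes X: "is_board n 0 0 X" and s: "acts_by X s"
  shows "chi n \<rho> (board_class n 0 0 X) = s"
  unfolding chi_def rhobar_z_elem[OF assms]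
proof (rule the_equality)
  fix t assume t: "\<forall>v. s *\<^sub>C v = t *\<^sub>C (v::'h)"
  obtain v :: 'h where "v \<noteq> 0" using nontrivial by blast
  then show "t = s" using t scaleC_cancel by metis
qed simp

lemma rhobar_z_elem_chi:
  assumes "d \<in> carrier (Delta n)"
  shows "rhobar n \<rho> (z_elem n d) v = chi n \<rho> d *\<^sub>C v"
proof -
  obtain X :: "nat board" where X: "is_board n 0 0 X" "d = board_class n 0 0 X"
    using assms by (auto elim: MorE)
  obtain s where s: "acts_by X s" by (rule acts_by_exists[OF X(1)])
  show ?thesis using rhobar_z_elem[OF X(1) s] chi_board_class[OF X(1) s] X(2) by simp
qed

lemma chi_mult:
  assumes "c \<in> carrier (Delta n)" "d \<in> carrier (Delta n)"
  shows "chi n \<rho> (c \<otimes>\<^bsub>Delta n\<^esub> d) = chi n \<rho> c * chi n \<rho> d"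
proof -
  obtain X :: "nat board" where X: "is_board n 0 0 X" "c = board_class n 0 0 X"
    using assms(1) by (auto elim: MorE)
  obtain Y :: "nat board" where Y: "is_board n 0 0 Y" "d = board_class n 0 0 Y"
    using assms(2) by (auto elim: MorE)
  note D = is_board_disjoint_board[OF X(1) Y(1) n]
  obtain s t r where acts: "acts_by X s" "acts_by Y t" "acts_by (disjoint_board X Y) r"
    using acts_by_exists X(1) Y(1) D by metis
  have "r = s * t" by (rule acts_by_disjoint_board[OF X(1) Y(1) acts nontrivial])
  then show ?thesis
    using chi_board_class[OF X(1) acts(1)] chi_board_class[OF Y(1) acts(2)] chi_board_class[OF D acts(3)]
      Delta_mult[OF X(1) Y(1) n] X(2) Y(2) by simp
qed

end

theorem mainTheorem6:
  fixes n :: nat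
    and \<rho> :: "(nat \<Rightarrow> nat \<Rightarrow> nat) \<Rightarrow> 'h::chilbert_space \<Rightarrow> 'h"
  assumes "n \<ge> 2"
    and "unitary_rep n \<rho>"
    and "irreducible_rep n \<rho>"
  shows "(\<forall>c \<in> center (EndB n \<infinity>). \<exists>s. \<forall>v. rhobar n \<rho> c v = s *\<^sub>C v) \<and>
    (\<forall>c \<in> carrier (Delta n). z_elem n c \<in> center (EndB n \<infinity>) \<and>
       (\<forall>v. rhobar n \<rho> (z_elem n c) v = chi n \<rho> c *\<^sub>C v)) \<and>
    chi n \<rho> \<in> hom (Delta n) Cmult"
proof -
  interpret irreducible_unitary_representation n \<rho>
    by unfold_locales (use assms in auto)
  \<comment> \<open>Each central element is z_d for an unlabelled board d, so the scalar is the
    value of \<open>chi\<close> at d.\<close>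
  have "\<exists>s. \<forall>v. rhobar n \<rho> c v = s *\<^sub>C v" if "c \<in> center (EndB n \<infinity>)" for c
    using center_EndB[OF assms(1) that] rhobar_z_elem_chi by metis
  moreover have "chi n \<rho> \<in> hom (Delta n) Cmult"
    using chi_mult by (auto simp: hom_def Cmult_def)
  ultimately show ?thesis using rhobar_z_elem_chi z_elem_in_center n by blast
qed

end
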